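(* Let $\Lambda$ be a space with measure $\mu$. Suppose that a quaternion kernel $K(x,y)$ on $\Lambda$ has a real diagonal form with eigenvalues $\lambda_k$, i.e. $K(x,y)=\sum_{k=1}^{\infty}\lambda_k u_k(x)u_k^{*}(y)$ with $\lambda_k$ real and $u_k$ an orthonormal system of real quaternion functions on $\Lambda$. Assume that all $\lambda_k\in[0,1]$ and that $\sum_{k=1}^{\infty}\lambda_k<\infty$. Then the kernel $K(x,y)$ defines a Pfaffian point field on $\Lambda$ with finite expected number of points; that is, there is a $\Lambda$-valued random point field with finite expected number of points whose correlation functions with respect to $\mu$ are $R_m(x_1,\ldots,x_m)=\mathrm{Det}_M\left(K(x_i,x_j)\right)_{1\le i,j\le m}$, $m=1,2,\ldots$.
   Context: Quaternions. "Quaternions" are complexified quaternions $q=s+x\mathbf{i}+y\mathbf{j}+z\mathbf{k}\in\mathbb{Q}_{\mathbb{C}}$ with $s,x,y,z\in\mathbb{C}$ (usual quaternion multiplication rules, complex scalars central); real quaternions are those with $s,x,y,z\in\mathbb{R}$. In both cases the conjugate is $q^{*}=s-x\mathbf{i}-y\mathbf{j}-z\mathbf{k}$ (the coefficients are not complex-conjugated). The dual $X^*$ of a quaternion matrix is given by $(X^* )_{lk}=(X_{kl})^*$; $X$ is self-dual if $X^*=X$. A quaternion kernel $K:\Lambda\times\Lambda\to\mathbb{Q}_{\mathbb{C}}$ is self-dual if $K(y,x)=K(x,y)^*$. Moore-Dyson determinant. For an $n\times n$ quaternion matrix $X$, write each permutation $\sigma\in S_n$ as a product of cycles $\sigma=(n_1i_2\ldots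 i_s)(n_2j_2\ldots j_t)\ldots(n_rk_2\ldots k_l)$ where $n_i$ is the largest element of its cycle and $n_1>n_2>\ldots>n_r$. Then $\mathrm{Det}_M(X)=\sum_{\sigma}(-1)^{n-r}\left(X_{n_1i_2}X_{i_2i_3}\ldots X_{i_sn_1}\right)\ldots\left(X_{n_rk_2}X_{k_2k_3}\ldots X_{k_ln_r}\right)$. It is scalar for self-dual $X$. Random point fields. A random point field on $\Lambda$ is a probability measure on the space of countable configurations of points of $\Lambda$ (with finitely many points in every compact subset). $\#(A)$ is the number of points in $A$. A locally integrable $R_k:\Lambda^k\to\mathbb{R}_+$ is the $k$-point correlation function with respect to $\mu$ if for all disjoint measurable $A_1,\ldots,A_m\subset\Lambda$ and non-negative integers $k_i$ with $\sum k_i=k$: $\mathbb{E}\prod_{i=1}^m[\#(A_i)\cdots(\#(A_i)-k_i+1)]=\int_{A_1^{k_1}\times\cdots\times A_m^{k_m}}R_k\,d\mu(x_1)\cdots d\mu(x_k)$. Correlation functions are defined up to sets of measure $0$. The field is Pfaffian with kernel $K$ if $K$ is a self-dual quaternion kernel and $R_m(x_1,\ldots,x_m)=\mathrm{Det}_M(K(x_i,x_j))_{1\le i,j\le m}$ for all $m\ge1$. Diagonal form. Orthonormality of quaternion functions means $\int_\Lambda u_k^*(x)u_l(x)\,d\mu(x)=\delta_{kl}$. The series $\sum_k\lambda_ku_k(x)u_k^*(y)$ is assumed absolutely convergent almost everywhere (finite sums are allowed). *)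

theory Defs
  imports "HOL-Probability.Probability" "HOL-Combinatorics.Combinatorics"
begin

section \<open>Complexified quaternions\<close>

text \<open>\<open>CQuat s x y z\<close> is \<open>s + x i + y j + z k\<close> with complex \<open>s, x, y, z\<close>; the imaginary unit of
  the coefficients is central and unrelated to the quaternion unit \<open>i\<close>.\<close>

datatype cquat = CQuat (qs: complex) (qx: complex) (qy: complex) (qz: complex)

lemma cquat_eq_iff: "p = q \<longleftrightarrow> qs p = qs q \<and> qx p = qx q \<and> qy p = qy q \<and> qz p = qz q"
  by (cases p; cases q) simp

definition qconj :: "cquat \<Rightarrow> cquat" where
  "qconj q = CQuat (qs q) (- qx q) (- qy q) (- qz q)"

definition real_quat :: "cquat \<Rightarrow> bool" where
  "real_quat q \<longleftrightarrow> qs q \<in> \<real> \<and> qx q \<in> \<real> \<and> qy q \<in> \<real> \<and> qz q \<in> \<real>"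

instantiation cquat :: real_algebra_1
begin

definition zero_cquat where "0 = CQuat 0 0 0 0"

definition one_cquat where "1 = CQuat 1 0 0 0"

definition plus_cquat where
  "p + q = CQuat (qs p + qs q) (qx p + qx q) (qy p + qy q) (qz p + qz q)"

definition minus_cquat where
  "p - q = CQuat (qs p - qs q) (qx p - qx q) (qy p - qy q) (qz p - qz q)"

definition uminus_cquat where
  "- q = CQuat (- qs q) (- qx q) (- qy q) (- qz q)"

definition times_cquat where
  "p * q = CQuat
     (qs p * qs q - qx p * qx q - qy p * qy q - qz p * qz q)
     (qs p * qx q + qx p * qs q + qy p * qz q - qz p * qy q)
     (qs p * qy q - qx p * qz q + qy p * qs q + qz p * qx q)
     (qs p * qz q + qx p * qy q - qy p * qx q + qz p * qs q)"

definition scaleR_cquat where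
  "r *\<^sub>R q = CQuat (r *\<^sub>R qs q) (r *\<^sub>R qx q) (r *\<^sub>R qy q) (r *\<^sub>R qz q)"

instance
proof
qed (simp_all only: cquat_eq_iff zero_cquat_def one_cquat_def plus_cquat_def minus_cquat_def
    uminus_cquat_def times_cquat_def scaleR_cquat_def cquat.sel,
    simp_all add: algebra_simps)

end

text \<open>The Euclidean structure of \<open>\<complex>\<^sup>4\<close>, used only as the topology and absolute value
  underlying integrals and infinite sums of quaternions.\<close>

instantiation cquat :: real_inner
begin

definition inner_cquat where
  "inner p q = inner (qs p) (qs q) + inner (qx p) (qx q) + inner (qy p) (qy q) + inner (qz p) (qz q)"

definition norm_cquat where "norm (q::cquat) = sqrt (inner q q)"

definition sgn_cquat where "sgn (q::cquat) = q /\<^sub>R norm q"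

definition dist_cquat where "dist (p::cquat) q = norm (p - q)"

definition uniformity_cquat where
  "(uniformity :: (cquat \<times> cquat) filter) = (INF e\<in>{0 <..}. principal {(x, y). dist x y < e})"

definition open_cquat where
  "open (U :: cquat set) \<longleftrightarrow> (\<forall>x\<in>U. eventually (\<lambda>(x', y). x' = x \<longrightarrow> y \<in> U) uniformity)"

instance
proof
  fix p q r :: cquat and a :: real
  show "dist p q = norm (p - q)" by (rule dist_cquat_def)
  show "sgn p = p /\<^sub>R norm p" by (rule sgn_cquat_def)
  show "norm p = sqrt (inner p p)" by (rule norm_cquat_def)
  show "inner p q = inner q p" by (simp add: inner_cquat_def inner_commute)
  show "inner (p + q) r = inner p r + inner q r"
    by (simp add: inner_cquat_def plus_cquat_def inner_add_left)
  show "inner (a *\<^sub>R p) q = a * inner p q"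
    by (simp add: inner_cquat_def scaleR_cquat_def algebra_simps)
  show "0 \<le> inner p p" by (simp add: inner_cquat_def)
  show "inner p p = 0 \<longleftrightarrow> p = 0"
    by (simp add: inner_cquat_def zero_cquat_def cquat_eq_iff add_nonneg_eq_0_iff)
qed (rule uniformity_cquat_def open_cquat_def)+

end

instantiation cquat :: euclidean_space
begin

definition Basis_cquat where
  "(Basis :: cquat set) =
     (\<lambda>b. CQuat b 0 0 0) ` Basis \<union> (\<lambda>b. CQuat 0 b 0 0) ` Basis \<union>
     (\<lambda>b. CQuat 0 0 b 0) ` Basis \<union> (\<lambda>b. CQuat 0 0 0 b) ` Basis"

instance
proof
  show "(Basis :: cquat set) \<noteq> {}" "finite (Basis :: cquat set)"
    by (auto simp: Basis_cquat_def)
  show "inner p q = (if p = q then 1 else 0)" if "p \<in> Basis" "q \<in> Basis" for p q :: cquat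
    using that unfolding Basis_cquat_def
    by (elim UnE imageE) (auto simp: inner_cquat_def inner_Basis dest: nonzero_Basis)
  show "(\<forall>b\<in>Basis. inner q b = 0) \<longleftrightarrow> q = 0" for q :: cquat
    unfolding Basis_cquat_def ball_Un ball_simps
    by (simp add: inner_cquat_def zero_cquat_def cquat_eq_iff euclidean_all_zero_iff)
qed

end

section \<open>The Moore-Dyson determinant\<close>

text \<open>\<open>n \<times> n\<close> matrices are functions restricted to indices below \<open>n\<close>.\<close>

definition cycle_leaders :: "nat \<Rightarrow> (nat \<Rightarrow> nat) \<Rightarrow> nat set" where
  "cycle_leaders n \<sigma> = {a. a < n \<and> (\<forall>b\<in>orbit \<sigma> a. b \<le> a)}"

definition cycle_prod :: "(nat \<Rightarrow> nat \<Rightarrow> cquat) \<Rightarrow> (nat \<Rightarrow> nat) \<Rightarrow> nat \<Rightarrow> cquat" where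
  "cycle_prod X \<sigma> a =
     prod_list (map (\<lambda>j. X ((\<sigma> ^^ j) a) ((\<sigma> ^^ Suc j) a)) [0..<card (orbit \<sigma> a)])"

text \<open>The factors do not commute: cycles are taken in decreasing order of their largest elements,
  and each cycle is started at its largest element.\<close>

definition moore_dyson_det :: "nat \<Rightarrow> (nat \<Rightarrow> nat \<Rightarrow> cquat) \<Rightarrow> cquat" where
  "moore_dyson_det n X =
     (\<Sum>\<sigma> | \<sigma> permutes {..<n}.
        (- 1) ^ (n - card (cycle_leaders n \<sigma>)) *
        prod_list (map (cycle_prod X \<sigma>) (rev (sorted_list_of_set (cycle_leaders n \<sigma>)))))"

section \<open>Random point fields\<close>

definition configurations :: "'a::topological_space set set" where
  "configurations = {X. countable X \<and> (\<forall>C. compact C \<longrightarrow> finite (X \<inter> C))}"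

definition num_points :: "'a set \<Rightarrow> 'a set \<Rightarrow> ennreal" where
  "num_points A X = emeasure (count_space UNIV) (X \<inter> A)"

text \<open>The \<open>\<sigma>\<close>-algebra on configurations is the smallest one for which the number of points in
  every Borel set is measurable.\<close>

definition configuration_space :: "'a::topological_space set measure" where
  "configuration_space =
     sigma configurations
       {{X \<in> configurations. num_points A X \<in> B} | A B. A \<in> sets borel \<and> B \<in> sets borel}"

definition random_point_field :: "'a::topological_space set measure \<Rightarrow> bool" where
  "random_point_field P \<longleftrightarrow> prob_space P \<and> sets P = sets configuration_space"

text \<open>\<open>#(A) (#(A) - 1) \<dots> (#(A) - k + 1)\<close>. Subtraction on \<open>ennreal\<close> is truncated, which is harmless:
  if \<open>#(A) < k\<close> then one factor is \<open>0\<close> in either reading.\<close>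

definition falling_count :: "'a set \<Rightarrow> nat \<Rightarrow> 'a set \<Rightarrow> ennreal" where
  "falling_count A k X = (\<Prod>j<k. num_points A X - of_nat j)"

text \<open>The product of the powers of \<open>A 0, \<dots>, A (m - 1)\<close> with exponents \<open>ks 0, \<dots>, ks (m - 1)\<close>: the
  first \<open>ks 0\<close> coordinates lie in \<open>A 0\<close>, the next \<open>ks 1\<close> coordinates in \<open>A 1\<close>, and so on.\<close>

definition block_box :: "nat \<Rightarrow> (nat \<Rightarrow> nat) \<Rightarrow> (nat \<Rightarrow> 'a set) \<Rightarrow> (nat \<Rightarrow> 'a) set" where
  "block_box m ks A =
     {x \<in> extensional {..<\<Sum>i<m. ks i}.
        \<forall>i<m. \<forall>j\<in>{(\<Sum>l<i. ks l)..<(\<Sum>l<Suc i. ks l)}. x j \<in> A i}"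

text \<open>Points of the \<open>k\<close>-th power are functions on \<open>{..<k}\<close>. Local integrability is tested on powers
  \<open>C\<^sup>k\<close> of compact sets, since every compact subset of the \<open>k\<close>-th power lies in one of these.\<close>

definition correlation_function ::
    "'a::topological_space measure \<Rightarrow> 'a set measure \<Rightarrow> nat \<Rightarrow> ((nat \<Rightarrow> 'a) \<Rightarrow> real) \<Rightarrow> bool" where
  "correlation_function M P k R \<longleftrightarrow>
     R \<in> borel_measurable (Pi\<^sub>M {..<k} (\<lambda>_. M)) \<and>
     (\<forall>x\<in>space (Pi\<^sub>M {..<k} (\<lambda>_. M)). 0 \<le> R x) \<and>
     (\<forall>C. compact C \<longrightarrow> set_integrable (Pi\<^sub>M {..<k} (\<lambda>_. M)) (Pi\<^sub>E {..<k} (\<lambda>_. C)) R) \<and>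
     (\<forall>m ks A. disjoint_family_on A {..<m} \<and> (\<forall>i<m. A i \<in> sets M) \<and> (\<Sum>i<m. ks i) = k \<longrightarrow>
        (\<integral>\<^sup>+X. (\<Prod>i<m. falling_count (A i) (ks i) X) \<partial>P) =
        (\<integral>\<^sup>+x\<in>block_box m ks A. ennreal (R x) \<partial>Pi\<^sub>M {..<k} (\<lambda>_. M)))"

section \<open>Quaternion kernels and Pfaffian point fields\<close>

text \<open>Kernels are given up to null sets. As correlation functions involve \<open>K x x\<close>, and the diagonal
  may itself be a null set of the product, an almost everywhere statement about a kernel must be
  required on the diagonal separately.\<close>

definition kernel_AE :: "'a measure \<Rightarrow> ('a \<Rightarrow> 'a \<Rightarrow> bool) \<Rightarrow> bool" where
  "kernel_AE M Q \<longleftrightarrow> (AE p in M \<Otimes>\<^sub>M M. Q (fst p) (snd p)) \<and> (AE x in M. Q x x)"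

definition self_dual_kernel :: "'a measure \<Rightarrow> ('a \<Rightarrow> 'a \<Rightarrow> cquat) \<Rightarrow> bool" where
  "self_dual_kernel M K \<longleftrightarrow> kernel_AE M (\<lambda>x y. K y x = qconj (K x y))"

text \<open>Correlation functions are defined up to null sets, so \<open>R\<^sub>m\<close> need only agree almost everywhere
  with the (scalar, real) determinant.\<close>

definition pfaffian_point_field ::
    "'a::topological_space measure \<Rightarrow> ('a \<Rightarrow> 'a \<Rightarrow> cquat) \<Rightarrow> 'a set measure \<Rightarrow> bool" where
  "pfaffian_point_field M K P \<longleftrightarrow>
     random_point_field P \<and> self_dual_kernel M K \<and>
     (\<forall>m\<ge>1. \<exists>R. correlation_function M P m R \<and>
        (AE x in Pi\<^sub>M {..<m} (\<lambda>_. M).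
           moore_dyson_det m (\<lambda>i j. K (x i) (x j)) = of_real (R x)))"

definition orthonormal_quat ::
    "'a measure \<Rightarrow> nat set \<Rightarrow> (nat \<Rightarrow> 'a \<Rightarrow> cquat) \<Rightarrow> bool" where
  "orthonormal_quat M I u \<longleftrightarrow>
     (\<forall>k\<in>I. u k \<in> borel_measurable M) \<and>
     (\<forall>k\<in>I. \<forall>l\<in>I.
        has_bochner_integral M (\<lambda>x. qconj (u k x) * u l x) (if k = l then 1 else 0))"

text \<open>The index set \<open>I\<close> is \<open>UNIV\<close> for a series and \<open>{..<n}\<close> for a finite sum.\<close>

definition real_diagonal_form ::
    "'a measure \<Rightarrow> ('a \<Rightarrow> 'a \<Rightarrow> cquat) \<Rightarrow> nat set \<Rightarrow> (nat \<Rightarrow> real) \<Rightarrow> (nat \<Rightarrow> 'a \<Rightarrow> cquat) \<Rightarrow> bool" where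
  "real_diagonal_form M K I lam u \<longleftrightarrow>
     orthonormal_quat M I u \<and>
     (\<forall>k\<in>I. \<forall>x\<in>space M. real_quat (u k x)) \<and>
     kernel_AE M (\<lambda>x y.
       (\<lambda>k. norm (lam k *\<^sub>R (u k x * qconj (u k y)))) summable_on I \<and>
       K x y = (\<Sum>\<^sub>\<infinity>k\<in>I. lam k *\<^sub>R (u k x * qconj (u k y))))"

end

theory Submission
  imports Defs
begin

text \<open>The kernel is an average of projection kernels: if each index \<open>k\<close> is selected independently with
  probability \<open>\<lambda>\<^sub>k\<close>, the expected correlation functions of the projection kernels
  \<open>K\<^sub>S = \<Sum>\<^sub>k\<^sub>\<in>\<^sub>S u\<^sub>k(x) u\<^sub>k\<^sup>*(y)\<close> of the (almost surely finite) random set \<open>S\<close> are those of \<open>K\<close>, because the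
  Moore-Dyson determinant of \<open>\<Sum>\<^sub>k \<lambda>\<^sub>k u\<^sub>k(x\<^sub>i) u\<^sub>k\<^sup>*(x\<^sub>j)\<close> is affine in each \<open>\<lambda>\<^sub>k\<close>. For a projection kernel of
  rank \<open>n\<close> one samples \<open>n\<close> points with density \<open>Det\<^sub>M(K\<^sub>S(x\<^sub>i, x\<^sub>j)) / n!\<close>; the reproducing property yields
  the lower correlation functions by integrating out points. Everything needed about the determinant
  of a self-dual real quaternion matrix (positivity on Gram matrices, affinity, vanishing for equal
  rows) follows from its invariance under row operations applied simultaneously to the columns,
  which in turn rests on a recursion over the cycles through one index, valid for every choice of
  the index.\<close>

text \<open>Since quaternions do not commute and the Moore-Dyson sum orders its cycles by their
  largest elements, neither row operations nor a relabelling of the points is visible from the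
  definition. Two facts remove the ordering: scalar parts satisfy
  \<open>qre (p * q) = qre (q * p)\<close>, and a cycle product added to that of the reversed cycle
  is the central scalar \<open>p + qconj p\<close>. The algebra is therefore done with
  \<open>moore_re\<close>. Affinity in an eigenvalue comes from Gaussian elimination on a rank-one
  term; real coefficients matter there, because \<open>p * qconj p\<close> must be positive to
  divide by it, whereas complexified quaternions have zero divisors. Summability of the eigenvalues
  enters twice: Borel-Cantelli makes the random set finite, and the bound of the product of
  \<open>1 + lam k\<close> by \<open>exp\<close> of the sum controls all factorial moments of its
  size. Gram minors grow when vectors are added, so the passage from truncations to the whole random
  set is monotone convergence; the same truncations converge entrywise to \<open>K\<close>, which
  identifies its determinant with the expected density.\<close>

definition dlists :: "'a set \<Rightarrow> 'a list set" where
  "dlists J = {l. distinct l \<and> set l \<subseteq> J}"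

lemma finite_dlists [simp]: "finite J \<Longrightarrow> finite (dlists J)"
  using finite_subset_distinct[of J] by (simp add: dlists_def conj_commute)

text \<open>The first row is a separate argument \<open>f\<close>, so that the row at the starting
  point can be replaced by a linear combination of rows while the path continues in the same
  matrix.\<close>

fun row_path :: "(nat \<Rightarrow> nat \<Rightarrow> 'b::monoid_mult) \<Rightarrow> (nat \<Rightarrow> 'b) \<Rightarrow> nat list \<Rightarrow> nat \<Rightarrow> 'b" where
  "row_path X f [] b = f b"
| "row_path X f (c # l) b = f c * row_path X (X c) l b"

lemma row_path_conv_prod_list:
  "row_path X (X a) l b =
     prod_list (map (\<lambda>j. X ((a # l @ [b]) ! j) ((a # l @ [b]) ! Suc j)) [0..<Suc (length l)])"
proof (induction l arbitrary: a)
  case (Cons c l)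
  have "[0..<Suc (length (c # l))] = 0 # map Suc [0..<Suc (length l)]"
    by (simp add: map_Suc_upt upt_conv_Cons del: upt_Suc)
  then show ?case using Cons[of c] by (simp add: comp_def del: upt_Suc)
qed simp

section \<open>Recursion for the Moore-Dyson determinant\<close>

text \<open>Arbitrary index sets replace \<open>{..<n}\<close> because deleting a cycle does not
  leave an initial segment.\<close>

definition leaders :: "nat set \<Rightarrow> (nat \<Rightarrow> nat) \<Rightarrow> nat set" where
  "leaders J \<sigma> = {a \<in> J. \<forall>b\<in>orbit \<sigma> a. b \<le> a}"

definition moore_term :: "nat set \<Rightarrow> (nat \<Rightarrow> nat \<Rightarrow> cquat) \<Rightarrow> (nat \<Rightarrow> nat) \<Rightarrow> cquat" where
  "moore_term J X \<sigma> = (- 1) ^ (card J - card (leaders J \<sigma>)) *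
        prod_list (map (cycle_prod X \<sigma>) (rev (sorted_list_of_set (leaders J \<sigma>))))"

definition moore :: "nat set \<Rightarrow> (nat \<Rightarrow> nat \<Rightarrow> cquat) \<Rightarrow> cquat" where
  "moore J X = (\<Sum>\<sigma> | \<sigma> permutes J. moore_term J X \<sigma>)"

lemma moore_dyson_det_conv_moore: "moore_dyson_det n X = moore {..<n} X"
  by (simp add: moore_dyson_det_def moore_def moore_term_def leaders_def cycle_leaders_def)

lemma moore_empty [simp]: "moore {} X = 1"
  by (simp add: moore_def moore_term_def leaders_def)

section \<open>Splitting off the cycle through one element\<close>

context
  fixes a :: nat and l :: "nat list" and J :: "nat set" and \<tau> \<sigma> :: "nat \<Rightarrow> nat"
  assumes l: "a \<notin> set l" "distinct l" and J: "finite J" "a \<in> J" "set l \<subseteq> J"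
    and \<tau>: "\<tau> permutes (J - {a} - set l)"
    and \<sigma>: "\<sigma> = cycle_of_list (a # l) \<circ> \<tau>"
begin

lemma cycle_comp_permutes: "\<sigma> permutes J"
proof -
  have "cycle_of_list (a # l) permutes J"
    using cycle_permutes[of "a # l"] J by (auto intro: permutes_subset)
  moreover have "\<tau> permutes J" using \<tau> by (rule permutes_subset) auto
  ultimately show ?thesis unfolding \<sigma> by (rule permutes_compose[rotated])
qed

lemma cycle_comp_outside: "x \<notin> set (a # l) \<Longrightarrow> \<sigma> x = \<tau> x"
proof -
  assume x: "x \<notin> set (a # l)"
  have "\<tau> x \<notin> set (a # l)"
  proof (cases "x \<in> J - {a} - set l")
    case True
    then show ?thesis using permutes_in_image[OF \<tau>, of x] by auto
  next
    case False
    then show ?thesis using \<tau> x by (simp add: permutes_def)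
  qed
  then show ?thesis by (simp add: \<sigma> id_outside_supp)
qed

lemma cycle_comp_inside: "x \<in> set (a # l) \<Longrightarrow> \<sigma> x = cycle_of_list (a # l) x"
  using \<tau> by (auto simp: \<sigma> permutes_def)

text \<open>Iterating a cycle rotates its list, and the image of \<open>a\<close> is the head of the
  rotated list. The iterates never leave the cycle, so \<open>\<tau>\<close> does not
  interfere.\<close>

lemma cycle_comp_funpow_inside: "(\<sigma> ^^ n) a = (a # l) ! (n mod Suc (length l))"
proof -
  have d: "distinct (a # l)" using l by simp
  have 1: "((cycle_of_list (a # l)) ^^ n) a = (a # l) ! (n mod Suc (length l))" for n
  proof -
    have "((cycle_of_list (a # l)) ^^ n) a = hd (map ((cycle_of_list (a # l)) ^^ n) (a # l))" by simp
    also have "\<dots> = hd (rotate n (a # l))" using cyclic_rotation[OF d, of n] by simp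
    also have "\<dots> = (a # l) ! (n mod Suc (length l))" by (simp add: hd_rotate_conv_nth)
    finally show ?thesis .
  qed
  show ?thesis
  proof (induction n)
    case (Suc n)
    have "(a # l) ! (n mod Suc (length l)) \<in> set (a # l)" by (rule nth_mem) simp
    then have "\<sigma> ((\<sigma> ^^ n) a) = cycle_of_list (a # l) ((cycle_of_list (a # l) ^^ n) a)"
      using cycle_comp_inside Suc 1 by simp
    then show ?case using 1[of "Suc n"] by simp
  qed simp
qed

lemma cycle_comp_orbit_inside:
  assumes "x \<in> set (a # l)" shows "orbit \<sigma> x = set (a # l)"
proof -
  have p: "permutation \<sigma>" using cycle_comp_permutes J by (auto simp: permutation_permutes)
  have "orbit \<sigma> a = {(\<sigma> ^^ n) a | n. n < Suc (length l)}"
    by (rule orbit_altdef_bounded) (simp_all add: cycle_comp_funpow_inside del: funpow.simps)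
  also have "\<dots> = set (a # l)"
  proof (intro set_eqI iffI)
    fix y assume "y \<in> set (a # l)"
    then obtain n where "n < Suc (length l)" "y = (a # l) ! n" by (auto simp only: in_set_conv_nth list.size add_0 add_Suc_right add_0_right)
    then show "y \<in> {(\<sigma> ^^ n) a | n. n < Suc (length l)}"
      using cycle_comp_funpow_inside[of n] by (intro CollectI exI[of _ n]) simp
  next
    fix y assume "y \<in> {(\<sigma> ^^ n) a | n. n < Suc (length l)}"
    then obtain n where "n < Suc (length l)" "y = (a # l) ! n"
      using cycle_comp_funpow_inside by auto
    then show "y \<in> set (a # l)" using nth_mem[of n "a # l"] by simp
  qed
  finally have *: "orbit \<sigma> a = set (a # l)" .
  have "cyclic_on \<sigma> (set (a # l))"
    unfolding cyclic_on_def using * l by auto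
  then show ?thesis using assms by (rule orbit_cyclic_eq3)
qed

lemma cycle_comp_funpow_outside:
  assumes "x \<in> J - {a} - set l" shows "(\<sigma> ^^ n) x = (\<tau> ^^ n) x \<and> (\<tau> ^^ n) x \<in> J - {a} - set l"
  using assms
proof (induction n)
  case (Suc n)
  then show ?case
    using cycle_comp_outside permutes_in_image[OF \<tau>, of "(\<tau> ^^ n) x"] by auto
qed simp

lemma cycle_comp_orbit_outside:
  assumes "x \<in> J - {a} - set l" shows "orbit \<sigma> x = orbit \<tau> x"
  using cycle_comp_funpow_outside[OF assms] by (simp add: orbit_altdef)

lemma cycle_prod_outside:
  assumes "x \<in> J - {a} - set l" shows "cycle_prod X \<sigma> x = cycle_prod X \<tau> x"
  using cycle_comp_funpow_outside[OF assms]
  by (simp add: cycle_prod_def cycle_comp_orbit_outside[OF assms] del: funpow.simps)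

lemma cycle_prod_inside: "cycle_prod X \<sigma> a = row_path X (X a) l a"
proof -
  have o: "card (orbit \<sigma> a) = Suc (length l)"
    using l by (simp add: cycle_comp_orbit_inside distinct_card)
  \<comment> \<open>At \<open>j = Suc (length l)\<close> the iterate has wrapped around to
    \<open>a\<close>, which the appended \<open>[a]\<close> supplies.\<close>
  have *: "(\<sigma> ^^ j) a = (a # l @ [a]) ! j" if "j \<le> Suc (length l)" for j
    using that by (cases "j = Suc (length l)") 
      (auto simp: cycle_comp_funpow_inside nth_append nth_Cons' le_Suc_eq simp del: funpow.simps)
  show ?thesis
    unfolding cycle_prod_def o row_path_conv_prod_list
  proof (intro arg_cong[where f = prod_list] map_cong refl)
    fix j assume "j \<in> set [0..<Suc (length l)]"
    then have "j \<le> Suc (length l)" "Suc j \<le> Suc (length l)" by auto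
    then show "X ((\<sigma> ^^ j) a) ((\<sigma> ^^ Suc j) a) = X ((a # l @ [a]) ! j) ((a # l @ [a]) ! Suc j)"
      by (simp only: *)
  qed
qed

text \<open>The maximum leads its own cycle, and every member of \<open>l\<close> has
  \<open>a\<close> in its orbit and so leads nothing.\<close>

lemma leaders_cycle_comp:
  assumes "a = Max J" shows "leaders J \<sigma> = insert a (leaders (J - {a} - set l) \<tau>)"
proof (intro set_eqI)
  fix x
  consider "x \<notin> J" | "x = a" | "x \<in> set l" | "x \<in> J - {a} - set l" by blast
  then show "x \<in> leaders J \<sigma> \<longleftrightarrow> x \<in> insert a (leaders (J - {a} - set l) \<tau>)"
  proof cases
    case 1 then show ?thesis using J by (auto simp: leaders_def)
  next
    case 2 then show ?thesis
      using J assms by (auto simp: leaders_def cycle_comp_orbit_inside)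
  next
    case 3
    then have "x \<in> J" "x \<noteq> a" using J l by auto
    then have "x < a" using assms J by (simp add: le_neq_trans)
    then show ?thesis using 3 by (force simp: leaders_def cycle_comp_orbit_inside)
  next
    case 4 then show ?thesis by (auto simp: leaders_def cycle_comp_orbit_outside)
  qed
qed

text \<open>As the largest leader, \<open>a\<close> contributes the leftmost cycle, so its product
  splits off on the left. A cycle of \<open>Suc (length l)\<close> elements removes one leader,
  whence the sign.\<close>

lemma moore_term_cycle_comp:
  assumes "a = Max J"
  shows "moore_term J X \<sigma> = (- 1) ^ length l * row_path X (X a) l a * moore_term (J - {a} - set l) X \<tau>"
proof -
  let ?J = "J - {a} - set l" and ?L = "leaders (J - {a} - set l) \<tau>"
  have L: "?L \<subseteq> ?J" "finite ?L" using J by (auto simp: leaders_def)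
  have aL: "a \<notin> ?L" using L by auto
  have lt: "x < a" if "x \<in> ?L" for x
  proof -
    have "x \<in> J" "x \<noteq> a" using that L by auto
    then show ?thesis using Max_ge[OF J(1), of x] assms by simp
  qed
  have cJ: "card J = card ?J + Suc (length l)"
  proof -
    have "?J = J - set (a # l)" by auto
    moreover have "card (set (a # l)) = Suc (length l)" using l by (simp add: distinct_card)
    moreover have "set (a # l) \<subseteq> J" using J by auto
    ultimately show ?thesis using card_Diff_subset[of "set (a # l)" J] card_mono[OF J(1), of "set (a # l)"]
      by simp
  qed
  have cL: "card (leaders J \<sigma>) = Suc (card ?L)"
    using aL L by (simp add: leaders_cycle_comp[OF assms])
  \<comment> \<open>This keeps the truncated subtraction in the exponent exact.\<close>
  have "card ?L \<le> card ?J" using L J by (intro card_mono) auto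
  then have e: "card J - card (leaders J \<sigma>) = length l + (card ?J - card ?L)"
    using cJ cL by simp
  have "sorted_wrt (<) (sorted_list_of_set ?L @ [a]) \<and> set (sorted_list_of_set ?L @ [a]) = leaders J \<sigma>
      \<and> length (sorted_list_of_set ?L @ [a]) = card (leaders J \<sigma>)"
    using L lt unfolding leaders_cycle_comp[OF assms] by (simp add: sorted_wrt_append aL)
  then have "sorted_list_of_set (leaders J \<sigma>) = sorted_list_of_set ?L @ [a]"
    using L by (subst (asm) sorted_list_of_set_unique) (simp_all add: leaders_cycle_comp[OF assms])
  then have r: "rev (sorted_list_of_set (leaders J \<sigma>)) = a # rev (sorted_list_of_set ?L)" by simp
  have m: "map (cycle_prod X \<sigma>) (rev (sorted_list_of_set ?L)) = map (cycle_prod X \<tau>) (rev (sorted_list_of_set ?L))"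
    using L by (intro map_cong refl) (auto intro!: cycle_prod_outside)
  let ?e = "(- 1 :: cquat) ^ (card ?J - card ?L)"
  \<comment> \<open>Signs are central, so the sign of the remaining cycles can be moved across the
    first cycle product.\<close>
  have comm: "(- 1 :: cquat) ^ n * y = y * (- 1) ^ n" for n y by (induction n) auto
  have "moore_term J X \<sigma> = (- 1) ^ length l * (?e * row_path X (X a) l a) *
      prod_list (map (cycle_prod X \<tau>) (rev (sorted_list_of_set ?L)))"
    unfolding moore_term_def e r list.map m by (simp add: power_add cycle_prod_inside mult.assoc)
  also have "?e * row_path X (X a) l a = row_path X (X a) l a * ?e" by (rule comm)
  finally show ?thesis by (simp add: moore_term_def mult.assoc)
qed

end

text \<open>The list is the orbit of \<open>a\<close> in the order of iteration; undoing this cycle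
  after \<open>\<sigma>\<close> fixes the orbit pointwise.\<close>

lemma permutes_eq_cycle_comp:
  fixes a :: nat
  assumes "finite J" "a \<in> J" "\<sigma> permutes J"
  shows "\<exists>l \<tau>. l \<in> dlists (J - {a}) \<and> \<tau> permutes (J - {a} - set l) \<and> \<sigma> = cycle_of_list (a # l) \<circ> \<tau>"
proof -
  have p: "permutation \<sigma>" using assms by (auto simp: permutation_permutes)
  define cs where "cs = support \<sigma> a"
  obtain l where l: "cs = a # l"
    unfolding cs_def using upt_conv_Cons[OF least_power_of_permutation(2)[OF p, of a]] by simp
  have d: "distinct cs" unfolding cs_def by (rule cycle_of_permutation[OF p])
  have eq: "cycle_of_list cs x = \<sigma> x" if "x \<in> set cs" for x
    using cycle_restrict[OF p] that unfolding cs_def by metis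
  have inJ: "set cs \<subseteq> J"
    unfolding cs_def support_set[OF p] using permutes_in_image[OF permutes_funpow[OF assms(3)], of _ a] assms(2)
    by blast
  define \<tau> where "\<tau> = inv (cycle_of_list cs) \<circ> \<sigma>"
  have cp: "cycle_of_list cs permutes J" using cycle_permutes inJ by (rule permutes_subset)
  have "\<tau> permutes J" unfolding \<tau>_def
    by (rule permutes_compose[OF assms(3) permutes_inv[OF cp]])
  moreover have "\<tau> x = x" if "x \<in> set cs" for x
    using eq[OF that] permutes_inverses(2)[OF cp, of x] by (simp add: \<tau>_def)
  ultimately have "\<tau> permutes (J - set cs)" by (rule permutes_superset) simp
  moreover have "J - set cs = J - {a} - set l" using l by auto
  moreover have "\<sigma> = cycle_of_list cs \<circ> \<tau>"
    using permutes_inverses(1)[OF cp] by (auto simp: \<tau>_def)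
  moreover have "l \<in> dlists (J - {a})" using l d inJ by (auto simp: dlists_def)
  ultimately show ?thesis unfolding l by (intro exI[of _ l] exI[of _ \<tau>]) simp
qed

text \<open>The list is recovered from the composite: its length from the orbit of \<open>a\<close>,
  its entries from the iterates at \<open>a\<close>. Injectivity of the cycle then determines
  \<open>\<tau>\<close>.\<close>

lemma cycle_comp_inj:
  fixes a :: nat
  assumes J: "finite J" "a \<in> J" and l: "l \<in> dlists (J - {a})" "l' \<in> dlists (J - {a})"
    and \<tau>: "\<tau> permutes (J - {a} - set l)" "\<tau>' permutes (J - {a} - set l')"
    and eq: "cycle_of_list (a # l) \<circ> \<tau> = cycle_of_list (a # l') \<circ> \<tau>'"
  shows "l = l' \<and> \<tau> = \<tau>'"
proof -
  define \<sigma> where "\<sigma> = cycle_of_list (a # l) \<circ> \<tau>"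
  have \<sigma>': "\<sigma> = cycle_of_list (a # l') \<circ> \<tau>'" using eq by (simp add: \<sigma>_def)
  have L: "a \<notin> set l" "distinct l" "set l \<subseteq> J" "a \<notin> set l'" "distinct l'" "set l' \<subseteq> J"
    using l by (auto simp: dlists_def)
  note f = cycle_comp_funpow_inside[OF L(1,2) J L(3) \<tau>(1) \<sigma>_def]
    and f' = cycle_comp_funpow_inside[OF L(4,5) J L(6) \<tau>(2) \<sigma>']
  have "set (a # l) = set (a # l')"
    using cycle_comp_orbit_inside[OF L(1,2) J L(3) \<tau>(1) \<sigma>_def, of a]
      cycle_comp_orbit_inside[OF L(4,5) J L(6) \<tau>(2) \<sigma>', of a] by simp
  moreover have "distinct (a # l)" "distinct (a # l')" using L by auto
  ultimately have len: "length (a # l) = length (a # l')" by (metis distinct_card)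
  have "a # l = a # l'"
  proof (rule nth_equalityI[OF len])
    fix n assume "n < length (a # l)"
    then show "(a # l) ! n = (a # l') ! n" using f[of n] f'[of n] len by simp
  qed
  moreover from this have "\<tau> = \<tau>'"
    using eq permutes_inj[OF cycle_permutes[of "a # l"]] by (simp add: fun_eq_iff inj_def)
  ultimately show ?thesis by simp
qed

text \<open>Permutations of \<open>J\<close> correspond bijectively to a cycle through
  \<open>a\<close> together with a permutation of the rest. At the maximum this holds for arbitrary
  quaternion matrices, since the cycle of \<open>a\<close> comes first in every term.\<close>

lemma moore_rec:
  assumes "finite J" "J \<noteq> {}" "a = Max J"
  shows "moore J X = (\<Sum>l\<in>dlists (J - {a}). (- 1) ^ length l * row_path X (X a) l a * moore (J - {a} - set l) X)"
proof -
  have a: "a \<in> J" using assms by simp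
  let ?h = "\<lambda>(l, \<tau>). cycle_of_list (a # l) \<circ> \<tau>"
  let ?S = "Sigma (dlists (J - {a})) (\<lambda>l. {\<tau>. \<tau> permutes (J - {a} - set l)})"
  have "(\<Sum>l\<in>dlists (J - {a}). (- 1) ^ length l * row_path X (X a) l a * moore (J - {a} - set l) X) =
     (\<Sum>(l, \<tau>)\<in>?S. (- 1) ^ length l * row_path X (X a) l a * moore_term (J - {a} - set l) X \<tau>)"
    using assms by (subst sum.Sigma[symmetric]) 
      (auto simp: moore_def sum_distrib_left finite_permutations)
  also have "\<dots> = (\<Sum>x\<in>?S. moore_term J X (?h x))"
  proof (rule sum.cong[OF refl])
    fix x assume "x \<in> ?S"
    then obtain l \<tau> where x: "x = (l, \<tau>)" and l: "l \<in> dlists (J - {a})"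
      and t: "\<tau> permutes (J - {a} - set l)" by blast
    have "a \<notin> set l" "distinct l" "set l \<subseteq> J" using l by (auto simp: dlists_def)
    from moore_term_cycle_comp[OF this(1,2) assms(1) a this(3) t refl assms(3)] x
    show "(case x of (l, \<tau>) \<Rightarrow> (- 1) ^ length l * row_path X (X a) l a * moore_term (J - {a} - set l) X \<tau>) =
      moore_term J X (?h x)" by simp
  qed
  also have "\<dots> = (\<Sum>\<sigma>\<in>?h ` ?S. moore_term J X \<sigma>)"
  proof (rule sum.reindex_cong[symmetric, OF _ refl refl], rule inj_onI)
    fix x y assume "x \<in> ?S" "y \<in> ?S" "?h x = ?h y"
    then show "x = y" using cycle_comp_inj[OF assms(1) a, of "fst x" "fst y" "snd x" "snd y"]
      by (cases x; cases y) simp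
  qed
  also have "?h ` ?S = {\<sigma>. \<sigma> permutes J}"
  proof (intro subset_antisym subsetI)
    fix \<sigma> assume "\<sigma> \<in> ?h ` ?S"
    then obtain l \<tau> where l: "l \<in> dlists (J - {a})" and t: "\<tau> permutes (J - {a} - set l)"
      and s: "\<sigma> = cycle_of_list (a # l) \<circ> \<tau>" by auto
    have "a \<notin> set l" "distinct l" "set l \<subseteq> J" using l by (auto simp: dlists_def)
    from cycle_comp_permutes[OF this(1,2) assms(1) a this(3) t s]
    show "\<sigma> \<in> {\<sigma>. \<sigma> permutes J}" by simp
  next
    fix \<sigma> assume "\<sigma> \<in> {\<sigma>. \<sigma> permutes J}"
    then obtain l \<tau> where "l \<in> dlists (J - {a})" "\<tau> permutes (J - {a} - set l)"
      "\<sigma> = cycle_of_list (a # l) \<circ> \<tau>"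
      using permutes_eq_cycle_comp[OF assms(1) a, of \<sigma>] by blast
    then show "\<sigma> \<in> ?h ` ?S" by (intro image_eqI[of _ _ "(l, \<tau>)"]) simp_all
  qed
  finally show ?thesis by (simp add: moore_def)
qed

section \<open>Quaternion algebra\<close>

lemma cquat_sel [simp]:
  "qs 0 = 0" "qx 0 = 0" "qy 0 = 0" "qz 0 = 0"
  "qs 1 = 1" "qx 1 = 0" "qy 1 = 0" "qz 1 = 0"
  "qs (p + q) = qs p + qs q" "qx (p + q) = qx p + qx q" "qy (p + q) = qy p + qy q" "qz (p + q) = qz p + qz q"
  "qs (p - q) = qs p - qs q" "qx (p - q) = qx p - qx q" "qy (p - q) = qy p - qy q" "qz (p - q) = qz p - qz q"
  "qs (- q) = - qs q" "qx (- q) = - qx q" "qy (- q) = - qy q" "qz (- q) = - qz q"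
  "qs (r *\<^sub>R q) = r *\<^sub>R qs q" "qx (r *\<^sub>R q) = r *\<^sub>R qx q" "qy (r *\<^sub>R q) = r *\<^sub>R qy q" "qz (r *\<^sub>R q) = r *\<^sub>R qz q"
  "qs (qconj q) = qs q" "qx (qconj q) = - qx q" "qy (qconj q) = - qy q" "qz (qconj q) = - qz q"
  by (simp_all add: zero_cquat_def one_cquat_def plus_cquat_def minus_cquat_def uminus_cquat_def
      scaleR_cquat_def qconj_def)

lemma cquat_mult_sel:
  "qs (p * q) = qs p * qs q - qx p * qx q - qy p * qy q - qz p * qz q"
  "qx (p * q) = qs p * qx q + qx p * qs q + qy p * qz q - qz p * qy q"
  "qy (p * q) = qs p * qy q - qx p * qz q + qy p * qs q + qz p * qx q"
  "qz (p * q) = qs p * qz q + qx p * qy q - qy p * qx q + qz p * qs q"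
  by (simp_all add: times_cquat_def)

lemma cquat_of_real_sel [simp]:
  "qs (of_real r) = of_real r" "qx (of_real r) = 0" "qy (of_real r) = 0" "qz (of_real r) = 0"
  by (simp_all add: of_real_def)

lemma qconj_simps [simp]:
  "qconj (p + q) = qconj p + qconj q" "qconj (p - q) = qconj p - qconj q" "qconj (- p) = - qconj p"
  "qconj (r *\<^sub>R p) = r *\<^sub>R qconj p" "qconj 0 = 0" "qconj 1 = 1" "qconj (qconj p) = p"
  "qconj (of_real r) = of_real r"
  by (simp_all add: cquat_eq_iff)

lemma qconj_mult [simp]: "qconj (p * q) = qconj q * qconj p"
  by (simp add: cquat_eq_iff cquat_mult_sel algebra_simps)

lemma qconj_sum: "qconj (\<Sum>i\<in>A. f i) = (\<Sum>i\<in>A. qconj (f i))"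
  by (induction A rule: infinite_finite_induct) auto

lemma real_quat_intros [simp, intro]:
  "real_quat 0" "real_quat 1" "real_quat (of_real r)"
  "real_quat p \<Longrightarrow> real_quat q \<Longrightarrow> real_quat (p + q)"
  "real_quat p \<Longrightarrow> real_quat q \<Longrightarrow> real_quat (p - q)"
  "real_quat p \<Longrightarrow> real_quat q \<Longrightarrow> real_quat (p * q)"
  "real_quat p \<Longrightarrow> real_quat (- p)"
  "real_quat p \<Longrightarrow> real_quat (r *\<^sub>R p)"
  "real_quat p \<Longrightarrow> real_quat (qconj p)"
  by (auto simp: real_quat_def cquat_mult_sel scaleR_conv_of_real)

lemma real_quat_sum: "(\<And>i. i \<in> A \<Longrightarrow> real_quat (f i)) \<Longrightarrow> real_quat (\<Sum>i\<in>A. f i)"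
  by (induction A rule: infinite_finite_induct) auto

definition qre :: "cquat \<Rightarrow> real" where "qre q = Re (qs q)"

lemma qre_simps [simp]:
  "qre 0 = 0" "qre 1 = 1" "qre (p + q) = qre p + qre q" "qre (p - q) = qre p - qre q"
  "qre (- p) = - qre p" "qre (r *\<^sub>R p) = r * qre p" "qre (qconj p) = qre p" "qre (of_real r) = r"
  by (simp_all add: qre_def)

lemma qre_mult_of_real [simp]: "qre (of_real r * p) = r * qre p" "qre (p * of_real r) = r * qre p"
  by (simp_all add: qre_def cquat_mult_sel)

lemma qre_sum: "qre (\<Sum>i\<in>A. f i) = (\<Sum>i\<in>A. qre (f i))"
  by (induction A rule: infinite_finite_induct) auto

text \<open>The scalar part behaves like a trace; this is what allows a cycle product to be started
  anywhere.\<close>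

lemma qre_mult_commute: "qre (p * q) = qre (q * p)"
  by (simp add: qre_def cquat_mult_sel algebra_simps)

lemma real_quat_add_qconj: "real_quat p \<Longrightarrow> p + qconj p = of_real (2 * qre p)"
  by (auto simp: cquat_eq_iff real_quat_def qre_def complex_is_Real_iff complex_eq_iff simp del: of_real_mult)

lemma self_conj_real_quat: "real_quat p \<Longrightarrow> qconj p = p \<Longrightarrow> p = of_real (qre p)"
  by (auto simp: cquat_eq_iff real_quat_def qre_def complex_is_Real_iff complex_eq_iff)

text \<open>The sum \<open>p + qconj p\<close> is a real scalar, hence central, and can be pulled
  out from between \<open>a\<close> and \<open>b\<close>.\<close>

lemma qre_mult_add_qconj:
  "real_quat p \<Longrightarrow> qre (a * p * b) + qre (a * qconj p * b) = 2 * (qre p * qre (a * b))"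
proof -
  assume "real_quat p"
  have "qre (a * p * b) + qre (a * qconj p * b) = qre (a * (p + qconj p) * b)"
    by (simp add: algebra_simps)
  also have "\<dots> = qre (a * of_real (2 * qre p) * b)" by (simp only: real_quat_add_qconj[OF \<open>real_quat p\<close>])
  also have "a * of_real (2 * qre p) * b = (2 * qre p) *\<^sub>R (a * b)"
    by (simp add: of_real_def)
  finally show ?thesis by simp
qed

text \<open>Makes a nonzero real quaternion invertible. With complex coefficients
  \<open>p * qconj p\<close> can vanish for nonzero \<open>p\<close>.\<close>

lemma real_quat_mult_qconj:
  assumes "real_quat p" shows "p * qconj p = of_real ((norm p)\<^sup>2)" "qconj p * p = of_real ((norm p)\<^sup>2)"
  using assms unfolding power2_norm_eq_inner
  by (auto simp: real_quat_def complex_is_Real_iff cquat_eq_iff cquat_mult_sel complex_eq_iff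
      inner_cquat_def inner_complex_def)

section \<open>Sums over lists without repetition\<close>

text \<open>Such a pair stands for the two arcs of a cycle cut at two of its elements, or for the
  remainders of two disjoint cycles.\<close>

definition dpairs :: "'a set \<Rightarrow> ('a list \<times> 'a list) set" where
  "dpairs J = {(l, l'). distinct (l @ l') \<and> set (l @ l') \<subseteq> J}"

lemma finite_dpairs [simp]: "finite J \<Longrightarrow> finite (dpairs J)"
  by (rule finite_subset[of _ "dlists J \<times> dlists J"], force simp: dpairs_def dlists_def, simp)

lemma sum_dlists_nested:
  "finite J \<Longrightarrow> (\<Sum>l\<in>dlists J. \<Sum>l'\<in>dlists (J - set l). g l l') = (\<Sum>(l, l')\<in>dpairs J. g l l')"
proof -
  assume "finite J"
  then have "(\<Sum>l\<in>dlists J. \<Sum>l'\<in>dlists (J - set l). g l l') =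
     (\<Sum>(l, l')\<in>Sigma (dlists J) (\<lambda>l. dlists (J - set l)). g l l')"
    by (intro sum.Sigma) auto
  also have "Sigma (dlists J) (\<lambda>l. dlists (J - set l)) = dpairs J"
    by (auto simp: dlists_def dpairs_def)
  finally show ?thesis .
qed

text \<open>Since \<open>b\<close> occurs at most once, a list containing it is cut at
  \<open>b\<close> in a unique way.\<close>

lemma sum_dlists_split:
  assumes "finite J" "b \<in> J"
  shows "(\<Sum>l\<in>dlists J. h l) =
    (\<Sum>l\<in>dlists (J - {b}). h l) + (\<Sum>(l, l')\<in>dpairs (J - {b}). h (l @ b # l'))"
proof -
  let ?f = "\<lambda>(l, l'). l @ b # l'"
  have "dlists J = dlists (J - {b}) \<union> ?f ` dpairs (J - {b})"
  proof (intro set_eqI iffI)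
    fix l assume l: "l \<in> dlists J"
    show "l \<in> dlists (J - {b}) \<union> ?f ` dpairs (J - {b})"
    proof (cases "b \<in> set l")
      case True
      then obtain l1 l2 where "l = l1 @ b # l2" by (meson split_list)
      moreover from this have "(l1, l2) \<in> dpairs (J - {b})" using l by (auto simp: dlists_def dpairs_def)
      ultimately show ?thesis by force
    qed (use l in \<open>auto simp: dlists_def\<close>)
  qed (use assms in \<open>auto simp: dlists_def dpairs_def\<close>)
  moreover have "dlists (J - {b}) \<inter> ?f ` dpairs (J - {b}) = {}" by (auto simp: dlists_def)
  ultimately have "sum h (dlists J) = sum h (dlists (J - {b})) + sum h (?f ` dpairs (J - {b}))"
    using assms by (simp add: sum.union_disjoint)
  also have "sum h (?f ` dpairs (J - {b})) = (\<Sum>(l, l')\<in>dpairs (J - {b}). h (l @ b # l'))"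
  proof (rule sum.reindex_cong[OF _ refl])
    show "inj_on ?f (dpairs (J - {b}))"
    proof (rule inj_onI)
      fix p q assume "p \<in> dpairs (J - {b})" "q \<in> dpairs (J - {b})" "?f p = ?f q"
      moreover obtain l1 l2 where "p = (l1, l2)" by (cases p)
      moreover obtain l3 l4 where "q = (l3, l4)" by (cases q)
      moreover have "b \<notin> set l1" "b \<notin> set l2" using calculation by (auto simp: dpairs_def)
      ultimately show "p = q" using append_Cons_eq_iff[of b l1 l2 l3 l4] by simp
    qed
  qed auto
  finally show ?thesis .
qed

lemma sum_dpairs_swap: "(\<Sum>(l, l')\<in>dpairs J. g l l') = (\<Sum>(l, l')\<in>dpairs J. g l' l)"
  by (rule sum.reindex_bij_witness[of _ "\<lambda>(l, l'). (l', l)" "\<lambda>(l, l'). (l', l)"])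
    (auto simp: dpairs_def)

lemma sum_dpairs_rev: "(\<Sum>(l, l')\<in>dpairs J. g l l') = (\<Sum>(l, l')\<in>dpairs J. g l (rev l'))"
  by (rule sum.reindex_bij_witness[of _ "\<lambda>(l, l'). (l, rev l')" "\<lambda>(l, l'). (l, rev l')"])
    (auto simp: dpairs_def)

lemma sum_dlists_rev: "(\<Sum>l\<in>dlists J. g l) = (\<Sum>l\<in>dlists J. g (rev l))"
  by (rule sum.reindex_bij_witness[of _ rev rev]) (auto simp: dlists_def)

lemma sum_dlists_Cons:
  assumes "finite J"
  shows "(\<Sum>l\<in>dlists J. h l) = h [] + (\<Sum>a\<in>J. \<Sum>l\<in>dlists (J - {a}). h (a # l))"
proof -
  have "dlists J = insert [] ((\<lambda>(a, l). a # l) ` Sigma J (\<lambda>a. dlists (J - {a})))"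
  proof (intro set_eqI iffI)
    fix l assume "l \<in> dlists J"
    then show "l \<in> insert [] ((\<lambda>(a, l). a # l) ` Sigma J (\<lambda>a. dlists (J - {a})))"
      by (cases l) (auto simp: dlists_def)
  qed (auto simp: dlists_def)
  then have "(\<Sum>l\<in>dlists J. h l) = h [] + sum h ((\<lambda>(a, l). a # l) ` Sigma J (\<lambda>a. dlists (J - {a})))"
    using assms by (simp, subst sum.insert) auto
  also have "sum h ((\<lambda>(a, l). a # l) ` Sigma J (\<lambda>a. dlists (J - {a}))) =
     (\<Sum>(a, l)\<in>Sigma J (\<lambda>a. dlists (J - {a})). h (a # l))"
    by (rule sum.reindex_cong[OF _ refl]) (auto simp: inj_on_def)
  finally show ?thesis using assms by (simp add: sum.Sigma)
qed

section \<open>The real determinant of a self-dual matrix\<close>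

lemma row_path_append: "row_path X f (l @ c # l') b = row_path X f l c * row_path X (X c) l' b"
  by (induction l arbitrary: f) (auto simp: mult.assoc)

lemma row_path_cong:
  assumes "\<And>c. c \<in> insert b (set l) \<Longrightarrow> f c = g c"
    "\<And>c d. c \<in> set l \<Longrightarrow> d \<in> insert b (set l) \<Longrightarrow> X c d = Y c d"
  shows "row_path X f l b = row_path Y g l b"
  using assms
proof (induction l arbitrary: f g)
  case (Cons c l)
  have "row_path X (X c) l b = row_path Y (Y c) l b" by (rule Cons.IH) (auto intro: Cons.prems)
  then show ?case using Cons.prems by simp
qed simp

lemma row_path_add:
  fixes X :: "nat \<Rightarrow> nat \<Rightarrow> cquat"
  shows "row_path X (\<lambda>c. f c + g c) l b = row_path X f l b + row_path X g l b"
  by (cases l) (simp_all add: distrib_right)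

lemma row_path_mult: "row_path X (\<lambda>c. q * f c) l b = q * row_path X f l b"
  by (cases l) (simp_all add: mult.assoc)

lemma row_path_compose: "row_path (\<lambda>a b. X (\<phi> a) (\<phi> b)) (\<lambda>c. f (\<phi> c)) l b = row_path X f (map \<phi> l) (\<phi> b)"
proof (induction l arbitrary: f)
  case (Cons c l)
  show ?case using Cons[of "X (\<phi> c)"] by simp
qed simp

text \<open>Demanded at all indices, so that passing to a smaller index set or renaming indices
  carries no side conditions.\<close>

definition self_dual_real :: "(nat \<Rightarrow> nat \<Rightarrow> cquat) \<Rightarrow> bool" where
  "self_dual_real X \<longleftrightarrow> (\<forall>i j. X j i = qconj (X i j) \<and> real_quat (X i j))"

lemma self_dual_realD:
  assumes "self_dual_real X" shows "qconj (X i j) = X j i" "real_quat (X i j)"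
  using assms unfolding self_dual_real_def by metis+

lemma real_quat_row_path:
  assumes "self_dual_real X" "\<And>c. real_quat (f c)" shows "real_quat (row_path X f l b)"
  using assms(2) by (induction l arbitrary: f) (simp_all add: self_dual_realD(2)[OF assms(1)])

text \<open>Conjugation reverses products and self-duality reverses each edge.\<close>

lemma row_path_rev:
  assumes "self_dual_real X" shows "row_path X (X a) (rev l) b = qconj (row_path X (X b) l a)"
  by (induction l arbitrary: b) (simp_all add: self_dual_realD(1)[OF assms] row_path_append)

lemma qre_row_path_rotate:
  "qre (row_path X (X a) (l @ b # l') a) = qre (row_path X (X b) (l' @ a # l) b)"
  unfolding row_path_append by (rule qre_mult_commute)

definition moore_re :: "nat set \<Rightarrow> (nat \<Rightarrow> nat \<Rightarrow> cquat) \<Rightarrow> real" where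
  "moore_re J X = qre (moore J X)"

lemma moore_re_empty [simp]: "moore_re {} X = 1" by (simp add: moore_re_def)

text \<open>Reversing a cycle conjugates its product, so the sum over the cycles through the maximal
  element only sees scalar parts.\<close>

lemma moore_conv_moore_re:
  assumes "finite J" "self_dual_real X" shows "moore J X = of_real (moore_re J X)"
  using assms(1)
proof (induction "card J" arbitrary: J rule: less_induct)
  case less
  show ?case
  proof (cases "J = {}")
    case False
    define a where "a = Max J"
    have a: "a \<in> J" using False less.prems by (simp add: a_def)
    define c where "c l = (- 1) ^ length l * moore_re (J - {a} - set l) X" for l
    let ?p = "\<lambda>l. row_path X (X a) l a"
    have "moore (J - {a} - set l) X = of_real (moore_re (J - {a} - set l) X)" if "l \<in> dlists (J - {a})" for l
      using less.prems a by (intro less.hyps psubset_card_mono) auto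
    then have m: "moore J X = (\<Sum>l\<in>dlists (J - {a}). c l *\<^sub>R ?p l)"
      unfolding moore_rec[OF less.prems False a_def]
      by (intro sum.cong refl) (auto simp: c_def of_real_def minus_one_power_iff)
    have "qconj (moore J X) = (\<Sum>l\<in>dlists (J - {a}). c l *\<^sub>R qconj (?p l))"
      by (simp add: m qconj_sum)
    \<comment> \<open>Reversing \<open>l\<close> changes neither its length nor its set, so the real
      coefficient \<open>c l\<close> is preserved.\<close>
    also have "\<dots> = moore J X"
      unfolding m row_path_rev[OF assms(2), symmetric]
      by (subst (2) sum_dlists_rev) (simp add: c_def)
    finally have "qconj (moore J X) = moore J X" .
    moreover have "real_quat (moore J X)"
      unfolding m by (intro real_quat_sum real_quat_intros real_quat_row_path assms(2) self_dual_realD(2)[OF assms(2)])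
    ultimately show ?thesis unfolding moore_re_def by (intro self_conj_real_quat)
  qed simp
qed

text \<open>The complementary minor is a real scalar, so the scalar part of each term falls on the
  cycle product alone.\<close>

lemma moore_re_rec_Max:
  assumes "finite J" "J \<noteq> {}" "a = Max J" "self_dual_real X"
  shows "moore_re J X = (\<Sum>l\<in>dlists (J - {a}). (- 1) ^ length l * qre (row_path X (X a) l a) * moore_re (J - {a} - set l) X)"
  unfolding moore_re_def[of J] moore_rec[OF assms(1-3)] qre_sum
  using assms by (intro sum.cong refl) (auto simp: moore_conv_moore_re minus_one_power_iff)

text \<open>The recursion holds at every element, because a pair of disjoint cycles, or a cycle through
  two given elements, can be read off starting from either of them.\<close>

lemma moore_re_rec:
  assumes "finite J" "a \<in> J" "self_dual_real X"
  shows "moore_re J X = (\<Sum>l\<in>dlists (J - {a}). (- 1) ^ length l * qre (row_path X (X a) l a) * moore_re (J - {a} - set l) X)"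
  using assms(1,2)
proof (induction "card J" arbitrary: J a rule: less_induct)
  case less
  define E where "E a = (\<Sum>l\<in>dlists (J - {a}). (- 1) ^ length l * qre (row_path X (X a) l a) * moore_re (J - {a} - set l) X)" for a
  define C where "C a l = qre (row_path X (X a) l a)" for a l
  \<comment> \<open>In the first sum \<open>a\<close> and \<open>b\<close> lie on different cycles,
    the second cycle being obtained from the induction hypothesis at \<open>b\<close>. In the second
    sum \<open>b\<close> lies on the cycle of \<open>a\<close>; it lengthens the list by one and so
    changes the sign.\<close>
  have E: "E a = (\<Sum>(l, l')\<in>dpairs (J - {a, b}). (- 1) ^ (length l + length l') * (C a l * C b l') * moore_re (J - {a, b} - set l - set l') X)
     + (\<Sum>(l, l')\<in>dpairs (J - {a, b}). (- 1) ^ (Suc (length l + length l')) * C a (l @ b # l') * moore_re (J - {a, b} - set l - set l') X)"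
    if ab: "a \<in> J" "b \<in> J" "a \<noteq> b" for a b
  proof -
    have fin: "finite (J - {a})" "finite (J - {a} - {b})" using less.prems by auto
    have bJ: "b \<in> J - {a}" using ab by auto
    have Jab: "J - {a} - {b} = J - {a, b}" by auto
    have rec: "moore_re (J - {a} - set l) X = (\<Sum>l'\<in>dlists (J - {a, b} - set l). (- 1) ^ length l' * C b l' * moore_re (J - {a, b} - set l - set l') X)"
      if l: "l \<in> dlists (J - {a, b})" for l
    proof -
      have "b \<in> J - {a} - set l" using l ab by (auto simp: dlists_def)
      moreover have "card (J - {a} - set l) < card J" using less.prems ab by (intro psubset_card_mono) auto
      moreover have "J - {a} - set l - {b} = J - {a, b} - set l" by auto
      ultimately show ?thesis using less.hyps[of "J - {a} - set l" b] less.prems by (simp add: C_def)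
    qed
    show ?thesis
      unfolding E_def sum_dlists_split[OF fin(1) bJ] Jab
    proof (intro arg_cong2[where f = "(+)"])
      show "(\<Sum>l\<in>dlists (J - {a, b}). (- 1) ^ length l * qre (row_path X (X a) l a) * moore_re (J - {a} - set l) X) =
        (\<Sum>(l, l')\<in>dpairs (J - {a, b}). (- 1) ^ (length l + length l') * (C a l * C b l') * moore_re (J - {a, b} - set l - set l') X)"
        using less.prems by (subst sum_dlists_nested[symmetric])
          (auto intro!: sum.cong simp: rec sum_distrib_left power_add C_def mult_ac)
      show "(\<Sum>(l, l')\<in>dpairs (J - {a, b}). (- 1) ^ length (l @ b # l') * qre (row_path X (X a) (l @ b # l') a) * moore_re (J - {a} - set (l @ b # l')) X) =
        (\<Sum>(l, l')\<in>dpairs (J - {a, b}). (- 1) ^ (Suc (length l + length l')) * C a (l @ b # l') * moore_re (J - {a, b} - set l - set l') X)"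
      proof (intro sum.cong refl, clarify)
        fix l l'
        have "J - {a} - set (l @ b # l') = J - {a, b} - set l - set l'" by auto
        then show "(- 1) ^ length (l @ b # l') * qre (row_path X (X a) (l @ b # l') a) * moore_re (J - {a} - set (l @ b # l')) X
          = (- 1) ^ (Suc (length l + length l')) * C a (l @ b # l') * moore_re (J - {a, b} - set l - set l') X"
          by (simp add: C_def)
      qed
    qed
  qed
  have "E a = E b" if ab: "a \<in> J" "b \<in> J" "a \<noteq> b" for a b
  proof -
    have ba: "J - {b, a} = J - {a, b}" by auto
    have D: "J - {a, b} - set l' - set l = J - {a, b} - set l - set l'" for l l' by auto
    have sg: "(- 1 :: real) ^ (length l' + length l) = (- 1) ^ (length l + length l')" for l l' :: "nat list"
      by (simp only: add.commute)
    show ?thesis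
      unfolding E[OF ab] E[OF ab(2,1) ab(3)[symmetric]] ba
      by (intro arg_cong2[where f = "(+)"]; subst sum_dpairs_swap, intro sum.cong refl)
        (auto simp: D sg C_def qre_row_path_rotate[of X a _ b] mult.commute)
  qed
  then have "E a = E (Max J)" using less.prems by (metis Max_in empty_iff)
  also have "\<dots> = moore_re J X"
    unfolding E_def using less.prems assms(3) by (intro moore_re_rec_Max[symmetric]) auto
  finally show ?case by (simp add: E_def)
qed

lemma moore_re_cong:
  assumes "finite J" "self_dual_real X" "self_dual_real Y" "\<And>a b. a \<in> J \<Longrightarrow> b \<in> J \<Longrightarrow> X a b = Y a b"
  shows "moore_re J X = moore_re J Y"
  using assms(1,4)
proof (induction "card J" arbitrary: J rule: less_induct)
  case less
  show ?case
  proof (cases "J = {}")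
    case False
    then obtain a where a: "a \<in> J" by blast
    show ?thesis
      unfolding moore_re_rec[OF less.prems(1) a assms(2)] moore_re_rec[OF less.prems(1) a assms(3)]
    proof (intro sum.cong refl arg_cong2[where f = "(*)"] arg_cong[where f = qre])
      fix l assume "l \<in> dlists (J - {a})"
      then have l: "set l \<subseteq> J" by (auto simp: dlists_def)
      show "row_path X (X a) l a = row_path Y (Y a) l a"
        using l a less.prems by (intro row_path_cong) auto
      show "moore_re (J - {a} - set l) X = moore_re (J - {a} - set l) Y"
        using l a less.prems by (intro less.hyps psubset_card_mono) auto
    qed
  qed simp
qed

text \<open>Every cycle through \<open>i\<close> can be started there, so each product has an entry
  of row \<open>i\<close> as its first factor.\<close>

lemma moore_re_zero_row:
  assumes "finite J" "i \<in> J" "self_dual_real X" "\<And>b. b \<in> J \<Longrightarrow> X i b = 0"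
  shows "moore_re J X = 0"
proof -
  have "row_path X (X i) l i = 0" if "l \<in> dlists (J - {i})" for l
    using that assms by (cases l) (auto simp: dlists_def)
  then show ?thesis unfolding moore_re_rec[OF assms(1-3)] by simp
qed

lemma self_dual_real_add:
  assumes "self_dual_real X" "self_dual_real Y" shows "self_dual_real (\<lambda>a b. X a b + Y a b)"
  unfolding self_dual_real_def
  by (simp add: self_dual_realD(1)[OF assms(1)] self_dual_realD(1)[OF assms(2)]
      self_dual_realD(2)[OF assms(1)] self_dual_realD(2)[OF assms(2)])

lemma self_dual_real_add_diag:
  assumes "self_dual_real X"
  shows "self_dual_real (\<lambda>a b. X a b + (if a = i \<and> b = i then of_real c else 0))"
  by (rule self_dual_real_add[OF assms]) (auto simp: self_dual_real_def)

text \<open>A cycle visits \<open>i\<close> once, so the entry \<open>(i, i)\<close> is used only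
  when \<open>i\<close> is a fixed point, that is, for the empty list in the recursion at
  \<open>i\<close>.\<close>

lemma moore_re_add_diag:
  assumes "finite J" "i \<in> J" "self_dual_real X"
  shows "moore_re J (\<lambda>a b. X a b + (if a = i \<and> b = i then of_real c else 0)) =
    moore_re J X + c * moore_re (J - {i}) X"
proof -
  let ?Y = "\<lambda>a b. X a b + (if a = i \<and> b = i then of_real c else 0)"
  let ?f = "\<lambda>X l. (- 1) ^ length l * qre (row_path X (X i) l i) * moore_re (J - {i} - set l) X"
  have Y: "self_dual_real ?Y"
    by (rule self_dual_real_add_diag[OF assms(3)])
  have "?f ?Y l = ?f X l + (if l = [] then c * moore_re (J - {i}) X else 0)"
    if l: "l \<in> dlists (J - {i})" for l
  proof -
    have 1: "moore_re (J - {i} - set l) ?Y = moore_re (J - {i} - set l) X"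
      using assms Y by (intro moore_re_cong) auto
    have 2: "row_path ?Y (?Y i) l i = row_path X (X i) l i" if "l \<noteq> []"
    proof -
      obtain c l' where l': "l = c # l'" using \<open>l \<noteq> []\<close> by (cases l) auto
      then have "row_path ?Y (?Y c) l' i = row_path X (X c) l' i"
        using l by (intro row_path_cong) (auto simp: dlists_def)
      then show ?thesis using l l' by (auto simp: dlists_def)
    qed
    show ?thesis
    proof (cases "l = []")
      case True
      then show ?thesis using 1 by (simp add: distrib_right)
    qed (use 1 2 in simp)
  qed
  moreover have "[] \<in> dlists (J - {i})" by (simp add: dlists_def)
  ultimately show ?thesis
    unfolding moore_re_rec[OF assms] moore_re_rec[OF assms(1,2) Y]
    using assms by (simp add: sum.distrib)
qed

text \<open>The definition depends on the order of the indices, which \<open>\<phi>\<close> need not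
  respect; the recursion at an arbitrary element does not.\<close>

lemma moore_re_compose:
  assumes "finite J" "inj_on \<phi> J" "self_dual_real X"
  shows "moore_re (\<phi> ` J) X = moore_re J (\<lambda>a b. X (\<phi> a) (\<phi> b))"
  using assms(1,2)
proof (induction "card J" arbitrary: J rule: less_induct)
  case less
  let ?Y = "\<lambda>a b. X (\<phi> a) (\<phi> b)"
  have Y: "self_dual_real ?Y"
    unfolding self_dual_real_def by (simp add: self_dual_realD[OF assms(3)])
  show ?case
  proof (cases "J = {}")
    case False
    then obtain a where a: "a \<in> J" by blast
    have img: "\<phi> ` J - {\<phi> a} = \<phi> ` (J - {a})"
      using less.prems a by (auto simp: inj_on_def)
    have inj: "inj_on \<phi> (J - {a})" using less.prems by (auto intro: inj_on_subset)
    have dl: "dlists (\<phi> ` J - {\<phi> a}) = map \<phi> ` dlists (J - {a})"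
    proof (intro set_eqI iffI)
      fix l assume l: "l \<in> dlists (\<phi> ` J - {\<phi> a})"
      then have "set l \<subseteq> \<phi> ` (J - {a})" by (simp add: dlists_def img)
      then have "l \<in> map \<phi> ` lists (J - {a})" unfolding lists_image[symmetric] by auto
      then obtain l' where l': "set l' \<subseteq> J - {a}" "l = map \<phi> l'" by (auto simp: lists_eq_set)
      then show "l \<in> map \<phi> ` dlists (J - {a})"
        using l by (auto simp: dlists_def distinct_map)
    next
      fix l assume "l \<in> map \<phi> ` dlists (J - {a})"
      then obtain l' where l': "l = map \<phi> l'" "distinct l'" "set l' \<subseteq> J - {a}" by (auto simp: dlists_def)
      moreover from inj l'(3) have "inj_on \<phi> (set l')" by (rule inj_on_subset)
      ultimately show "l \<in> dlists (\<phi> ` J - {\<phi> a})"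
        unfolding img by (simp add: dlists_def distinct_map image_mono)
    qed
    have "moore_re (\<phi> ` J) X = (\<Sum>l\<in>map \<phi> ` dlists (J - {a}). (- 1) ^ length l * qre (row_path X (X (\<phi> a)) l (\<phi> a)) * moore_re (\<phi> ` J - {\<phi> a} - set l) X)"
      using a less.prems by (subst moore_re_rec[OF _ _ assms(3), of _ "\<phi> a"]) (simp_all add: dl)
    also have "\<dots> = (\<Sum>l\<in>dlists (J - {a}). (- 1) ^ length (map \<phi> l) * qre (row_path X (X (\<phi> a)) (map \<phi> l) (\<phi> a)) * moore_re (\<phi> ` J - {\<phi> a} - set (map \<phi> l)) X)"
    proof (rule sum.reindex_cong[OF _ refl refl])
      show "inj_on (map \<phi>) (dlists (J - {a}))"
        using inj by (intro inj_on_mapI) (auto intro: inj_on_subset simp: dlists_def)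
    qed
    also have "\<dots> = moore_re J ?Y"
      unfolding moore_re_rec[OF less.prems(1) a Y]
    proof (intro sum.cong refl arg_cong2[where f = "(*)"] arg_cong[where f = qre])
      fix l assume l: "l \<in> dlists (J - {a})"
      show "row_path X (X (\<phi> a)) (map \<phi> l) (\<phi> a) = row_path ?Y (?Y a) l a"
        by (simp add: row_path_compose)
      have "\<phi> ` J - {\<phi> a} - set (map \<phi> l) = \<phi> ` (J - {a} - set l)"
        unfolding img using l inj by (auto simp: dlists_def inj_on_def)
      moreover have "inj_on \<phi> (J - {a} - set l)" using inj by (rule inj_on_subset) auto
      moreover have "card (J - {a} - set l) < card J" using a less.prems by (intro psubset_card_mono) auto
      ultimately show "moore_re (\<phi> ` J - {\<phi> a} - set (map \<phi> l)) X = moore_re (J - {a} - set l) ?Y"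
        using less.prems by (simp add: less.hyps)
    qed simp
    finally show ?thesis .
  qed simp
qed

section \<open>Invariance under row operations\<close>

text \<open>A cycle through \<open>j\<close> attached to the end of a path to \<open>j\<close>, together with its reversal,
  contributes as much as the same cycle split off, but with the opposite sign.\<close>

lemma sum_row_path_eq_0:
  assumes "finite J" "j \<in> J" "self_dual_real X" "\<And>c. real_quat (f c)"
  shows "(\<Sum>l\<in>dlists J. (- 1) ^ length l * qre (row_path X f l j * q) * moore_re (J - set l) X) = 0"
proof -
  let ?h = "\<lambda>l. (- 1) ^ length l * qre (row_path X f l j * q) * moore_re (J - set l) X"
  let ?M = "\<lambda>l l'. moore_re (J - {j} - set l - set l') X"
  let ?C = "\<lambda>l'. row_path X (X j) l' j"
  let ?P = "\<lambda>l. row_path X f l j"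
  define S1 where "S1 = (\<Sum>(l, l')\<in>dpairs (J - {j}). (- 1) ^ (length l + length l') * (qre (?C l') * qre (?P l * q)) * ?M l l')"
  let ?g = "\<lambda>l l'. (- 1) ^ (length l + length l') * qre (?P l * ?C l' * q) * ?M l l'"
  have "(\<Sum>l\<in>dlists (J - {j}). ?h l) = S1"
  proof -
    have "?h l = (\<Sum>l'\<in>dlists (J - {j} - set l). (- 1) ^ (length l + length l') * (qre (?C l') * qre (?P l * q)) * ?M l l')"
      if "l \<in> dlists (J - {j})" for l
    proof -
      have "j \<in> J - set l" using that assms by (auto simp: dlists_def)
      moreover have "J - set l - {j} = J - {j} - set l" by auto
      ultimately have "moore_re (J - set l) X = (\<Sum>l'\<in>dlists (J - {j} - set l). (- 1) ^ length l' * qre (?C l') * ?M l l')"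
        using moore_re_rec[of "J - set l" j X] assms by simp
      then show ?thesis by (simp add: sum_distrib_left power_add mult_ac)
    qed
    then show ?thesis unfolding S1_def using assms by (subst sum_dlists_nested[symmetric]) auto
  qed
  moreover have "(\<Sum>(l, l')\<in>dpairs (J - {j}). ?h (l @ j # l')) = - S1"
  proof -
    have "J - set (l @ j # l') = J - {j} - set l - set l'" for l l' by auto
    then have "(\<Sum>(l, l')\<in>dpairs (J - {j}). ?h (l @ j # l')) = - (\<Sum>(l, l')\<in>dpairs (J - {j}). ?g l l')"
      by (simp add: row_path_append sum_negf[symmetric] split_def)
    \<comment> \<open>The sum is doubled so that each \<open>l'\<close> can be paired with its
      reversal even when the two coincide.\<close>
    moreover have "2 * (\<Sum>(l, l')\<in>dpairs (J - {j}). ?g l l') = 2 * S1"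
    proof -
      have "2 * (\<Sum>(l, l')\<in>dpairs (J - {j}). ?g l l') =
        (\<Sum>(l, l')\<in>dpairs (J - {j}). ?g l l') + (\<Sum>(l, l')\<in>dpairs (J - {j}). ?g l (rev l'))"
        using sum_dpairs_rev[of ?g "J - {j}"] by simp
      also have "\<dots> = (\<Sum>(l, l')\<in>dpairs (J - {j}). ?g l l' + ?g l (rev l'))"
        by (simp add: sum.distrib split_def)
      also have "\<dots> = (\<Sum>(l, l')\<in>dpairs (J - {j}). 2 * ((- 1) ^ (length l + length l') * (qre (?C l') * qre (?P l * q)) * ?M l l'))"
      proof (intro sum.cong refl, clarify)
        fix l l'
        have "real_quat (?C l')" by (intro real_quat_row_path assms self_dual_realD(2)[OF assms(3)])
        then have e: "qre (?P l * ?C l' * q) + qre (?P l * ?C (rev l') * q) = 2 * (qre (?C l') * qre (?P l * q))"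
          unfolding row_path_rev[OF assms(3)] by (rule qre_mult_add_qconj)
        have "?g l l' + ?g l (rev l') = (- 1) ^ (length l + length l') * (qre (?P l * ?C l' * q) + qre (?P l * ?C (rev l') * q)) * ?M l l'"
          by (simp add: distrib_left distrib_right)
        then show "?g l l' + ?g l (rev l') = 2 * ((- 1) ^ (length l + length l') * (qre (?C l') * qre (?P l * q)) * ?M l l')"
          unfolding e by simp
      qed
      finally show ?thesis by (simp add: S1_def sum_distrib_left split_def)
    qed
    ultimately show ?thesis by simp
  qed
  ultimately show ?thesis unfolding sum_dlists_split[OF assms(1,2)] by simp
qed

text \<open>The congruence of \<open>X\<close> by the identity plus the column \<open>q\<close>
  placed at \<open>i\<close>: multiples of row \<open>i\<close> are added to the other rows and the
  dual multiples of column \<open>i\<close> to the columns, which preserves self-duality.\<close>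

definition shear :: "(nat \<Rightarrow> nat \<Rightarrow> cquat) \<Rightarrow> (nat \<Rightarrow> cquat) \<Rightarrow> nat \<Rightarrow> nat \<Rightarrow> nat \<Rightarrow> cquat" where
  "shear X q i a b = X a b + q a * X i b + X a i * qconj (q b) + q a * X i i * qconj (q b)"

lemma self_dual_real_shear:
  assumes "self_dual_real X" "\<And>a. real_quat (q a)" shows "self_dual_real (shear X q i)"
  unfolding self_dual_real_def
proof (intro allI conjI)
  fix a b
  show "real_quat (shear X q i a b)"
    unfolding shear_def by (intro real_quat_intros assms(2) self_dual_realD(2)[OF assms(1)])
  show "shear X q i b a = qconj (shear X q i a b)"
    by (simp add: shear_def self_dual_realD(1)[OF assms(1)] mult.assoc)
qed

text \<open>A path that avoids \<open>j\<close> before its end meets the modified entries only on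
  its last edge, into column \<open>j\<close>; that edge splits into one to \<open>j\<close> and one
  to \<open>i\<close>.\<close>

lemma row_path_shear:
  assumes "j \<notin> set l" "i \<noteq> j" "\<And>b. b \<noteq> j \<Longrightarrow> f' b = f b" "f' j = f j + f i * qconj r"
  shows "row_path (shear X (\<lambda>a. if a = j then r else 0) i) f' l j = row_path X f l j + row_path X f l i * qconj r"
  using assms
proof (induction l arbitrary: f f')
  case (Cons c l)
  let ?Y = "shear X (\<lambda>a. if a = j then r else 0) i"
  have "row_path ?Y (?Y c) l j = row_path X (X c) l j + row_path X (X c) l i * qconj r"
    using Cons.prems by (intro Cons.IH) (auto simp: shear_def)
  moreover have "f' c = f c" using Cons.prems by auto
  ultimately show ?case by (simp add: distrib_left mult.assoc)
qed auto

text \<open>In the recursion at \<open>j\<close> each cycle product becomes four terms. Those whose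
  path ends at \<open>i\<close> vanish by \<open>sum_row_path_eq_0\<close> on
  \<open>J - {j}\<close>; the one from \<open>i\<close> to \<open>j\<close> turns into such a term
  by reversal and conjugation.\<close>

lemma moore_re_shear_single:
  assumes "finite J" "i \<in> J" "j \<in> J" "i \<noteq> j" "self_dual_real X" "real_quat r"
  shows "moore_re J (shear X (\<lambda>a. if a = j then r else 0) i) = moore_re J X"
proof -
  let ?Y = "shear X (\<lambda>a. if a = j then r else 0) i"
  have Y: "self_dual_real ?Y" using assms by (intro self_dual_real_shear) auto
  let ?J = "J - {j}"
  define S where "S A = (\<Sum>l\<in>dlists ?J. (- 1) ^ length l * qre (A l) * moore_re (?J - set l) X)" for A
  let ?P = "\<lambda>a l b. row_path X (X a) l b"
  have S0: "S (\<lambda>l. row_path X f l i * q) = 0" if "\<And>c. real_quat (f c)" for f q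
    unfolding S_def using assms that by (intro sum_row_path_eq_0) auto
  have "moore_re J ?Y = S (\<lambda>l. ?P j l j + r * ?P i l j + ?P j l i * qconj r + (r * ?P i l i) * qconj r)"
    unfolding S_def moore_re_rec[OF assms(1,3) Y]
  proof (intro sum.cong refl arg_cong2[where f = "(*)"] arg_cong[where f = qre])
    fix l assume l: "l \<in> dlists ?J"
    show "moore_re (?J - set l) ?Y = moore_re (?J - set l) X"
      using assms(1,5) Y by (intro moore_re_cong) (auto simp: shear_def)
    have "row_path ?Y (?Y j) l j = row_path X (\<lambda>b. X j b + r * X i b) l j + row_path X (\<lambda>b. X j b + r * X i b) l i * qconj r"
      using l assms by (intro row_path_shear) (auto simp: dlists_def shear_def distrib_left distrib_right mult.assoc)
    then show "row_path ?Y (?Y j) l j = ?P j l j + r * ?P i l j + ?P j l i * qconj r + (r * ?P i l i) * qconj r"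
      by (simp add: row_path_add row_path_mult distrib_right)
  qed
  also have "\<dots> = S (\<lambda>l. ?P j l j) + S (\<lambda>l. r * ?P i l j) + S (\<lambda>l. ?P j l i * qconj r) + S (\<lambda>l. (r * ?P i l i) * qconj r)"
    by (simp add: S_def distrib_left distrib_right sum.distrib)
  also have "S (\<lambda>l. r * ?P i l j) = S (\<lambda>l. ?P j l i * qconj r)"
  proof -
    have "qre (r * ?P i (rev l) j) = qre (?P j l i * qconj r)" for l
    proof -
      have "qre (r * ?P i (rev l) j) = qre (qconj (r * ?P i (rev l) j))" by (simp only: qre_simps)
      then show ?thesis by (simp add: row_path_rev[OF assms(5)])
    qed
    then show ?thesis unfolding S_def by (subst sum_dlists_rev) simp
  qed
  also have "S (\<lambda>l. ?P j l i * qconj r) = 0"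
    by (intro S0 self_dual_realD(2)[OF assms(5)])
  also have "S (\<lambda>l. (r * ?P i l i) * qconj r) = 0"
    unfolding row_path_mult[symmetric]
    by (intro S0 real_quat_intros assms self_dual_realD(2)[OF assms(5)])
  also have "S (\<lambda>l. ?P j l j) = moore_re J X"
    unfolding S_def by (rule moore_re_rec[OF assms(1,3,5), symmetric])
  finally show ?thesis by simp
qed

text \<open>With \<open>q i = 0\<close> the first shear leaves row and column \<open>i\<close> as
  multipliers for the second unchanged up to the same shear, so the coefficients simply add.\<close>

lemma shear_shear:
  assumes "q i = 0"
  shows "shear (shear X q i) q' i = shear X (\<lambda>a. q a + q' a) i"
  by (intro ext) (simp add: shear_def assms distrib_left distrib_right mult.assoc)

lemma moore_re_shear:
  assumes "finite J" "i \<in> J" "self_dual_real X" "\<And>a. real_quat (q a)"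
    "\<And>a. a \<notin> J - {i} \<Longrightarrow> q a = 0"
  shows "moore_re J (shear X q i) = moore_re J X"
proof -
  have "finite (J - {i})" using assms by simp
  then have "\<forall>q. (\<forall>a. real_quat (q a)) \<longrightarrow> (\<forall>a. a \<notin> A \<longrightarrow> q a = 0) \<longrightarrow> moore_re J (shear X q i) = moore_re J X"
    if "A \<subseteq> J - {i}" for A
  proof (rule finite_subset_induct'[OF finite_subset[OF that] that])
    have "shear X (\<lambda>a. 0) i = X" by (simp add: shear_def fun_eq_iff)
    then show "\<forall>q. (\<forall>a. real_quat (q a)) \<longrightarrow> (\<forall>a. a \<notin> {} \<longrightarrow> q a = 0) \<longrightarrow> moore_re J (shear X q i) = moore_re J X"
      by (metis empty_iff ext)
  next
    fix j B
    assume j: "j \<in> J - {i}" "j \<notin> B" "B \<subseteq> J - {i}"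
      and IH: "\<forall>q. (\<forall>a. real_quat (q a)) \<longrightarrow> (\<forall>a. a \<notin> B \<longrightarrow> q a = 0) \<longrightarrow> moore_re J (shear X q i) = moore_re J X"
    show "\<forall>q. (\<forall>a. real_quat (q a)) \<longrightarrow> (\<forall>a. a \<notin> insert j B \<longrightarrow> q a = 0) \<longrightarrow> moore_re J (shear X q i) = moore_re J X"
    proof (intro allI impI)
      fix q :: "nat \<Rightarrow> cquat" assume q: "\<forall>a. real_quat (q a)" "\<forall>a. a \<notin> insert j B \<longrightarrow> q a = 0"
      let ?q = "q(j := 0)"
      have rq: "\<And>a. real_quat (?q a)" using q by auto
      have "shear (shear X ?q i) (\<lambda>a. if a = j then q j else 0) i = shear X q i"
        using q j by (subst shear_shear) (auto intro!: arg_cong[where f = "\<lambda>q. shear X q i"])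
      moreover have "moore_re J (shear (shear X ?q i) (\<lambda>a. if a = j then q j else 0) i) = moore_re J (shear X ?q i)"
        using assms j q rq by (intro moore_re_shear_single self_dual_real_shear) auto
      moreover have "moore_re J (shear X ?q i) = moore_re J X"
        using IH q rq by auto
      ultimately show "moore_re J (shear X q i) = moore_re J X" by simp
    qed
  qed
  from this[of "J - {i}"] show ?thesis using assms by auto
qed

text \<open>Subtracting row \<open>i\<close> from row \<open>j\<close>, and dually for columns,
  produces a zero row; the columns agree too, by self-duality.\<close>

lemma moore_re_equal_rows:
  assumes "finite J" "i \<in> J" "j \<in> J" "i \<noteq> j" "self_dual_real X" "\<And>b. b \<in> J \<Longrightarrow> X i b = X j b"
  shows "moore_re J X = 0"
proof -
  let ?q = "\<lambda>a. if a = j then - 1 else 0 :: cquat"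
  have "X a i = X a j" if "a \<in> J" for a
    using assms(6)[OF that] by (metis self_dual_realD(1)[OF assms(5)])
  then have "moore_re J (shear X ?q i) = 0"
    using assms by (intro moore_re_zero_row[of J j] self_dual_real_shear) (auto simp: shear_def)
  then show ?thesis using moore_re_shear_single[OF assms(1-5), of "- 1"] by simp
qed

section \<open>Gram matrices\<close>

definition add_rank1 :: "(nat \<Rightarrow> nat \<Rightarrow> cquat) \<Rightarrow> real \<Rightarrow> (nat \<Rightarrow> cquat) \<Rightarrow> nat \<Rightarrow> nat \<Rightarrow> cquat" where
  "add_rank1 X c v a b = X a b + c *\<^sub>R (v a * qconj (v b))"

lemma self_dual_real_add_rank1:
  assumes "self_dual_real X" "\<And>a. real_quat (v a)" shows "self_dual_real (add_rank1 X c v)"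
  unfolding self_dual_real_def
proof (intro allI conjI)
  fix a b
  show "real_quat (add_rank1 X c v a b)"
    unfolding add_rank1_def by (intro real_quat_intros assms(2) self_dual_realD(2)[OF assms(1)])
  show "add_rank1 X c v b a = qconj (add_rank1 X c v a b)"
    by (simp add: add_rank1_def self_dual_realD(1)[OF assms(1)])
qed

text \<open>Unless \<open>v\<close> vanishes on \<open>J\<close>, row operations turn the perturbation into a multiple of a diagonal
  matrix unit.\<close>

lemma moore_re_add_rank1:
  assumes "finite J" "self_dual_real X" "\<And>a. real_quat (v a)"
  obtains "\<And>c. moore_re J (add_rank1 X c v) = moore_re J X"
  | i q w where "i \<in> J" "\<And>a. real_quat (q a)" "0 < w"
    "\<And>c. moore_re J (add_rank1 X c v) = moore_re J X + c * w * moore_re (J - {i}) (shear X q i)"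
proof (cases "\<forall>a\<in>J. v a = 0")
  case True
  then have "moore_re J (add_rank1 X c v) = moore_re J X" for c
    using assms by (intro moore_re_cong self_dual_real_add_rank1) (auto simp: add_rank1_def)
  then show ?thesis using that(1) by blast
next
  case False
  then obtain i where i: "i \<in> J" "v i \<noteq> 0" by blast
  define w where "w = (norm (v i))\<^sup>2"
  have w: "0 < w" using i by (simp add: w_def)
  \<comment> \<open>Gaussian elimination with pivot \<open>v i\<close>, whose inverse is
    \<open>qconj (v i)\<close> divided by \<open>w\<close>.\<close>
  define q where "q b = (if b \<in> J - {i} then - ((1 / w) *\<^sub>R (v b * qconj (v i))) else 0)" for b
  have q: "real_quat (q a)" for a using assms(3) by (auto simp: q_def)
  have elim: "v b + q b * v i = (if b = i then v i else 0)" if "b \<in> J" for b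
    using that w real_quat_mult_qconj(2)[OF assms(3), of i]
    by (simp add: q_def mult.assoc w_def[symmetric]) (simp add: of_real_def)
  have "moore_re J (add_rank1 X c v) = moore_re J X + c * w * moore_re (J - {i}) (shear X q i)" for c
  proof -
    have "moore_re J (add_rank1 X c v) = moore_re J (shear (add_rank1 X c v) q i)"
      using assms i q by (intro moore_re_shear[symmetric] self_dual_real_add_rank1) (auto simp: q_def)
    also have "\<dots> = moore_re J (\<lambda>a b. shear X q i a b + (if a = i \<and> b = i then of_real (c * w) else 0))"
    proof (rule moore_re_cong)
      fix a b assume ab: "a \<in> J" "b \<in> J"
      have "shear (add_rank1 X c v) q i a b = shear X q i a b + c *\<^sub>R ((v a + q a * v i) * qconj (v b + q b * v i))"
        by (simp add: shear_def add_rank1_def algebra_simps)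
      also have "c *\<^sub>R ((v a + q a * v i) * qconj (v b + q b * v i)) = (if a = i \<and> b = i then of_real (c * w) else 0)"
        unfolding elim[OF ab(1)] elim[OF ab(2)]
        using real_quat_mult_qconj(1)[OF assms(3), of i] by (simp add: w_def scaleR_conv_of_real)
      finally show "shear (add_rank1 X c v) q i a b = shear X q i a b + (if a = i \<and> b = i then of_real (c * w) else 0)" .
    next
      show "self_dual_real (\<lambda>a b. shear X q i a b + (if a = i \<and> b = i then of_real (c * w) else 0))"
        by (intro self_dual_real_add_diag self_dual_real_shear assms(2) q)
    qed (use assms q in \<open>auto intro!: self_dual_real_shear self_dual_real_add_rank1\<close>)
    also have "\<dots> = moore_re J (shear X q i) + c * w * moore_re (J - {i}) (shear X q i)"
      using assms q i by (intro moore_re_add_diag self_dual_real_shear) auto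
    also have "moore_re J (shear X q i) = moore_re J X"
      using assms i q by (intro moore_re_shear) (auto simp: q_def)
    finally show ?thesis .
  qed
  then show ?thesis using that(2)[of i q w] i q w by blast
qed

text \<open>The data \<open>i\<close>, \<open>q\<close>, \<open>w\<close> of the preceding
  alternative do not depend on \<open>c\<close>, so the value at \<open>1\<close> determines the
  slope.\<close>

lemma moore_re_add_rank1_affine:
  assumes "finite J" "self_dual_real X" "\<And>a. real_quat (v a)"
  shows "moore_re J (add_rank1 X c v) = (1 - c) * moore_re J X + c * moore_re J (add_rank1 X 1 v)"
  by (rule moore_re_add_rank1[OF assms(1,2), of v]) (simp_all add: assms(3) algebra_simps)

definition gram :: "'k set \<Rightarrow> ('k \<Rightarrow> real) \<Rightarrow> ('k \<Rightarrow> nat \<Rightarrow> cquat) \<Rightarrow> nat \<Rightarrow> nat \<Rightarrow> cquat" where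
  "gram T c v a b = (\<Sum>s\<in>T. c s *\<^sub>R (v s a * qconj (v s b)))"

lemma gram_empty [simp]: "gram {} c v = (\<lambda>a b. 0)" by (simp add: gram_def fun_eq_iff)

lemma gram_insert: "finite T \<Longrightarrow> s \<notin> T \<Longrightarrow> gram (insert s T) c v = add_rank1 (gram T c v) (c s) (v s)"
  by (simp add: gram_def add_rank1_def fun_eq_iff add.commute)

lemma self_dual_real_gram:
  assumes "\<And>s a. s \<in> T \<Longrightarrow> real_quat (v s a)" shows "self_dual_real (gram T c v)"
  unfolding self_dual_real_def gram_def qconj_sum using assms by (auto intro!: real_quat_sum)

lemma self_dual_real_zero: "self_dual_real (\<lambda>a b. 0)" by (simp add: self_dual_real_def)

text \<open>A congruence acts on the generating vectors and leaves the weights alone. Hence Gram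
  matrices are stable under shears, which lets inductions over \<open>T\<close> continue after an
  elimination.\<close>

lemma shear_gram: "shear (gram T c v) q i = gram T c (\<lambda>s a. v s a + q a * v s i)"
  by (intro ext) (simp add: shear_def gram_def sum_distrib_left sum_distrib_right sum.distrib algebra_simps)

text \<open>Each new vector adds a nonnegative multiple of a smaller minor of a sheared Gram matrix
  with the same \<open>T\<close>; therefore \<open>J\<close> and \<open>v\<close> vary in the
  induction.\<close>

lemma moore_re_gram_nonneg:
  assumes "finite T" "finite J" "\<And>s a. s \<in> T \<Longrightarrow> real_quat (v s a)" "\<And>s. s \<in> T \<Longrightarrow> 0 \<le> c s"
  shows "0 \<le> moore_re J (gram T c v)"
  using assms
proof (induction T arbitrary: J v rule: finite_induct)
  case empty
  then show ?case
    using moore_re_zero_row[OF empty(1) _ self_dual_real_zero] by (cases "J = {}") auto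
next
  case (insert s T)
  have g: "self_dual_real (gram T c v)" and v: "\<And>a. real_quat (v s a)"
    using insert by (auto intro: self_dual_real_gram)
  from \<open>finite J\<close> g v show ?case
  proof (rule moore_re_add_rank1)
    assume "moore_re J (add_rank1 (gram T c v) c' (v s)) = moore_re J (gram T c v)" for c'
    then show ?thesis using insert by (simp add: gram_insert)
  next
    fix i q w assume i: "i \<in> J" and q: "\<And>a. real_quat (q a)" and w: "0 < (w :: real)"
      and eq: "\<And>c'. moore_re J (add_rank1 (gram T c v) c' (v s)) =
        moore_re J (gram T c v) + c' * w * moore_re (J - {i}) (shear (gram T c v) q i)"
    have "0 \<le> moore_re (J - {i}) (shear (gram T c v) q i)"
      unfolding shear_gram using insert q by (intro insert.IH) auto
    moreover have "0 \<le> moore_re J (gram T c v)" using insert by (intro insert.IH) auto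
    ultimately show ?thesis using insert w by (simp add: gram_insert eq)
  qed
qed

text \<open>Supplies the monotone convergence both along truncations of the series and along the
  random selection.\<close>

lemma moore_re_gram_mono:
  assumes "finite T" "finite J" "\<And>s a. s \<in> T \<Longrightarrow> real_quat (v s a)" "\<And>s. s \<in> T \<Longrightarrow> 0 \<le> c s" "U \<subseteq> T"
  shows "moore_re J (gram U c v) \<le> moore_re J (gram T c v)"
proof -
  have step: "moore_re J (gram U c v) \<le> moore_re J (gram (insert s U) c v)"
    if "s \<in> T" "s \<notin> U" "U \<subseteq> T" for s U
  proof -
    have U: "finite U" using that assms by (auto intro: finite_subset)
    have g: "self_dual_real (gram U c v)" and v: "\<And>a. real_quat (v s a)"
      using that assms by (auto intro: self_dual_real_gram)
    from \<open>finite J\<close> g v show ?thesis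
    proof (rule moore_re_add_rank1)
      assume "moore_re J (add_rank1 (gram U c v) c' (v s)) = moore_re J (gram U c v)" for c'
      then show ?thesis using that U by (simp add: gram_insert)
    next
      fix i q w assume i: "i \<in> J" and q: "\<And>a. real_quat (q a)" and w: "0 < (w :: real)"
        and eq: "\<And>c'. moore_re J (add_rank1 (gram U c v) c' (v s)) =
          moore_re J (gram U c v) + c' * w * moore_re (J - {i}) (shear (gram U c v) q i)"
      have "0 \<le> moore_re (J - {i}) (shear (gram U c v) q i)"
        unfolding shear_gram using assms q that U by (intro moore_re_gram_nonneg) auto
      then show ?thesis using that U w assms by (simp add: gram_insert eq)
    qed
  qed
  have "finite (T - U)" using assms by simp
  then have "moore_re J (gram U c v) \<le> moore_re J (gram (U \<union> V) c v)" if "V \<subseteq> T - U" for V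
  proof (rule finite_subset_induct'[OF finite_subset[OF that] that])
    fix s V assume "s \<in> T - U" "V \<subseteq> T - U" "s \<notin> V" "moore_re J (gram U c v) \<le> moore_re J (gram (U \<union> V) c v)"
    then show "moore_re J (gram U c v) \<le> moore_re J (gram (U \<union> insert s V) c v)"
      using order_trans[OF _ step[of s "U \<union> V"]] assms(5) by auto
  qed simp
  from this[of "T - U"] show ?thesis using assms(5) by (simp add: Un_absorb1)
qed

text \<open>A rank bound: eliminating one vector costs one index, so the vectors run out first and a
  zero matrix on a nonempty index set remains.\<close>

lemma moore_re_gram_eq_0:
  assumes "finite T" "finite J" "\<And>s a. s \<in> T \<Longrightarrow> real_quat (v s a)" "card T < card J"
  shows "moore_re J (gram T c v) = 0"
  using assms
proof (induction T arbitrary: J v rule: finite_induct)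
  case empty
  then obtain i where "i \<in> J" by fastforce
  then show ?case using moore_re_zero_row[OF empty(1) _ self_dual_real_zero] by simp
next
  case (insert s T)
  have g: "self_dual_real (gram T c v)" and v: "\<And>a. real_quat (v s a)"
    using insert by (auto intro: self_dual_real_gram)
  from \<open>finite J\<close> g v show ?case
  proof (rule moore_re_add_rank1)
    assume "moore_re J (add_rank1 (gram T c v) c' (v s)) = moore_re J (gram T c v)" for c'
    then show ?thesis using insert by (simp add: gram_insert)
  next
    fix i q w assume i: "i \<in> J" and q: "\<And>a. real_quat (q a)"
      and eq: "\<And>c'. moore_re J (add_rank1 (gram T c v) c' (v s)) =
        moore_re J (gram T c v) + c' * w * moore_re (J - {i}) (shear (gram T c v) q i)"
    have "moore_re (J - {i}) (shear (gram T c v) q i) = 0"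
      unfolding shear_gram using insert q i by (intro insert.IH) auto
    moreover have "moore_re J (gram T c v) = 0" using insert by (intro insert.IH) auto
    ultimately show ?thesis using insert by (simp add: gram_insert eq)
  qed
qed

text \<open>A function affine in each weight is interpolated from the vertices of the unit cube. The
  summand \<open>X\<close> absorbs the vector being added, so that the induction hypothesis applies
  to the others.\<close>

lemma moore_re_gram_expand_aux:
  assumes "finite T" "finite J" "\<And>s a. s \<in> T \<Longrightarrow> real_quat (v s a)" "self_dual_real X"
  shows "moore_re J (\<lambda>a b. X a b + gram T c v a b) =
    (\<Sum>U\<in>Pow T. (\<Prod>s\<in>U. c s) * (\<Prod>s\<in>T - U. 1 - c s) * moore_re J (\<lambda>a b. X a b + gram U (\<lambda>_. 1) v a b))"
  using assms(1,3,4)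
proof (induction T arbitrary: X rule: finite_induct)
  case (insert s T)
  let ?Y = "\<lambda>U a b. X a b + gram U (\<lambda>_. 1) v a b"
  let ?p = "\<lambda>T U. (\<Prod>s\<in>U. c s) * (\<Prod>s\<in>T - U. 1 - c s)"
  have v: "\<And>a. real_quat (v s a)" using insert by auto
  have comm: "(\<lambda>a b. add_rank1 X c' (v s) a b + gram U d v a b) = add_rank1 (\<lambda>a b. X a b + gram U d v a b) c' (v s)" for c' U d
    by (simp add: add_rank1_def fun_eq_iff)
  have "moore_re J (\<lambda>a b. X a b + gram (insert s T) c v a b) = moore_re J (\<lambda>a b. add_rank1 X (c s) (v s) a b + gram T c v a b)"
    using insert by (simp add: gram_insert add_rank1_def add_ac)
  also have "\<dots> = (\<Sum>U\<in>Pow T. ?p T U * moore_re J (\<lambda>a b. add_rank1 X (c s) (v s) a b + gram U (\<lambda>_. 1) v a b))"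
    using insert v by (intro insert.IH self_dual_real_add_rank1) auto
  also have "\<dots> = (\<Sum>U\<in>Pow T. ?p T U * ((1 - c s) * moore_re J (?Y U) + c s * moore_re J (?Y (insert s U))))"
  proof (intro sum.cong refl)
    fix U assume "U \<in> Pow T"
    then have U: "finite U" "s \<notin> U" "U \<subseteq> T" using insert by (auto intro: finite_subset)
    have "self_dual_real (gram U (\<lambda>_. 1) v)" using insert U by (intro self_dual_real_gram) auto
    then have "self_dual_real (?Y U)" by (rule self_dual_real_add[OF insert.prems(2)])
    moreover have "add_rank1 (?Y U) 1 (v s) = ?Y (insert s U)"
      using U by (simp add: gram_insert add_rank1_def fun_eq_iff)
    ultimately show "?p T U * moore_re J (\<lambda>a b. add_rank1 X (c s) (v s) a b + gram U (\<lambda>_. 1) v a b) =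
      ?p T U * ((1 - c s) * moore_re J (?Y U) + c s * moore_re J (?Y (insert s U)))"
      using moore_re_add_rank1_affine[OF assms(2) _ v, of "?Y U" "c s"] by (simp add: comm)
  qed
  \<comment> \<open>The factors \<open>1 - c s\<close> and \<open>c s\<close> complete the weights
    of \<open>U\<close> and \<open>insert s U\<close>, which together exhaust the subsets of
    \<open>insert s T\<close>.\<close>
  also have "\<dots> = (\<Sum>U\<in>Pow T. ?p (insert s T) U * moore_re J (?Y U)) + (\<Sum>U\<in>Pow T. ?p (insert s T) (insert s U) * moore_re J (?Y (insert s U)))"
    unfolding sum.distrib[symmetric]
  proof (intro sum.cong refl)
    fix U assume "U \<in> Pow T"
    then have U: "finite U" "s \<notin> U" "U \<subseteq> T" using insert by (auto intro: finite_subset)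
    have "insert s T - U = insert s (T - U)" "insert s T - insert s U = T - U" using U insert by auto
    then show "?p T U * ((1 - c s) * moore_re J (?Y U) + c s * moore_re J (?Y (insert s U))) =
      ?p (insert s T) U * moore_re J (?Y U) + ?p (insert s T) (insert s U) * moore_re J (?Y (insert s U))"
      using U insert by (simp add: algebra_simps)
  qed
  also have "(\<Sum>U\<in>Pow T. ?p (insert s T) (insert s U) * moore_re J (?Y (insert s U))) =
      (\<Sum>U\<in>insert s ` Pow T. ?p (insert s T) U * moore_re J (?Y U))"
  proof (rule sum.reindex_cong[symmetric, OF _ refl refl], rule inj_onI)
    fix U V assume "U \<in> Pow T" "V \<in> Pow T" "insert s U = insert s V"
    moreover from this have "s \<notin> U" "s \<notin> V" using insert by auto
    ultimately show "U = V" by (simp add: insert_ident)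
  qed
  finally show ?case
    using insert by (simp add: Pow_insert, subst sum.union_disjoint) auto
qed simp

lemma moore_re_gram_expand:
  assumes "finite T" "finite J" "\<And>s a. s \<in> T \<Longrightarrow> real_quat (v s a)"
  shows "moore_re J (gram T c v) =
    (\<Sum>U\<in>Pow T. (\<Prod>s\<in>U. c s) * (\<Prod>s\<in>T - U. 1 - c s) * moore_re J (gram U (\<lambda>_. 1) v))"
  using moore_re_gram_expand_aux[OF assms self_dual_real_zero] by simp

section \<open>Integration of Gram densities\<close>

lemma bounded_bilinear_cquat_mult: "bounded_bilinear ((*) :: cquat \<Rightarrow> cquat \<Rightarrow> cquat)"
  unfolding bilinear_conv_bounded_bilinear[symmetric] bilinear_def
  by (auto intro!: linearI simp: algebra_simps)

lemma borel_measurable_cquat_mult [measurable (raw)]: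
  fixes f g :: "'a \<Rightarrow> cquat"
  assumes "f \<in> borel_measurable N" "g \<in> borel_measurable N"
  shows "(\<lambda>x. f x * g x) \<in> borel_measurable N"
  using assms by (rule borel_measurable_continuous_Pair)
    (auto intro!: bounded_bilinear.continuous_on[OF bounded_bilinear_cquat_mult] continuous_intros)

lemma bounded_linear_qconj: "bounded_linear qconj"
  unfolding linear_conv_bounded_linear[symmetric] by (auto intro!: linearI)

lemma bounded_linear_qre: "bounded_linear qre"
  unfolding linear_conv_bounded_linear[symmetric] by (auto intro!: linearI)

lemma borel_measurable_qconj [measurable]: "qconj \<in> borel_measurable borel"
  by (intro borel_measurable_continuous_onI linear_continuous_on bounded_linear_qconj)

lemma borel_measurable_qre [measurable]: "qre \<in> borel_measurable borel"
  by (intro borel_measurable_continuous_onI linear_continuous_on bounded_linear_qre)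

lemma borel_measurable_row_path:
  assumes "\<And>a b. a \<in> insert e (set l) \<Longrightarrow> b \<in> insert b0 (set l) \<Longrightarrow> (\<lambda>x. X x a b) \<in> borel_measurable N"
  shows "(\<lambda>x. row_path (X x) (X x e) l b0 :: cquat) \<in> borel_measurable N"
  using assms
proof (induction l arbitrary: e)
  case (Cons c l)
  have "(\<lambda>x. row_path (X x) (X x c) l b0) \<in> borel_measurable N"
    by (rule Cons.IH) (auto intro: Cons.prems)
  moreover have "(\<lambda>x. X x e c) \<in> borel_measurable N" by (rule Cons.prems) auto
  ultimately show ?case by simp
qed simp

lemma borel_measurable_moore_re:
  assumes "finite J" "\<And>x. self_dual_real (X x)"
    "\<And>a b. a \<in> J \<Longrightarrow> b \<in> J \<Longrightarrow> (\<lambda>x. X x a b) \<in> borel_measurable N"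
  shows "(\<lambda>x. moore_re J (X x)) \<in> borel_measurable N"
  using assms(1,3)
proof (induction "card J" arbitrary: J rule: less_induct)
  case less
  show ?case
  proof (cases "J = {}")
    case False
    then obtain a where a: "a \<in> J" by blast
    have [measurable]: "(\<lambda>x. row_path (X x) (X x a) l a) \<in> borel_measurable N" if "l \<in> dlists (J - {a})" for l
      using that a by (intro borel_measurable_row_path less.prems) (auto simp: dlists_def)
    have [measurable]: "(\<lambda>x. moore_re (J - {a} - set l) (X x)) \<in> borel_measurable N" if "l \<in> dlists (J - {a})" for l
      using that a less.prems by (intro less.hyps psubset_card_mono) auto
    show ?thesis
      unfolding moore_re_rec[OF less.prems(1) a assms(2)] by measurable
  qed simp
qed

text \<open>Only the last edge sees the end point. When the end point becomes the variable of
  integration, \<open>W\<close> is a constant factor.\<close>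

lemma row_path_last_edge:
  assumes "a \<notin> A" "distinct (a # l)" "set l \<subseteq> A"
  obtains W e where "e \<in> insert a A"
    "\<And>X' m. (\<And>c d. c \<in> insert a A \<Longrightarrow> d \<in> insert a A \<Longrightarrow> X' c d = X c d) \<Longrightarrow>
      row_path X' (X' a) l m = W * X' e m"
proof (cases l rule: rev_exhaust)
  case Nil
  then show ?thesis using that[of a 1] by simp
next
  case (snoc l' e)
  have "row_path X' (X' a) l m = row_path X (X a) l' e * X' e m"
    if "\<And>c d. c \<in> insert a A \<Longrightarrow> d \<in> insert a A \<Longrightarrow> X' c d = X c d" for X' m
  proof -
    have "row_path X' (X' a) l' e = row_path X (X a) l' e"
      using that snoc assms by (intro row_path_cong) auto
    then show ?thesis using snoc by (simp add: row_path_append)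
  qed
  then show ?thesis using that[of e "row_path X (X a) l' e"] snoc assms by auto
qed

section \<open>Densities of projection kernels\<close>

locale quat_system = sigma_finite_measure M for M :: "'a measure" +
  fixes I :: "nat set" and u :: "nat \<Rightarrow> 'a \<Rightarrow> cquat"
  assumes orthonormal: "orthonormal_quat M I u"
    and real: "k \<in> I \<Longrightarrow> real_quat (u k x)"
begin

sublocale P: product_sigma_finite "\<lambda>_::nat. M" ..

lemma measurable_u [measurable]: "k \<in> I \<Longrightarrow> u k \<in> borel_measurable M"
  using orthonormal by (auto simp: orthonormal_quat_def)

lemma has_bochner_integral_orthonormal:
  "k \<in> I \<Longrightarrow> l \<in> I \<Longrightarrow> has_bochner_integral M (\<lambda>x. qconj (u k x) * u l x) (if k = l then 1 else 0)"
  using orthonormal by (auto simp: orthonormal_quat_def)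

definition kern :: "nat set \<Rightarrow> (nat \<Rightarrow> 'a) \<Rightarrow> nat \<Rightarrow> nat \<Rightarrow> cquat" where
  "kern T x = gram T (\<lambda>_. 1) (\<lambda>s a. u s (x a))"

definition dens :: "nat set \<Rightarrow> nat set \<Rightarrow> (nat \<Rightarrow> 'a) \<Rightarrow> real" where
  "dens T J x = moore_re J (kern T x)"

context
  fixes T :: "nat set"
  assumes T: "finite T" "T \<subseteq> I"
begin

lemma self_dual_kern: "self_dual_real (kern T x)"
  unfolding kern_def using T real by (intro self_dual_real_gram) auto

lemma dens_nonneg: "finite J \<Longrightarrow> 0 \<le> dens T J x"
  unfolding dens_def kern_def using T real by (intro moore_re_gram_nonneg) auto

lemma dens_empty [simp]: "dens T {} x = 1"
  by (simp add: dens_def)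

lemma dens_eq_0: "finite J \<Longrightarrow> card T < card J \<Longrightarrow> dens T J x = 0"
  unfolding dens_def kern_def using T real by (intro moore_re_gram_eq_0) auto

lemma dens_cong: "finite J \<Longrightarrow> (\<And>a. a \<in> J \<Longrightarrow> x a = y a) \<Longrightarrow> dens T J x = dens T J y"
  unfolding dens_def by (rule moore_re_cong) (auto simp: self_dual_kern, simp add: kern_def gram_def)

lemma dens_compose:
  assumes "finite J" "inj_on \<phi> J" shows "dens T (\<phi> ` J) x = dens T J (\<lambda>a. x (\<phi> a))"
  unfolding dens_def moore_re_compose[OF assms self_dual_kern] by (simp add: kern_def gram_def[abs_def])

lemma dens_equal_points:
  assumes "finite J" "i \<in> J" "j \<in> J" "i \<noteq> j" "\<And>s. s \<in> T \<Longrightarrow> u s (x i) = u s (x j)"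
  shows "dens T J x = 0"
  unfolding dens_def using assms
  by (intro moore_re_equal_rows[OF assms(1-4) self_dual_kern]) (simp add: kern_def gram_def)

lemma borel_measurable_dens_comp:
  assumes "finite J" "\<And>a. a \<in> J \<Longrightarrow> (\<lambda>z. g z a) \<in> measurable N M"
  shows "(\<lambda>z. dens T J (g z)) \<in> borel_measurable N"
  unfolding dens_def
proof (rule borel_measurable_moore_re[OF assms(1) self_dual_kern])
  fix a b assume ab: "a \<in> J" "b \<in> J"
  have *: "(\<lambda>x. u s (g x c)) \<in> borel_measurable N" if "s \<in> T" "c \<in> J" for s c
    using that assms T by (intro measurable_compose[OF _ measurable_u]) auto
  show "(\<lambda>x. kern T (g x) a b) \<in> borel_measurable N"
    unfolding kern_def gram_def
    by (intro borel_measurable_sum borel_measurable_scaleR borel_measurable_const borel_measurable_cquat_mult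
        measurable_compose[OF _ borel_measurable_qconj] * ab)
qed

lemma borel_measurable_dens [measurable]:
  "finite J \<Longrightarrow> J \<subseteq> L \<Longrightarrow> dens T J \<in> borel_measurable (Pi\<^sub>M L (\<lambda>_. M))"
  by (rule borel_measurable_dens_comp) (auto intro: measurable_component_singleton)

text \<open>The reproducing property: the two factors depending on \<open>y\<close> are adjacent,
  and orthonormality contracts the double sum to its diagonal.\<close>

lemma has_bochner_integral_kern_kern:
  assumes "a \<noteq> m" "b \<noteq> m"
  shows "has_bochner_integral M (\<lambda>y. kern T (x(m := y)) b m * kern T (x(m := y)) m a) (kern T x b a)"
proof -
  have "has_bochner_integral M (\<lambda>y. \<Sum>s\<in>T. \<Sum>t\<in>T. (u s (x b) * (qconj (u s y) * u t y)) * qconj (u t (x a)))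
     (\<Sum>s\<in>T. \<Sum>t\<in>T. (u s (x b) * (if s = t then 1 else 0)) * qconj (u t (x a)))"
    using T
    by (intro has_bochner_integral_orthonormal has_bochner_integral_sum
        has_bochner_integral_bounded_linear[OF bounded_bilinear.bounded_linear_left[OF bounded_bilinear_cquat_mult]]
        has_bochner_integral_bounded_linear[OF bounded_bilinear.bounded_linear_right[OF bounded_bilinear_cquat_mult]])
      (auto simp: subset_iff)
  moreover have "(\<Sum>s\<in>T. \<Sum>t\<in>T. (u s (x b) * (if s = t then 1 else 0)) * qconj (u t (x a))) = kern T x b a"
    using T by (simp add: kern_def gram_def if_distrib if_distribR sum.delta cong: if_cong)
  ultimately show ?thesis
    using assms by (simp add: kern_def gram_def sum_product mult.assoc)
qed

text \<open>The trace of a projection is its rank. Taking scalar parts turns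
  \<open>u * qconj u\<close> into \<open>qconj u * u\<close>, the product of which orthonormality
  speaks.\<close>

lemma has_bochner_integral_kern_diag:
  "has_bochner_integral M (\<lambda>y. qre (kern T (x(m := y)) m m)) (card T)"
proof -
  have "has_bochner_integral M (\<lambda>y. \<Sum>s\<in>T. qre (qconj (u s y) * u s y)) (\<Sum>s\<in>T. qre 1)"
  proof (intro has_bochner_integral_sum has_bochner_integral_bounded_linear[OF bounded_linear_qre])
    fix s assume "s \<in> T"
    then show "has_bochner_integral M (\<lambda>y. qconj (u s y) * u s y) 1"
      using has_bochner_integral_orthonormal[of s s] T by auto
  qed
  moreover have "qre (kern T (x(m := y)) m m) = (\<Sum>s\<in>T. qre (qconj (u s y) * u s y))" for y
    by (simp add: kern_def gram_def qre_sum qre_mult_commute[of "u _ y"])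
  ultimately show ?thesis by simp
qed

text \<open>Integrating out a point closes a path through it into a shorter cycle by the reproducing
  property, so that the total is again a sum of the recursions at all other points.\<close>

lemma has_bochner_integral_dens_insert:
  assumes J: "finite J" "m \<notin> J"
  shows "has_bochner_integral M (\<lambda>y. dens T (insert m J) (x(m := y))) ((real (card T) - real (card J)) * dens T J x)"
proof -
  let ?X = "\<lambda>y. kern T (x(m := y))" and ?Y = "kern T x"
  let ?D = "\<lambda>l. moore_re (J - set l) ?Y"
  have XY: "?X y c d = ?Y c d" if "c \<noteq> m" "d \<noteq> m" for y c d
    using that by (simp add: kern_def gram_def)
  have D: "moore_re (J - set l) (?X y) = ?D l" for y l
    using J by (intro moore_re_cong self_dual_kern XY) auto
  have Jm: "insert m J - {m} = J" using J by auto
  \<comment> \<open>The empty list is the fixed point \<open>m\<close>. Otherwise the list starts at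
    some \<open>a\<close>, and rotating the product brings the edges into and out of
    \<open>m\<close> next to each other.\<close>
  have eq: "dens T (insert m J) (x(m := y)) = qre (?X y m m) * dens T J x +
     (\<Sum>a\<in>J. \<Sum>l\<in>dlists (J - {a}). - ((- 1) ^ length l) * qre (row_path (?X y) (?X y a) l m * ?X y m a) * moore_re (J - {a} - set l) ?Y)" for y
  proof -
    have "dens T (insert m J) (x(m := y)) = (\<Sum>l\<in>dlists J. (- 1) ^ length l * qre (row_path (?X y) (?X y m) l m) * ?D l)"
    proof -
      have "finite (insert m J)" "m \<in> insert m J" using J by auto
      from moore_re_rec[OF this self_dual_kern, of "x(m := y)"] show ?thesis unfolding dens_def Jm D .
    qed
    also have "\<dots> = qre (?X y m m) * dens T J x +
      (\<Sum>a\<in>J. \<Sum>l\<in>dlists (J - {a}). (- 1) ^ length (a # l) * qre (row_path (?X y) (?X y m) (a # l) m) * ?D (a # l))"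
      by (simp add: sum_dlists_Cons[OF J(1)] dens_def)
    also have "(\<Sum>a\<in>J. \<Sum>l\<in>dlists (J - {a}). (- 1) ^ length (a # l) * qre (row_path (?X y) (?X y m) (a # l) m) * ?D (a # l)) =
      (\<Sum>a\<in>J. \<Sum>l\<in>dlists (J - {a}). - ((- 1) ^ length l) * qre (row_path (?X y) (?X y a) l m * ?X y m a) * moore_re (J - {a} - set l) ?Y)"
    proof (intro sum.cong refl)
      fix a l
      have "J - set (a # l) = J - {a} - set l" by auto
      then show "(- 1) ^ length (a # l) * qre (row_path (?X y) (?X y m) (a # l) m) * ?D (a # l) =
        - ((- 1) ^ length l) * qre (row_path (?X y) (?X y a) l m * ?X y m a) * moore_re (J - {a} - set l) ?Y"
        by (simp add: qre_mult_commute[of "?X y m a"])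
    qed
    finally show ?thesis .
  qed
  have "has_bochner_integral M (\<lambda>y. dens T (insert m J) (x(m := y)))
    (real (card T) * dens T J x +
     (\<Sum>a\<in>J. \<Sum>l\<in>dlists (J - {a}). - ((- 1) ^ length l) * qre (row_path ?Y (?Y a) l a) * moore_re (J - {a} - set l) ?Y))"
    unfolding eq
  proof (intro has_bochner_integral_add has_bochner_integral_sum has_bochner_integral_mult_left has_bochner_integral_mult_right has_bochner_integral_kern_diag)
    fix a l assume a: "a \<in> J" and l: "l \<in> dlists (J - {a})"
    have l': "a \<notin> J - {a}" "distinct (a # l)" "set l \<subseteq> J - {a}" using l by (auto simp: dlists_def)
    obtain W e where e: "e \<in> insert a (J - {a})" and
      W: "\<And>X' m. (\<And>c d. c \<in> insert a (J - {a}) \<Longrightarrow> d \<in> insert a (J - {a}) \<Longrightarrow> X' c d = ?Y c d) \<Longrightarrow>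
        row_path X' (X' a) l m = W * X' e m"
      by (rule row_path_last_edge[OF l', where X = ?Y]) blast
    have em: "a \<noteq> m" "e \<noteq> m" using e a J by auto
    have "row_path (?X y) (?X y a) l m = W * ?X y e m" for y
      using a J by (intro W XY) auto
    moreover have "row_path ?Y (?Y a) l a = W * ?Y e a" by (intro W) auto
    moreover have "has_bochner_integral M (\<lambda>y. qre (W * (?X y e m * ?X y m a))) (qre (W * ?Y e a))"
      by (intro has_bochner_integral_bounded_linear[OF bounded_linear_qre]
          has_bochner_integral_bounded_linear[OF bounded_bilinear.bounded_linear_right[OF bounded_bilinear_cquat_mult]]
          has_bochner_integral_kern_kern em)
    ultimately show "has_bochner_integral M (\<lambda>y. qre (row_path (?X y) (?X y a) l m * ?X y m a)) (qre (row_path ?Y (?Y a) l a))"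
      by (simp add: mult.assoc)
  qed
  moreover have "(\<Sum>a\<in>J. \<Sum>l\<in>dlists (J - {a}). - ((- 1) ^ length l) * qre (row_path ?Y (?Y a) l a) * moore_re (J - {a} - set l) ?Y)
    = (\<Sum>a\<in>J. - dens T J x)"
  proof (rule sum.cong[OF refl])
    fix a assume "a \<in> J"
    then show "(\<Sum>l\<in>dlists (J - {a}). - ((- 1) ^ length l) * qre (row_path ?Y (?Y a) l a) * moore_re (J - {a} - set l) ?Y) = - dens T J x"
      using moore_re_rec[OF J(1) _ self_dual_kern, of a x] by (simp add: dens_def sum_negf)
  qed
  ultimately show ?thesis by (simp add: algebra_simps)
qed

lemma nn_integral_dens_insert:
  assumes J: "finite J" "m \<notin> J"
  shows "(\<integral>\<^sup>+y. ennreal (dens T (insert m J) (x(m := y))) \<partial>M) = of_nat (card T - card J) * ennreal (dens T J x)"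
proof -
  have "(\<integral>\<^sup>+y. ennreal (dens T (insert m J) (x(m := y))) \<partial>M) = ennreal ((real (card T) - real (card J)) * dens T J x)"
    using has_bochner_integral_dens_insert[OF assms] dens_nonneg[of "insert m J"] J
    by (intro nn_integral_eq_integral[THEN trans]) (auto simp: has_bochner_integral_iff)
  \<comment> \<open>If \<open>J\<close> is larger than \<open>T\<close>, the real difference is
    negative and the truncated one zero, but then the density vanishes.\<close>
  also have "(real (card T) - real (card J)) * dens T J x = real (card T - card J) * dens T J x"
    using dens_eq_0[OF J(1), of x] by (cases "card J \<le> card T") (auto simp: of_nat_diff)
  also have "ennreal (real (card T - card J) * dens T J x) = of_nat (card T - card J) * ennreal (dens T J x)"
    by (simp add: ennreal_mult dens_nonneg J ennreal_of_nat_eq_real_of_nat)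
  finally show ?thesis .
qed

text \<open>The points of \<open>L\<close> are integrated out one at a time; each contributes the
  rank minus the number of points still present.\<close>

lemma nn_integral_dens_union:
  assumes "finite L" "finite J" "J \<inter> L = {}" "\<And>a. a \<in> J \<Longrightarrow> x a \<in> space M"
  shows "(\<integral>\<^sup>+z. ennreal (dens T (J \<union> L) (\<lambda>a. if a \<in> J then x a else z a)) \<partial>Pi\<^sub>M L (\<lambda>_. M)) =
    of_nat (\<Prod>t<card L. card T - card J - t) * ennreal (dens T J x)"
  using assms(1,3)
proof (induction L rule: finite_induct)
  case empty
  have "dens T J (\<lambda>a. if a \<in> J then x a else z a) = dens T J x" for z
    using assms by (intro dens_cong) auto
  then show ?case by (simp add: PiM_empty)
next
  case (insert i L)
  have fin: "finite (J \<union> L)" and i: "i \<notin> J \<union> L" using insert assms by auto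
  let ?z = "\<lambda>z a. if a \<in> J then x a else z a"
  have z: "(\<lambda>z. ?z z a) \<in> measurable (Pi\<^sub>M K (\<lambda>_. M)) M" if "a \<in> J \<union> K" for a K
    using that assms(4) by (cases "a \<in> J") (auto intro: measurable_component_singleton)
  have m: "(\<lambda>z. ennreal (dens T (J \<union> insert i L) (?z z))) \<in> borel_measurable (Pi\<^sub>M (insert i L) (\<lambda>_. M))"
    using fin by (intro measurable_compose[OF _ measurable_ennreal] borel_measurable_dens_comp z) auto
  have "(\<integral>\<^sup>+z. ennreal (dens T (J \<union> insert i L) (?z z)) \<partial>Pi\<^sub>M (insert i L) (\<lambda>_. M)) =
    (\<integral>\<^sup>+z. \<integral>\<^sup>+y. ennreal (dens T (J \<union> insert i L) (?z (z(i := y)))) \<partial>M \<partial>Pi\<^sub>M L (\<lambda>_. M))"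
    using insert by (intro P.product_nn_integral_insert m) auto
  also have "\<dots> = (\<integral>\<^sup>+z. of_nat (card T - card (J \<union> L)) * ennreal (dens T (J \<union> L) (?z z)) \<partial>Pi\<^sub>M L (\<lambda>_. M))"
  proof -
    have "?z (z(i := y)) = (?z z)(i := y)" for z y using i by auto
    then show ?thesis using nn_integral_dens_insert[OF fin i] by simp
  qed
  also have "\<dots> = of_nat (card T - card (J \<union> L)) * (\<integral>\<^sup>+z. ennreal (dens T (J \<union> L) (?z z)) \<partial>Pi\<^sub>M L (\<lambda>_. M))"
    using fin by (intro nn_integral_cmult measurable_compose[OF _ measurable_ennreal] borel_measurable_dens_comp z) auto
  finally show ?case
    using insert assms by (simp add: card_Un_disjoint mult_ac)
qed

end

end

section \<open>Counting points\<close>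

text \<open>The values are chosen one coordinate at a time. Only earlier coordinates with the same
  label compete for a value, because the sets of different labels are disjoint.\<close>

lemma card_inj_PiE:
  fixes C :: "'i \<Rightarrow> 'b set" and b :: "nat \<Rightarrow> 'i"
  assumes "\<And>t. t < k \<Longrightarrow> finite (C (b t))"
    "\<And>s t. s < k \<Longrightarrow> t < k \<Longrightarrow> b s \<noteq> b t \<Longrightarrow> C (b s) \<inter> C (b t) = {}"
  shows "card {\<phi> \<in> Pi\<^sub>E {..<k} (\<lambda>t. C (b t)). inj_on \<phi> {..<k}} =
    (\<Prod>t<k. card (C (b t)) - card {s. s < t \<and> b s = b t})"
  using assms
proof (induction k)
  case 0
  have "{\<phi> \<in> Pi\<^sub>E {..<0::nat} (\<lambda>t. C (b t)). inj_on \<phi> {..<0}} = {\<lambda>_. undefined}" by auto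
  then show ?case by simp
next
  case (Suc k)
  let ?S = "\<lambda>k. {\<phi> \<in> Pi\<^sub>E {..<k} (\<lambda>t. C (b t)). inj_on \<phi> {..<k}}"
  let ?h = "\<lambda>(\<phi>, y). \<phi>(k := y)"
  let ?Q = "Sigma (?S k) (\<lambda>\<phi>. C (b k) - \<phi> ` {..<k})"
  have "?S (Suc k) = ?h ` ?Q"
  proof (intro set_eqI iffI)
    fix \<phi> assume \<phi>: "\<phi> \<in> ?S (Suc k)"
    let ?\<psi> = "\<phi>(k := undefined)"
    have "?\<psi> \<in> ?S k"
      using \<phi> by (auto simp: PiE_iff extensional_def inj_on_def)
    moreover have "\<phi> k \<in> C (b k) - ?\<psi> ` {..<k}"
    proof -
      have "\<phi> k \<noteq> \<phi> t" if "t < k" for t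
        using \<phi> that inj_onD[of \<phi> "{..<Suc k}" k t] by auto
      then show ?thesis using \<phi> by (auto simp: PiE_iff)
    qed
    ultimately show "\<phi> \<in> ?h ` ?Q" by (intro image_eqI[of _ _ "(?\<psi>, \<phi> k)"]) auto
  next
    fix \<phi> assume "\<phi> \<in> ?h ` ?Q"
    then obtain \<psi> y where \<psi>: "\<psi> \<in> ?S k" "y \<in> C (b k)" "y \<notin> \<psi> ` {..<k}" "\<phi> = \<psi>(k := y)" by auto
    then show "\<phi> \<in> ?S (Suc k)"
      by (auto simp: PiE_iff extensional_def inj_on_def less_Suc_eq image_iff)
  qed
  moreover have "inj_on ?h ?Q"
  proof (rule inj_onI)
    fix p q assume pq: "p \<in> ?Q" "q \<in> ?Q" "?h p = ?h q"
    obtain \<phi> y where p: "p = (\<phi>, y)" by (cases p)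
    obtain \<psi> z where q: "q = (\<psi>, z)" by (cases q)
    have e: "\<phi>(k := y) = \<psi>(k := z)" using pq p q by simp
    have "\<phi> = \<psi>"
    proof
      fix t show "\<phi> t = \<psi> t"
      proof (cases "t = k")
        case True then show ?thesis using pq p q by (auto simp: PiE_iff extensional_def)
      qed (use fun_cong[OF e, of t] in simp)
    qed
    moreover have "y = z" using fun_cong[OF e, of k] by simp
    ultimately show "p = q" using p q by simp
  qed
  ultimately have "card (?S (Suc k)) = card ?Q" by (simp add: card_image)
  also have "\<dots> = (\<Sum>\<phi>\<in>?S k. card (C (b k) - \<phi> ` {..<k}))"
  proof (rule card_SigmaI)
    show "finite (?S k)" by (rule finite_subset[OF _ finite_PiE[of "{..<k}" "\<lambda>t. C (b t)"]]) (use Suc in auto)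
  qed (use Suc in auto)
  also have "\<dots> = (\<Sum>\<phi>\<in>?S k. card (C (b k)) - card {s. s < k \<and> b s = b k})"
  proof (intro sum.cong refl)
    fix \<phi> assume \<phi>: "\<phi> \<in> ?S k"
    have "C (b k) \<inter> \<phi> ` {..<k} = \<phi> ` {s. s < k \<and> b s = b k}"
    proof (intro set_eqI iffI)
      fix y assume "y \<in> C (b k) \<inter> \<phi> ` {..<k}"
      then obtain s where s: "s < k" "y = \<phi> s" "y \<in> C (b k)" by auto
      then have "y \<in> C (b s)" using \<phi> by (auto simp: PiE_iff)
      then have "b s = b k" using Suc.prems(2)[of s k] s by auto
      then show "y \<in> \<phi> ` {s. s < k \<and> b s = b k}" using s by auto
    next
      fix y assume "y \<in> \<phi> ` {s. s < k \<and> b s = b k}"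
      then obtain s where s: "s < k" "b s = b k" "y = \<phi> s" by auto
      have "\<phi> s \<in> C (b s)" using \<phi> s(1) by (auto simp: PiE_iff)
      then show "y \<in> C (b k) \<inter> \<phi> ` {..<k}" using s by auto
    qed
    moreover have "card (\<phi> ` {s. s < k \<and> b s = b k}) = card {s. s < k \<and> b s = b k}"
      using \<phi> by (intro card_image) (auto intro: inj_on_subset)
    ultimately show "card (C (b k) - \<phi> ` {..<k}) = card (C (b k)) - card {s. s < k \<and> b s = b k}"
      by (subst card_Diff_subset_Int) auto
  qed
  also have "\<dots> = (\<Prod>t<Suc k. card (C (b t)) - card {s. s < t \<and> b s = b t})"
    using Suc by simp
  finally show ?case .
qed

text \<open>Inverts the layout of \<open>block_box\<close>: taking the least \<open>i\<close> skips
  blocks of length 0.\<close>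

definition block :: "(nat \<Rightarrow> nat) \<Rightarrow> nat \<Rightarrow> nat" where
  "block ks t = (LEAST i. t < (\<Sum>l<Suc i. ks l))"

lemma sum_lessThan_mono_nat: "(i :: nat) \<le> i' \<Longrightarrow> (\<Sum>l<i. ks l) \<le> (\<Sum>l<i'. ks l :: nat)"
  by (rule sum_mono2) auto

lemma block_eq:
  assumes "j < ks i" shows "block ks ((\<Sum>l<i. ks l) + j) = i"
  unfolding block_def
proof (rule Least_equality)
  fix i' assume "(\<Sum>l<i. ks l) + j < (\<Sum>l<Suc i'. ks l)"
  then have "\<not> (\<Sum>l<Suc i'. ks l) \<le> (\<Sum>l<i. ks l)" by simp
  then show "i \<le> i'" using sum_lessThan_mono_nat[of "Suc i'" i ks] by (meson not_less_eq_eq)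
qed (use assms in simp)

lemma block_cases:
  fixes m t :: nat and ks :: "nat \<Rightarrow> nat"
  assumes "t < (\<Sum>l<m. ks l)"
  obtains i j where "i < m" "j < ks i" "t = (\<Sum>l<i. ks l) + j"
proof -
  have "\<exists>i<m. \<exists>j<ks i. t = (\<Sum>l<i. ks l) + j"
    using assms
  proof (induction m)
    case (Suc m)
    show ?case
    proof (cases "t < (\<Sum>l<m. ks l)")
      case True
      then show ?thesis using Suc.IH by (meson less_SucI)
    next
      case False
      then have "t = (\<Sum>l<m. ks l) + (t - (\<Sum>l<m. ks l))" "t - (\<Sum>l<m. ks l) < ks m" using Suc.prems by auto
      then show ?thesis by blast
    qed
  qed simp
  then show ?thesis using that by blast
qed

lemma card_same_block:
  assumes "j < ks i" shows "card {s. s < (\<Sum>l<i. ks l) + j \<and> block ks s = i} = j"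
proof -
  have "{s. s < (\<Sum>l<i. ks l) + j \<and> block ks s = i} = {(\<Sum>l<i. ks l)..<(\<Sum>l<i. ks l) + j}"
  proof (intro set_eqI iffI)
    fix s assume s: "s \<in> {s. s < (\<Sum>l<i. ks l) + j \<and> block ks s = i}"
    have "\<not> s < (\<Sum>l<i. ks l)"
    proof
      assume "s < (\<Sum>l<i. ks l)"
      then obtain i' j' where "i' < i" "j' < ks i'" "s = (\<Sum>l<i'. ks l) + j'" by (rule block_cases)
      then show False using block_eq[of j' ks i'] s by simp
    qed
    then show "s \<in> {(\<Sum>l<i. ks l)..<(\<Sum>l<i. ks l) + j}" using s by simp
  next
    fix s assume "s \<in> {(\<Sum>l<i. ks l)..<(\<Sum>l<i. ks l) + j}"
    then show "s \<in> {s. s < (\<Sum>l<i. ks l) + j \<and> block ks s = i}"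
      using block_eq[of "s - (\<Sum>l<i. ks l)" ks i] assms by auto
  qed
  then show ?thesis by simp
qed

lemma prod_lessThan_add: "(\<Prod>t<a + b. h t) = (\<Prod>t<a. h t) * (\<Prod>j<b. h (a + j :: nat) :: 'c::comm_monoid_mult)"
  by (induction b) (auto simp: mult.assoc)

text \<open>The position of \<open>t\<close> within its block is the number of earlier coordinates
  in that block, which is the form needed for \<open>card_inj_PiE\<close>.\<close>

lemma prod_block:
  fixes g :: "nat \<Rightarrow> nat \<Rightarrow> 'c::comm_monoid_mult"
  shows "(\<Prod>i<m. \<Prod>j<ks i. g i j) =
    (\<Prod>t<(\<Sum>l<m. ks l). g (block ks t) (card {s. s < t \<and> block ks s = block ks t}))"
  by (induction m) (simp_all add: prod_lessThan_add block_eq card_same_block)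

lemma block_box_iff:
  "x \<in> block_box m ks A \<longleftrightarrow>
    x \<in> extensional {..<\<Sum>i<m. ks i} \<and> (\<forall>t<\<Sum>i<m. ks i. x t \<in> A (block ks t))"
proof -
  have "(\<forall>i<m. \<forall>j\<in>{(\<Sum>l<i. ks l)..<(\<Sum>l<Suc i. ks l)}. x j \<in> A i) \<longleftrightarrow> (\<forall>t<\<Sum>i<m. ks i. x t \<in> A (block ks t))"
    (is "?L \<longleftrightarrow> ?R")
  proof
    assume L: ?L
    show ?R
    proof (intro allI impI)
      fix t assume "t < (\<Sum>i<m. ks i)"
      then obtain i j where "i < m" "j < ks i" "t = (\<Sum>l<i. ks l) + j" by (rule block_cases)
      then show "x t \<in> A (block ks t)" using L block_eq[of j ks i] by auto
    qed
  next
    assume R: ?R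
    show ?L
    proof (intro allI impI ballI)
      fix i j assume i: "i < m" and j: "j \<in> {(\<Sum>l<i. ks l)..<(\<Sum>l<Suc i. ks l)}"
      have "j < (\<Sum>l<m. ks l)" using j sum_lessThan_mono_nat[of "Suc i" m ks] i by auto
      moreover have "block ks j = i" using block_eq[of "j - (\<Sum>l<i. ks l)" ks i] j by auto
      ultimately show "x j \<in> A i" using R by auto
    qed
  qed
  then show ?thesis unfolding block_box_def by simp
qed

lemma num_points_finite: "finite X \<Longrightarrow> num_points A X = of_nat (card (X \<inter> A))"
  by (simp add: num_points_def emeasure_count_space_finite)

lemma falling_count_finite: "finite X \<Longrightarrow> falling_count A k X = of_nat (\<Prod>j<k. card (X \<inter> A) - j)"
proof -
  assume "finite X"
  have "of_nat a - of_nat b = (of_nat (a - b) :: ennreal)" for a b :: nat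
    unfolding ennreal_of_nat_eq_real_of_nat
    by (cases "b \<le> a") (simp_all add: ennreal_minus of_nat_diff ennreal_neg)
  then show ?thesis unfolding falling_count_def num_points_finite[OF \<open>finite X\<close>] by simp
qed

definition inj_maps :: "nat \<Rightarrow> nat \<Rightarrow> (nat \<Rightarrow> nat) set" where
  "inj_maps k n = {\<phi> \<in> {..<k} \<rightarrow>\<^sub>E {..<n}. inj_on \<phi> {..<k}}"

lemma finite_inj_maps [simp]: "finite (inj_maps k n)"
  unfolding inj_maps_def by (rule finite_subset[OF _ finite_PiE[of "{..<k}" "\<lambda>_. {..<n}"]]) auto

lemma card_inj_maps: "card (inj_maps k n) = (\<Prod>t<k. n - t)"
  using card_inj_PiE[of k "\<lambda>_. {..<n}" "\<lambda>_. ()"] by (simp add: inj_maps_def)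

lemma prod_diff_mult_fact: "k \<le> n \<Longrightarrow> (\<Prod>t<k. n - t) * fact (n - k) = (fact n :: nat)"
proof (induction k)
  case (Suc k)
  then have "n - k = Suc (n - Suc k)" by simp
  then have "(n - k) * fact (n - Suc k) = (fact (n - k) :: nat)" by simp
  then show ?case using Suc by (simp add: mult.assoc)
qed simp

text \<open>A product of falling factorials over disjoint sets counts ordered selections of distinct
  points with prescribed sets. Indexing them by injections makes the expression a finite sum of
  products, ready for integration.\<close>

lemma prod_falling_count:
  assumes x: "inj_on x {..<n}" and A: "disjoint_family_on A {..<m}" and k: "(\<Sum>i<m. ks i) = k"
  shows "(\<Prod>i<m. falling_count (A i) (ks i) (x ` {..<n})) =
    (\<Sum>\<phi>\<in>inj_maps k n. \<Prod>t<k. indicator (A (block ks t)) (x (\<phi> t)))"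
proof -
  let ?C = "\<lambda>i. {a. a < n \<and> x a \<in> A i}"
  let ?B = "\<lambda>t. A (block ks t)"
  have "card (x ` {..<n} \<inter> A i) = card (?C i)" for i
  proof -
    have "x ` {..<n} \<inter> A i = x ` ?C i" by auto
    then show ?thesis using x by (auto intro!: card_image inj_on_subset[OF x])
  qed
  then have "(\<Prod>i<m. falling_count (A i) (ks i) (x ` {..<n})) = of_nat (\<Prod>i<m. \<Prod>j<ks i. card (?C i) - j)"
    by (simp add: falling_count_finite)
  also have "(\<Prod>i<m. \<Prod>j<ks i. card (?C i) - j) =
      (\<Prod>t<k. card (?C (block ks t)) - card {s. s < t \<and> block ks s = block ks t})"
    unfolding prod_block k ..
  also have "\<dots> = card {\<phi> \<in> Pi\<^sub>E {..<k} (\<lambda>t. ?C (block ks t)). inj_on \<phi> {..<k}}"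
  proof (rule card_inj_PiE[symmetric])
    fix s t assume st: "s < k" "t < k" "block ks s \<noteq> block ks t"
    have "block ks r < m" if "r < k" for r
      using that unfolding k[symmetric] by (rule block_cases) (simp add: block_eq)
    then have "A (block ks s) \<inter> A (block ks t) = {}"
      using A st by (simp add: disjoint_family_on_def)
    then show "?C (block ks s) \<inter> ?C (block ks t) = {}" by blast
  qed simp
  also have "{\<phi> \<in> Pi\<^sub>E {..<k} (\<lambda>t. ?C (block ks t)). inj_on \<phi> {..<k}} = {\<phi> \<in> inj_maps k n. \<forall>t<k. x (\<phi> t) \<in> ?B t}"
    by (auto simp: inj_maps_def PiE_iff)
  also have "of_nat (card {\<phi> \<in> inj_maps k n. \<forall>t<k. x (\<phi> t) \<in> ?B t}) = (\<Sum>\<phi>\<in>inj_maps k n. if \<forall>t<k. x (\<phi> t) \<in> ?B t then 1 else 0 :: ennreal)"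
    by (simp add: sum.If_cases Int_def)
  also have "\<dots> = (\<Sum>\<phi>\<in>inj_maps k n. \<Prod>t<k. indicator (?B t) (x (\<phi> t)))"
  proof (intro sum.cong refl)
    fix \<phi>
    show "(if \<forall>t<k. x (\<phi> t) \<in> ?B t then 1 else 0 :: ennreal) = (\<Prod>t<k. indicator (?B t) (x (\<phi> t)))"
      by (auto simp: indicator_def intro!: prod_zero[symmetric])
  qed
  finally show ?thesis .
qed

section \<open>Point fields with a given number of points\<close>

lemma configuration_space_generator:
  "{{X \<in> configurations. num_points A X \<in> B} | A B. A \<in> sets borel \<and> B \<in> sets borel} \<subseteq> Pow configurations"
  by auto

lemma space_configuration_space: "space configuration_space = configurations"
  unfolding configuration_space_def by (rule space_measure_of[OF configuration_space_generator])

lemma measurable_num_points [measurable]: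
  assumes "A \<in> sets borel" shows "num_points A \<in> borel_measurable configuration_space"
proof (rule measurableI)
  fix B :: "ennreal set" assume "B \<in> sets borel"
  then have "{X \<in> configurations. num_points A X \<in> B} \<in> sets configuration_space"
    unfolding configuration_space_def sets_measure_of[OF configuration_space_generator]
    using assms by (intro sigma_sets.Basic) auto
  moreover have "{X \<in> configurations. num_points A X \<in> B} = num_points A -` B \<inter> space configuration_space"
    by (auto simp: space_configuration_space)
  ultimately show "num_points A -` B \<inter> space configuration_space \<in> sets configuration_space" by simp
qed simp

lemma measurable_falling_count [measurable]:
  "A \<in> sets borel \<Longrightarrow> falling_count A k \<in> borel_measurable configuration_space"
  unfolding falling_count_def
  by (intro borel_measurable_prod_ennreal borel_measurable_minus_ennreal measurable_num_points borel_measurable_const)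

lemma finite_in_configurations: "finite X \<Longrightarrow> X \<in> configurations"
  by (simp add: configurations_def countable_finite)

lemma measurable_configuration_space:
  fixes f :: "'a \<Rightarrow> 'b::topological_space set"
  assumes "\<And>x. x \<in> space N \<Longrightarrow> f x \<in> configurations"
    "\<And>A. A \<in> sets borel \<Longrightarrow> (\<lambda>x. num_points A (f x)) \<in> borel_measurable N"
  shows "f \<in> measurable N configuration_space"
  unfolding configuration_space_def
proof (rule measurable_measure_of[OF configuration_space_generator])
  show "f \<in> space N \<rightarrow> configurations" using assms(1) by auto
next
  fix Y :: "'b set set"
  assume "Y \<in> {{X \<in> configurations. num_points A X \<in> B} | A B. A \<in> sets borel \<and> B \<in> sets borel}"
  then obtain A B where "A \<in> sets borel" "B \<in> sets borel" "Y = {X \<in> configurations. num_points A X \<in> B}" by auto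
  moreover from this have "f -` Y \<inter> space N = (\<lambda>x. num_points A (f x)) -` B \<inter> space N" using assms(1) by auto
  ultimately show "f -` Y \<inter> space N \<in> sets N" using measurable_sets[OF assms(2)] by simp
qed

text \<open>A finite product of sigma-finite measures is determined by its values on boxes, where
  reindexing permutes the factors.\<close>

lemma (in product_sigma_finite) distr_PiM_reindex_finite:
  assumes "finite J" "inj_on f J"
  shows "distr (Pi\<^sub>M (f ` J) M) (Pi\<^sub>M J (\<lambda>i. M (f i))) (\<lambda>\<omega>. \<lambda>n\<in>J. \<omega> (f n)) = Pi\<^sub>M J (\<lambda>i. M (f i))"
proof -
  interpret f: product_sigma_finite "\<lambda>i. M (f i)" by standard
  let ?t = "\<lambda>\<omega>. \<lambda>n\<in>J. \<omega> (f n)"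
  have t: "?t \<in> measurable (Pi\<^sub>M (f ` J) M) (Pi\<^sub>M J (\<lambda>i. M (f i)))"
    by (intro measurable_restrict measurable_component_singleton) auto
  show ?thesis
  proof (rule f.PiM_eqI[OF assms(1)])
    fix A assume A: "\<And>i. i \<in> J \<Longrightarrow> A i \<in> sets (M (f i))"
    let ?A = "\<lambda>j. A (the_inv_into J f j)"
    have [simp]: "i \<in> J \<Longrightarrow> the_inv_into J f (f i) = i" for i
      using assms by (intro the_inv_into_f_f) auto
    have "emeasure (distr (Pi\<^sub>M (f ` J) M) (Pi\<^sub>M J (\<lambda>i. M (f i))) ?t) (Pi\<^sub>E J A) =
      emeasure (Pi\<^sub>M (f ` J) M) (?t -` Pi\<^sub>E J A \<inter> space (Pi\<^sub>M (f ` J) M))"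
      using A assms by (intro emeasure_distr t sets_PiM_I_finite) auto
    also have "?t -` Pi\<^sub>E J A \<inter> space (Pi\<^sub>M (f ` J) M) = Pi\<^sub>E (f ` J) ?A"
      using A[THEN sets.sets_into_space] by (auto simp: space_PiM PiE_iff extensional_def) blast+
    also have "emeasure (Pi\<^sub>M (f ` J) M) (Pi\<^sub>E (f ` J) ?A) = (\<Prod>j\<in>f ` J. emeasure (M j) (?A j))"
      using A assms by (intro emeasure_PiM) auto
    also have "\<dots> = (\<Prod>i\<in>J. emeasure (M (f i)) (A i))"
      using assms by (simp add: prod.reindex)
    finally show "emeasure (distr (Pi\<^sub>M (f ` J) M) (Pi\<^sub>M J (\<lambda>i. M (f i))) ?t) (Pi\<^sub>E J A) = (\<Prod>i\<in>J. emeasure (M (f i)) (A i))" .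
  qed simp
qed

context quat_system begin

context
  fixes T :: "nat set"
  assumes T: "finite T" "T \<subseteq> I"
begin

text \<open>The points outside the image of \<open>\<phi>\<close> are integrated out, giving the
  factorial; the remaining ones are renamed along \<open>\<phi>\<close>, under which the density is
  invariant.\<close>

lemma nn_integral_dens_projection:
  assumes \<phi>: "\<phi> \<in> inj_maps k n" and B: "\<And>t. t < k \<Longrightarrow> B t \<in> sets M" and n: "n = card T"
  shows "(\<integral>\<^sup>+x. ennreal (dens T {..<n} x) * (\<Prod>t<k. indicator (B t) (x (\<phi> t))) \<partial>Pi\<^sub>M {..<n} (\<lambda>_. M)) =
    fact (n - k) * (\<integral>\<^sup>+x. ennreal (dens T {..<k} x) * (\<Prod>t<k. indicator (B t) (x t)) \<partial>Pi\<^sub>M {..<k} (\<lambda>_. M))"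
proof -
  define J where "J = \<phi> ` {..<k}"
  define L where "L = {..<n} - J"
  have inj: "inj_on \<phi> {..<k}" and J: "J \<subseteq> {..<n}" using \<phi> by (auto simp: inj_maps_def J_def)
  have fin: "finite J" "finite L" "J \<inter> L = {}" and JL: "J \<union> L = {..<n}" using J by (auto simp: L_def J_def)
  have cJ: "card J = k" using inj by (simp add: J_def card_image)
  have cL: "card L = n - k" using J cJ fin by (simp add: L_def card_Diff_subset)
  have \<phi>J: "\<phi> t \<in> J" if "t < k" for t using that by (auto simp: J_def)
  let ?i = "\<lambda>x. (\<Prod>t<k. indicator (B t) (x (\<phi> t))) :: ennreal"
  have comp: "(\<lambda>x. indicator (B t) (x (\<phi> t)) :: ennreal) \<in> borel_measurable (Pi\<^sub>M K (\<lambda>_. M))"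
    if "t < k" "J \<subseteq> K" for t K
    using that B \<phi>J by (intro measurable_compose[OF measurable_component_singleton borel_measurable_indicator]) auto
  have i: "?i \<in> borel_measurable (Pi\<^sub>M K (\<lambda>_. M))" if "J \<subseteq> K" for K
    using comp[OF _ that] by (intro borel_measurable_prod_ennreal) auto
  have m: "(\<lambda>x. ennreal (dens T {..<n} x) * ?i x) \<in> borel_measurable (Pi\<^sub>M (J \<union> L) (\<lambda>_. M))"
    using T J by (intro borel_measurable_times_ennreal i measurable_compose[OF borel_measurable_dens measurable_ennreal]) (auto simp: JL)
  have "(\<integral>\<^sup>+x. ennreal (dens T {..<n} x) * ?i x \<partial>Pi\<^sub>M {..<n} (\<lambda>_. M)) =
    (\<integral>\<^sup>+x. \<integral>\<^sup>+z. ennreal (dens T {..<n} (merge J L (x, z))) * ?i (merge J L (x, z)) \<partial>Pi\<^sub>M L (\<lambda>_. M) \<partial>Pi\<^sub>M J (\<lambda>_. M))"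
    unfolding JL[symmetric] using fin m by (subst P.product_nn_integral_fold) (auto simp: JL)
  also have "\<dots> = (\<integral>\<^sup>+x. fact (n - k) * (ennreal (dens T J x) * ?i x) \<partial>Pi\<^sub>M J (\<lambda>_. M))"
  proof (rule nn_integral_cong)
    fix x assume x: "x \<in> space (Pi\<^sub>M J (\<lambda>_. M))"
    have 1: "?i (merge J L (x, z)) = ?i x" for z
      using \<phi>J by (intro prod.cong refl) (auto simp: merge_def)
    have 2: "dens T {..<n} (merge J L (x, z)) = dens T (J \<union> L) (\<lambda>a. if a \<in> J then x a else z a)" for z
      unfolding JL[symmetric] using T fin by (intro dens_cong) (auto simp: merge_def)
    have xM: "x a \<in> space M" if "a \<in> J" for a using x that by (auto simp: space_PiM)
    have m': "(\<lambda>z. ennreal (dens T (J \<union> L) (\<lambda>a. if a \<in> J then x a else z a))) \<in> borel_measurable (Pi\<^sub>M L (\<lambda>_. M))"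
    proof (intro measurable_compose[OF _ measurable_ennreal] borel_measurable_dens_comp T)
      fix a assume "a \<in> J \<union> L"
      then show "(\<lambda>z. if a \<in> J then x a else z a) \<in> Pi\<^sub>M L (\<lambda>_. M) \<rightarrow>\<^sub>M M"
        using xM by (cases "a \<in> J") (auto intro: measurable_component_singleton)
    qed (use fin in auto)
    \<comment> \<open>Here \<open>card T - card J\<close> and \<open>card L\<close> are both
      \<open>n - k\<close>, so the falling product runs all the way down to 1.\<close>
    have f: "(\<Prod>t<card L. card T - card J - t) = (fact (n - k) :: nat)"
      using cL cJ n by (simp add: fact_prod_rev atLeast0LessThan)
    have "(\<integral>\<^sup>+z. ennreal (dens T {..<n} (merge J L (x, z))) * ?i (merge J L (x, z)) \<partial>Pi\<^sub>M L (\<lambda>_. M)) =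
      (\<integral>\<^sup>+z. ennreal (dens T (J \<union> L) (\<lambda>a. if a \<in> J then x a else z a)) \<partial>Pi\<^sub>M L (\<lambda>_. M)) * ?i x"
      unfolding 1 2 by (rule nn_integral_multc[OF m'])
    also have "\<dots> = fact (n - k) * (ennreal (dens T J x) * ?i x)"
      using nn_integral_dens_union[OF T fin(2,1,3), of x] xM unfolding f by (simp add: mult.assoc)
    finally show "(\<integral>\<^sup>+z. ennreal (dens T {..<n} (merge J L (x, z))) * ?i (merge J L (x, z)) \<partial>Pi\<^sub>M L (\<lambda>_. M)) =
      fact (n - k) * (ennreal (dens T J x) * ?i x)" .
  qed
  also have "\<dots> = fact (n - k) * (\<integral>\<^sup>+x. ennreal (dens T J x) * ?i x \<partial>Pi\<^sub>M J (\<lambda>_. M))"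
    using T fin by (intro nn_integral_cmult borel_measurable_times_ennreal i measurable_compose[OF borel_measurable_dens measurable_ennreal]) auto
  also have "(\<integral>\<^sup>+x. ennreal (dens T J x) * ?i x \<partial>Pi\<^sub>M J (\<lambda>_. M)) =
     (\<integral>\<^sup>+x. ennreal (dens T {..<k} x) * (\<Prod>t<k. indicator (B t) (x t)) \<partial>Pi\<^sub>M {..<k} (\<lambda>_. M))"
  proof -
    let ?t = "\<lambda>x. \<lambda>t\<in>{..<k}. x (\<phi> t)"
    let ?g = "\<lambda>x. ennreal (dens T {..<k} x) * (\<Prod>t<k. indicator (B t) (x t))"
    have "(\<lambda>x. indicator (B t) (x t) :: ennreal) \<in> borel_measurable (Pi\<^sub>M {..<k} (\<lambda>_. M))" if "t < k" for t
      using that B by (intro measurable_compose[OF measurable_component_singleton borel_measurable_indicator]) auto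
    then have g: "?g \<in> borel_measurable (Pi\<^sub>M {..<k} (\<lambda>_. M))"
      using T by (intro borel_measurable_times_ennreal borel_measurable_prod_ennreal measurable_compose[OF borel_measurable_dens measurable_ennreal]) auto
    have t: "?t \<in> measurable (Pi\<^sub>M J (\<lambda>_. M)) (Pi\<^sub>M {..<k} (\<lambda>_. M))"
      using \<phi>J by (intro measurable_restrict measurable_component_singleton) auto
    have "(\<integral>\<^sup>+x. ?g x \<partial>Pi\<^sub>M {..<k} (\<lambda>_. M)) = (\<integral>\<^sup>+x. ?g x \<partial>distr (Pi\<^sub>M J (\<lambda>_. M)) (Pi\<^sub>M {..<k} (\<lambda>_. M)) ?t)"
      unfolding J_def using P.distr_PiM_reindex_finite[OF _ inj] by simp
    also have "\<dots> = (\<integral>\<^sup>+x. ?g (?t x) \<partial>Pi\<^sub>M J (\<lambda>_. M))"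
      using g by (intro nn_integral_distr[OF t]) (simp only: measurable_distr_eq1)
    also have "\<dots> = (\<integral>\<^sup>+x. ennreal (dens T J x) * ?i x \<partial>Pi\<^sub>M J (\<lambda>_. M))"
    proof (rule nn_integral_cong)
      fix x
      have "dens T J x = dens T {..<k} (\<lambda>t. x (\<phi> t))" unfolding J_def using T inj by (intro dens_compose) auto
      also have "\<dots> = dens T {..<k} (?t x)" using T by (intro dens_cong) auto
      finally show "?g (?t x) = ennreal (dens T J x) * ?i x" by simp
    qed
    finally show ?thesis by (rule sym)
  qed
  finally show ?thesis .
qed

lemma nn_integral_dens_total:
  "(\<integral>\<^sup>+x. ennreal (dens T {..<k} x) \<partial>Pi\<^sub>M {..<k} (\<lambda>_. M)) = of_nat (\<Prod>t<k. card T - t)"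
proof -
  have "dens T {..<k} (\<lambda>a. if a \<in> {} then undefined else z a) = dens T {..<k} z" for z by simp
  then show ?thesis using nn_integral_dens_union[OF T, of "{..<k}" "{}" "\<lambda>_. undefined"] T by simp
qed

end

end

section \<open>The law of a projection field\<close>

locale point_system = quat_system M I u
  for M :: "'a::topological_space measure" and I u +
  assumes sets_M: "sets M = sets borel"
begin

definition good :: "nat set \<Rightarrow> nat \<Rightarrow> (nat \<Rightarrow> 'a) \<Rightarrow> bool" where
  "good T n x \<longleftrightarrow> (\<forall>i\<in>{..<n}. \<forall>j\<in>{..<n}. i \<noteq> j \<longrightarrow> (\<exists>s\<in>T. u s (x i) \<noteq> u s (x j)))"

text \<open>The diagonal of a product space need not be measurable. But the density vanishes wherever two
  points cannot be told apart by the functions \<open>u s\<close>, and elsewhere the points are distinct.\<close>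

definition config :: "nat set \<Rightarrow> (nat \<Rightarrow> 'a) \<Rightarrow> 'a set" where
  "config T x = (if good T (card T) x then x ` {..<card T} else {})"

text \<open>The density lives on ordered tuples, where its mass is \<open>fact (card T)\<close>;
  hence the division.\<close>

definition point_law :: "nat set \<Rightarrow> 'a set measure" where
  "point_law T = distr (density (Pi\<^sub>M {..<card T} (\<lambda>_. M)) (\<lambda>x. ennreal (dens T {..<card T} x / fact (card T))))
     configuration_space (config T)"

lemma good_inj: "good T n x \<Longrightarrow> inj_on x {..<n}"
  unfolding good_def by (rule inj_onI) metis

context
  fixes T :: "nat set"
  assumes T: "finite T" "T \<subseteq> I"
begin

lemma pred_good [measurable]: "Measurable.pred (Pi\<^sub>M {..<n} (\<lambda>_. M)) (good T n)"
proof -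
  have m: "(\<lambda>x. u s (x i)) \<in> borel_measurable (Pi\<^sub>M {..<n} (\<lambda>_. M))" if "s \<in> T" "i \<in> {..<n}" for s i
    using that T by (intro measurable_compose[OF _ measurable_u]) (auto intro: measurable_component_singleton)
  have neq: "Measurable.pred (Pi\<^sub>M {..<n} (\<lambda>_. M)) (\<lambda>x. u s (x i) \<noteq> u s (x j))"
    if "s \<in> T" "i \<in> {..<n}" "j \<in> {..<n}" for s i j
  proof -
    let ?N = "Pi\<^sub>M {..<n} (\<lambda>_. M)"
    have "(\<lambda>x. u s (x i) - u s (x j)) -` (- {0}) \<inter> space ?N \<in> sets ?N"
      by (rule measurable_sets[OF borel_measurable_diff[OF m[OF that(1,2)] m[OF that(1,3)]]]) simp
    also have "(\<lambda>x. u s (x i) - u s (x j)) -` (- {0}) \<inter> space ?N = {x \<in> space ?N. u s (x i) \<noteq> u s (x j)}"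
      by auto
    finally show ?thesis by (simp add: pred_def)
  qed
  show ?thesis
    unfolding good_def using T
    by (intro pred_intros_finite(3) pred_intros_finite(4) pred_intros_imp' neq) auto
qed

lemma num_points_config:
  "num_points A (config T x) = (if good T (card T) x then \<Sum>i<card T. indicator A (x i) else 0)"
proof (cases "good T (card T) x")
  case True
  have "x ` {..<card T} \<inter> A = x ` {i. i < card T \<and> x i \<in> A}" by auto
  also have "card \<dots> = card {i. i < card T \<and> x i \<in> A}"
    using good_inj[OF True] by (intro card_image) (auto intro: inj_on_subset)
  finally have "num_points A (config T x) = of_nat (card {i. i < card T \<and> x i \<in> A})"
    using True by (simp add: num_points_finite config_def)
  also have "\<dots> = (\<Sum>i<card T. indicator A (x i))"
    by (simp add: indicator_def sum.If_cases Int_def)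
  finally show ?thesis using True by simp
qed (simp add: config_def num_points_finite)

lemma measurable_config [measurable]:
  "config T \<in> measurable (Pi\<^sub>M {..<card T} (\<lambda>_. M)) configuration_space"
proof (rule measurable_configuration_space)
  show "config T x \<in> configurations" for x by (auto simp: config_def intro: finite_in_configurations)
  fix A :: "'a set" assume A: "A \<in> sets borel"
  have "(\<lambda>x. indicator A (x i) :: ennreal) \<in> borel_measurable (Pi\<^sub>M {..<card T} (\<lambda>_. M))" if "i < card T" for i
    using that A sets_M by (intro measurable_compose[OF measurable_component_singleton borel_measurable_indicator]) auto
  then show "(\<lambda>x. num_points A (config T x)) \<in> borel_measurable (Pi\<^sub>M {..<card T} (\<lambda>_. M))"
    unfolding num_points_config using pred_good by (intro measurable_If borel_measurable_sum borel_measurable_const) auto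
qed

lemma dens_not_good: "\<not> good T n x \<Longrightarrow> dens T {..<n} x = 0"
  unfolding good_def using dens_equal_points[OF T, of "{..<n}"] by blast

lemma nn_integral_point_law:
  assumes "f \<in> borel_measurable configuration_space"
  shows "(\<integral>\<^sup>+X. f X \<partial>point_law T) =
    (\<integral>\<^sup>+x. ennreal (dens T {..<card T} x / fact (card T)) * f (config T x) \<partial>Pi\<^sub>M {..<card T} (\<lambda>_. M))"
proof -
  have d: "(\<lambda>x. ennreal (dens T {..<card T} x / fact (card T))) \<in> borel_measurable (Pi\<^sub>M {..<card T} (\<lambda>_. M))"
    using T by (intro measurable_compose[OF _ measurable_ennreal] borel_measurable_divide borel_measurable_dens) auto
  show ?thesis unfolding point_law_def using assms d measurable_config
    by (simp add: nn_integral_distr nn_integral_density)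
qed

lemma sets_point_law [simp]: "sets (point_law T) = sets configuration_space"
  by (simp add: point_law_def)

lemma ennreal_div_fact: "0 \<le> r \<Longrightarrow> ennreal (r / fact n) = ennreal r * ennreal (1 / fact n)"
  by (simp add: ennreal_mult[symmetric])

lemma prob_space_point_law: "prob_space (point_law T)"
proof
  let ?n = "card T"
  have "emeasure (point_law T) (space (point_law T)) = (\<integral>\<^sup>+X. 1 \<partial>point_law T)" by simp
  also have "\<dots> = (\<integral>\<^sup>+x. ennreal (dens T {..<?n} x) * ennreal (1 / fact ?n) \<partial>Pi\<^sub>M {..<?n} (\<lambda>_. M))"
    unfolding nn_integral_point_law[OF borel_measurable_const]
    by (intro nn_integral_cong) (simp only: mult_1_right ennreal_div_fact[OF dens_nonneg[OF T finite_lessThan]])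
  also have "\<dots> = of_nat (\<Prod>t<?n. ?n - t) * ennreal (1 / fact ?n)"
    using T by (subst nn_integral_multc) (auto intro!: measurable_compose[OF borel_measurable_dens measurable_ennreal] simp: nn_integral_dens_total)
  also have "(\<Prod>t<?n. ?n - t) = fact ?n" by (simp add: fact_prod_rev atLeast0LessThan)
  also have "of_nat (fact ?n) * ennreal (1 / fact ?n) = 1"
    unfolding ennreal_of_nat_eq_real_of_nat by (subst ennreal_mult[symmetric]) auto
  finally show "emeasure (point_law T) (space (point_law T)) = 1" .
qed

text \<open>Every injection contributes \<open>fact (card T - k)\<close> times the right-hand side,
  and their number times this factorial is the normalising constant.\<close>

lemma nn_integral_point_law_falling:
  assumes A: "disjoint_family_on A {..<m}" "\<And>i. i < m \<Longrightarrow> A i \<in> sets borel" and k: "(\<Sum>i<m. ks i) = k"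
  shows "(\<integral>\<^sup>+X. (\<Prod>i<m. falling_count (A i) (ks i) X) \<partial>point_law T) =
    (\<integral>\<^sup>+x. ennreal (dens T {..<k} x) * (\<Prod>t<k. indicator (A (block ks t)) (x t)) \<partial>Pi\<^sub>M {..<k} (\<lambda>_. M))"
    (is "_ = ?R")
proof -
  let ?n = "card T" and ?B = "\<lambda>t. A (block ks t)"
  have B: "?B t \<in> sets M" if "t < k" for t
    using that unfolding k[symmetric] sets_M by (rule block_cases) (simp add: block_eq A)
  have "(\<integral>\<^sup>+X. (\<Prod>i<m. falling_count (A i) (ks i) X) \<partial>point_law T) =
    (\<integral>\<^sup>+x. ennreal (dens T {..<?n} x / fact ?n) * (\<Prod>i<m. falling_count (A i) (ks i) (config T x)) \<partial>Pi\<^sub>M {..<?n} (\<lambda>_. M))"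
    using A by (intro nn_integral_point_law borel_measurable_prod_ennreal measurable_falling_count) auto
  also have "\<dots> = (\<integral>\<^sup>+x. ennreal (1 / fact ?n) * (\<Sum>\<phi>\<in>inj_maps k ?n. ennreal (dens T {..<?n} x) * (\<Prod>t<k. indicator (?B t) (x (\<phi> t)))) \<partial>Pi\<^sub>M {..<?n} (\<lambda>_. M))"
  proof (rule nn_integral_cong)
    fix x
    show "ennreal (dens T {..<?n} x / fact ?n) * (\<Prod>i<m. falling_count (A i) (ks i) (config T x)) =
      ennreal (1 / fact ?n) * (\<Sum>\<phi>\<in>inj_maps k ?n. ennreal (dens T {..<?n} x) * (\<Prod>t<k. indicator (?B t) (x (\<phi> t))))"
    proof (cases "good T ?n x")
      case True
      then have c: "config T x = x ` {..<?n}" by (simp add: config_def)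
      have d: "0 \<le> dens T {..<?n} x" using T by (intro dens_nonneg) auto
      show ?thesis
        unfolding c prod_falling_count[OF good_inj[OF True] A(1) k] sum_distrib_left[symmetric] ennreal_div_fact[OF d]
        by (simp only: mult_ac)
    qed (simp add: dens_not_good)
  qed
  also have "\<dots> = ennreal (1 / fact ?n) * (\<Sum>\<phi>\<in>inj_maps k ?n. \<integral>\<^sup>+x. ennreal (dens T {..<?n} x) * (\<Prod>t<k. indicator (?B t) (x (\<phi> t))) \<partial>Pi\<^sub>M {..<?n} (\<lambda>_. M))"
  proof -
    have "(\<lambda>x. ennreal (dens T {..<?n} x) * (\<Prod>t<k. indicator (?B t) (x (\<phi> t)))) \<in> borel_measurable (Pi\<^sub>M {..<?n} (\<lambda>_. M))"
      if "\<phi> \<in> inj_maps k ?n" for \<phi>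
    proof (intro borel_measurable_times_ennreal borel_measurable_prod_ennreal)
      show "(\<lambda>x. ennreal (dens T {..<?n} x)) \<in> borel_measurable (Pi\<^sub>M {..<?n} (\<lambda>_. M))"
        using T by (intro measurable_compose[OF borel_measurable_dens measurable_ennreal]) auto
      fix t assume "t \<in> {..<k}"
      then show "(\<lambda>x. indicator (?B t) (x (\<phi> t)) :: ennreal) \<in> borel_measurable (Pi\<^sub>M {..<?n} (\<lambda>_. M))"
        using that B by (intro measurable_compose[OF measurable_component_singleton borel_measurable_indicator])
          (auto simp: inj_maps_def)
    qed
    then show ?thesis by (subst nn_integral_cmult) (auto simp: nn_integral_sum)
  qed
  also have "\<dots> = ennreal (1 / fact ?n) * (\<Sum>\<phi>\<in>inj_maps k ?n. fact (?n - k) * ?R)"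
    using nn_integral_dens_projection[OF T _ B refl] by simp
  also have "\<dots> = ?R"
  proof (cases "k \<le> ?n")
    case True
    have "card (inj_maps k ?n) * fact (?n - k) = (fact ?n :: nat)"
      using True by (simp add: card_inj_maps prod_diff_mult_fact)
    then have "(of_nat (card (inj_maps k ?n)) * fact (?n - k) :: ennreal) = of_nat (fact ?n)"
      by (metis of_nat_fact of_nat_mult)
    moreover have "ennreal (1 / fact ?n) * of_nat (fact ?n) = 1"
      unfolding ennreal_of_nat_eq_real_of_nat by (subst ennreal_mult[symmetric]) auto
    ultimately show ?thesis by (simp add: mult.assoc[symmetric])
  next
    case False
    \<comment> \<open>The falling product contains the factor at \<open>t = card T\<close>, which is
      0. The density of more points than eigenfunctions vanishes as well, so both sides are
      0.\<close>
    then have "card (inj_maps k ?n) = 0" unfolding card_inj_maps by (auto intro!: bexI[of _ ?n])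
    moreover have "dens T {..<k} x = 0" for x using dens_eq_0[OF T, of "{..<k}" x] False by simp
    ultimately show ?thesis by simp
  qed
  finally show ?thesis .
qed

end

end

section \<open>Random selection of eigenfunctions\<close>

locale pfaffian_data = point_system M I u
  for M :: "'a::t2_space measure" and I u +
  fixes lam :: "nat \<Rightarrow> real"
  assumes lam: "k \<in> I \<Longrightarrow> 0 \<le> lam k" "k \<in> I \<Longrightarrow> lam k \<le> 1"
    and lam_summable: "lam summable_on I"
begin

text \<open>Outside \<open>I\<close> nothing is assumed about \<open>lam\<close>; the parameter 0
  there gives a product of probability measures over all naturals.\<close>

definition bern :: "nat \<Rightarrow> bool measure" where
  "bern k = measure_pmf (bernoulli_pmf (if k \<in> I then lam k else 0))"

sublocale Om: product_prob_space bern UNIV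
  by (intro product_prob_spaceI) (simp add: bern_def measure_pmf.prob_space_axioms)

abbreviation \<Omega> :: "(nat \<Rightarrow> bool) measure" where "\<Omega> \<equiv> Pi\<^sub>M UNIV bern"

lemma prob_space_Om: "prob_space \<Omega>" by (rule prob_space_PiM) (simp add: bern_def measure_pmf.prob_space_axioms)

lemma sets_bern [simp]: "sets (bern k) = UNIV" by (simp add: bern_def)

lemma emeasure_bern:
  "k \<in> I \<Longrightarrow> emeasure (bern k) {b} = ennreal (if b then lam k else 1 - lam k)"
  using lam by (cases b) (simp_all add: bern_def emeasure_pmf_single)

definition sel :: "(nat \<Rightarrow> bool) \<Rightarrow> nat set" where "sel \<omega> = {k \<in> I. \<omega> k}"

text \<open>On the null event of an infinite selection the value is set to \<open>{}\<close>, so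
  that \<open>fsel\<close> takes values everywhere in a countable set of finite subsets.\<close>

definition fsel :: "(nat \<Rightarrow> bool) \<Rightarrow> nat set" where "fsel \<omega> = (if finite (sel \<omega>) then sel \<omega> else {})"

lemma sets_coord: "{\<omega> \<in> space \<Omega>. \<omega> k = b} \<in> sets \<Omega>"
proof -
  have "(\<lambda>\<omega>. \<omega> k) -` {b} \<inter> space \<Omega> \<in> sets \<Omega>"
    by (rule measurable_sets[OF measurable_component_singleton]) auto
  moreover have "(\<lambda>\<omega>. \<omega> k) -` {b} \<inter> space \<Omega> = {\<omega> \<in> space \<Omega>. \<omega> k = b}" by auto
  ultimately show ?thesis by simp
qed

lemma sets_sel_Int: "{\<omega> \<in> space \<Omega>. sel \<omega> \<inter> K = U} \<in> sets \<Omega>"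
proof -
  have "{\<omega> \<in> space \<Omega>. (k \<in> I \<and> \<omega> k \<and> k \<in> K) = (k \<in> U)} \<in> sets \<Omega>" for k
    using sets_coord[of k True] sets_coord[of k False] by (cases "k \<in> I \<and> k \<in> K"; cases "k \<in> U") auto
  then have "{\<omega> \<in> space \<Omega>. \<forall>k. (k \<in> I \<and> \<omega> k \<and> k \<in> K) = (k \<in> U)} \<in> sets \<Omega>"
    by (rule sets.sets_Collect_countable_All)
  moreover have "{\<omega> \<in> space \<Omega>. \<forall>k. (k \<in> I \<and> \<omega> k \<and> k \<in> K) = (k \<in> U)} = {\<omega> \<in> space \<Omega>. sel \<omega> \<inter> K = U}"
    by (auto simp: sel_def)
  ultimately show ?thesis by simp
qed

lemma measurable_sel_Int: "finite K \<Longrightarrow> (\<lambda>\<omega>. sel \<omega> \<inter> K) \<in> measurable \<Omega> (count_space (Pow K))"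
proof (subst measurable_count_space_eq_countable)
  assume "finite K"
  then show "countable (Pow K)" by (simp add: countable_finite)
  have "(\<lambda>\<omega>. sel \<omega> \<inter> K) -` {U} \<inter> space \<Omega> = {\<omega> \<in> space \<Omega>. sel \<omega> \<inter> K = U}" for U by auto
  then show "(\<lambda>\<omega>. sel \<omega> \<inter> K) \<in> space \<Omega> \<rightarrow> Pow K \<and> (\<forall>U\<in>Pow K. (\<lambda>\<omega>. sel \<omega> \<inter> K) -` {U} \<inter> space \<Omega> \<in> sets \<Omega>)"
    using sets_sel_Int by auto
qed

definition fsets :: "nat set set" where "fsets = {T. finite T \<and> T \<subseteq> I}"

lemma countable_fsets: "countable fsets"
  by (rule countable_subset[OF _ countable_Collect_finite]) (auto simp: fsets_def)

lemma fsel_in_fsets: "fsel \<omega> \<in> fsets" by (auto simp: fsel_def fsets_def sel_def)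

lemma fselD: "finite (fsel \<omega>)" "fsel \<omega> \<subseteq> I" using fsel_in_fsets[of \<omega>] by (auto simp: fsets_def)

lemma measurable_fsel: "fsel \<in> measurable \<Omega> (count_space fsets)"
proof (subst measurable_count_space_eq_countable[OF countable_fsets], intro conjI ballI)
  show "fsel \<in> space \<Omega> \<rightarrow> fsets" using fsel_in_fsets by auto
  have ne: "fsel -` {T} \<inter> space \<Omega> \<in> sets \<Omega>" if "T \<in> fsets - {{}}" for T
  proof -
    have "fsel -` {T} \<inter> space \<Omega> = {\<omega> \<in> space \<Omega>. sel \<omega> \<inter> UNIV = T}"
      using that by (auto simp: fsel_def fsets_def split: if_splits)
    then show ?thesis using sets_sel_Int[of UNIV T] by simp
  qed
  fix T assume T: "T \<in> fsets"
  show "fsel -` {T} \<inter> space \<Omega> \<in> sets \<Omega>"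
  proof (cases "T = {}")
    case True
    \<comment> \<open>The fibre over \<open>{}\<close> also contains the infinite selections, so it
      is obtained as the complement of the other fibres.\<close>
    have "fsel -` {{}} \<inter> space \<Omega> = space \<Omega> - (\<Union>T\<in>fsets - {{}}. fsel -` {T} \<inter> space \<Omega>)"
      using fsel_in_fsets by auto
    moreover have "(\<Union>T\<in>fsets - {{}}. fsel -` {T} \<inter> space \<Omega>) \<in> sets \<Omega>"
      using countable_fsets ne by (intro sets.countable_UN') auto
    ultimately show ?thesis using True by auto
  qed (use T ne in auto)
qed

text \<open>First Borel-Cantelli lemma: the selection probabilities are summable.\<close>

lemma AE_finite_sel: "AE \<omega> in \<Omega>. finite (sel \<omega>)"
proof -
  let ?A = "\<lambda>k. {\<omega> \<in> space \<Omega>. k \<in> I \<and> \<omega> k}"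
  have A: "?A k \<in> sets \<Omega>" for k using sets_coord[of k True] by (cases "k \<in> I") auto
  have m: "measure \<Omega> (?A k) = (if k \<in> I then lam k else 0)" for k
  proof (cases "k \<in> I")
    case True
    have "emeasure \<Omega> {\<omega> \<in> space \<Omega>. \<omega> k \<in> {True}} = emeasure (bern k) {True}"
      by (rule Om.emeasure_PiM_Collect_single) auto
    then show ?thesis using True lam by (simp add: measure_def emeasure_bern)
  qed simp
  have "(\<lambda>k. if k \<in> I then lam k else 0) summable_on UNIV"
    using lam_summable summable_on_cong_neutral[of I UNIV lam "\<lambda>k. if k \<in> I then lam k else 0"] by auto
  then have "summable (\<lambda>k. if k \<in> I then lam k else 0)"
    using lam by (subst (asm) summable_on_UNIV_nonneg_real_iff) auto
  then have "AE \<omega> in \<Omega>. eventually (\<lambda>k. \<omega> \<in> space \<Omega> - ?A k) sequentially"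
    using A by (intro borel_cantelli_AE1) (auto simp: m Om.P.emeasure_eq_measure)
  then show ?thesis
  proof (rule AE_mp, intro AE_I2 impI)
    fix \<omega> assume "\<omega> \<in> space \<Omega>" "eventually (\<lambda>k. \<omega> \<in> space \<Omega> - ?A k) sequentially"
    then obtain N where "\<And>k. k \<ge> N \<Longrightarrow> \<not> (k \<in> I \<and> \<omega> k)" by (auto simp: eventually_sequentially)
    then have "sel \<omega> \<subseteq> {..<N}" unfolding sel_def by (auto simp: not_less[symmetric])
    then show "finite (sel \<omega>)" by (rule finite_subset) simp
  qed
qed

text \<open>By independence the weights are those of \<open>moore_re_gram_expand\<close>; this
  coincidence turns the multi-affine expansion into an expectation.\<close>

lemma nn_integral_sel_Int:
  fixes f :: "nat set \<Rightarrow> ennreal"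
  assumes K: "finite K" "K \<subseteq> I"
  shows "(\<integral>\<^sup>+\<omega>. f (sel \<omega> \<inter> K) \<partial>\<Omega>) =
    (\<Sum>U\<in>Pow K. f U * ennreal ((\<Prod>s\<in>U. lam s) * (\<Prod>s\<in>K - U. 1 - lam s)))"
proof -
  let ?E = "\<lambda>U. {\<omega> \<in> space \<Omega>. \<forall>k\<in>K. \<omega> k \<in> {k \<in> U}}"
  have E: "?E U = {\<omega> \<in> space \<Omega>. sel \<omega> \<inter> K = U}" if "U \<subseteq> K" for U
    using that K by (auto simp: sel_def)
  have mE: "?E U \<in> sets \<Omega>" if "U \<in> Pow K" for U using E[of U] that sets_sel_Int by auto
  have "(\<integral>\<^sup>+\<omega>. f (sel \<omega> \<inter> K) \<partial>\<Omega>) = (\<integral>\<^sup>+\<omega>. (\<Sum>U\<in>Pow K. f U * indicator (?E U) \<omega>) \<partial>\<Omega>)"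
  proof (rule nn_integral_cong)
    fix \<omega> assume w: "\<omega> \<in> space \<Omega>"
    have "(\<Sum>U\<in>Pow K. f U * indicator (?E U) \<omega>) = (\<Sum>U\<in>Pow K. if sel \<omega> \<inter> K = U then f U else 0)"
    proof (intro sum.cong refl)
      fix U assume "U \<in> Pow K"
      then have "U \<subseteq> K" by simp
      from E[OF this] show "f U * indicator (?E U) \<omega> = (if sel \<omega> \<inter> K = U then f U else 0)"
        using w by (simp only:) (simp add: indicator_def)
    qed
    also have "\<dots> = f (sel \<omega> \<inter> K)" using sum.delta'[of "Pow K" "sel \<omega> \<inter> K" f] K(1) by simp
    finally show "f (sel \<omega> \<inter> K) = (\<Sum>U\<in>Pow K. f U * indicator (?E U) \<omega>)" ..
  qed
  also have "\<dots> = (\<Sum>U\<in>Pow K. f U * emeasure \<Omega> (?E U))"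
    using mE by (subst nn_integral_sum) (auto simp: nn_integral_cmult_indicator)
  also have "\<dots> = (\<Sum>U\<in>Pow K. f U * ennreal ((\<Prod>s\<in>U. lam s) * (\<Prod>s\<in>K - U. 1 - lam s)))"
  proof (intro sum.cong refl arg_cong2[where f = "(*)"])
    fix U assume U: "U \<in> Pow K"
    have "emeasure \<Omega> (?E U) = (\<Prod>k\<in>K. emeasure (bern k) {k \<in> U})"
      using K by (intro Om.emeasure_PiM_Collect) auto
    also have "\<dots> = (\<Prod>k\<in>K. ennreal (if k \<in> U then lam k else 1 - lam k))"
      using K by (intro prod.cong refl emeasure_bern) auto
    also have "\<dots> = ennreal (\<Prod>k\<in>K. if k \<in> U then lam k else 1 - lam k)"
      using K lam by (intro prod_ennreal) auto
    also have "(\<Prod>k\<in>K. if k \<in> U then lam k else 1 - lam k) = (\<Prod>s\<in>U. lam s) * (\<Prod>s\<in>K - U. 1 - lam s)"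
      using K U by (simp add: prod.If_cases Int_absorb1 Diff_eq[symmetric])
    finally show "emeasure \<Omega> (?E U) = ennreal ((\<Prod>s\<in>U. lam s) * (\<Prod>s\<in>K - U. 1 - lam s))" .
  qed
  finally show ?thesis .
qed

text \<open>Almost surely the truncated selections increase to the full one and become stationary,
  so monotone convergence reduces everything to finitely many independent coordinates.\<close>

lemma nn_integral_fsel_SUP:
  fixes f :: "nat set \<Rightarrow> ennreal"
  assumes mono: "\<And>U V. finite V \<Longrightarrow> V \<subseteq> I \<Longrightarrow> U \<subseteq> V \<Longrightarrow> f U \<le> f V"
  shows "(\<integral>\<^sup>+\<omega>. f (fsel \<omega>) \<partial>\<Omega>) = (SUP n. \<integral>\<^sup>+\<omega>. f (sel \<omega> \<inter> (I \<inter> {..<n})) \<partial>\<Omega>)"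
proof -
  have "(\<integral>\<^sup>+\<omega>. f (fsel \<omega>) \<partial>\<Omega>) = (\<integral>\<^sup>+\<omega>. (SUP n. f (sel \<omega> \<inter> (I \<inter> {..<n}))) \<partial>\<Omega>)"
  proof (rule nn_integral_cong_AE, rule AE_mp[OF AE_finite_sel], intro AE_I2 impI)
    fix \<omega> assume fin: "finite (sel \<omega>)"
    then obtain N where N: "sel \<omega> \<subseteq> {..<N}" unfolding finite_nat_iff_bounded ..
    have I: "sel \<omega> \<subseteq> I" by (auto simp: sel_def)
    have "(SUP n. f (sel \<omega> \<inter> (I \<inter> {..<n}))) = f (sel \<omega>)"
    proof (rule antisym)
      show "(SUP n. f (sel \<omega> \<inter> (I \<inter> {..<n}))) \<le> f (sel \<omega>)"
        using fin I by (intro SUP_least mono) auto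
      have "sel \<omega> \<inter> (I \<inter> {..<N}) = sel \<omega>" using N I by auto
      then show "f (sel \<omega>) \<le> (SUP n. f (sel \<omega> \<inter> (I \<inter> {..<n})))" by (intro SUP_upper2[of N]) auto
    qed
    then show "f (fsel \<omega>) = (SUP n. f (sel \<omega> \<inter> (I \<inter> {..<n})))" using fin by (simp add: fsel_def)
  qed
  also have "\<dots> = (SUP n. \<integral>\<^sup>+\<omega>. f (sel \<omega> \<inter> (I \<inter> {..<n})) \<partial>\<Omega>)"
  proof (rule nn_integral_monotone_convergence_SUP_AE)
    show "AE \<omega> in \<Omega>. f (sel \<omega> \<inter> (I \<inter> {..<n})) \<le> f (sel \<omega> \<inter> (I \<inter> {..<Suc n}))" for n
      by (intro AE_I2 mono) auto
    show "(\<lambda>\<omega>. f (sel \<omega> \<inter> (I \<inter> {..<n}))) \<in> borel_measurable \<Omega>" for n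
      by (rule measurable_compose[OF measurable_sel_Int]) auto
  qed
  finally show ?thesis .
qed

definition gram_trunc :: "nat \<Rightarrow> (nat \<Rightarrow> 'a) \<Rightarrow> nat \<Rightarrow> nat \<Rightarrow> cquat" where
  "gram_trunc n x = gram (I \<inter> {..<n}) lam (\<lambda>s a. u s (x a))"

text \<open>For each truncation the expected density is the Gram minor with weights
  \<open>lam\<close>, by the expansion over subsets.\<close>

lemma nn_integral_fsel_dens:
  assumes "finite J"
  shows "(\<integral>\<^sup>+\<omega>. ennreal (dens (fsel \<omega>) J x) \<partial>\<Omega>) = (SUP n. ennreal (moore_re J (gram_trunc n x)))"
proof -
  have "(\<integral>\<^sup>+\<omega>. ennreal (dens (fsel \<omega>) J x) \<partial>\<Omega>) = (SUP n. \<integral>\<^sup>+\<omega>. ennreal (dens (sel \<omega> \<inter> (I \<inter> {..<n})) J x) \<partial>\<Omega>)"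
  proof (rule nn_integral_fsel_SUP[where f = "\<lambda>U. ennreal (dens U J x)"])
    fix U V assume V: "finite V" "V \<subseteq> I" "U \<subseteq> V"
    have "dens U J x \<le> dens V J x"
      unfolding dens_def kern_def using V assms real by (intro moore_re_gram_mono) auto
    then show "ennreal (dens U J x) \<le> ennreal (dens V J x)" by (rule ennreal_leI)
  qed
  also have "(\<lambda>n. \<integral>\<^sup>+\<omega>. ennreal (dens (sel \<omega> \<inter> (I \<inter> {..<n})) J x) \<partial>\<Omega>) = (\<lambda>n. ennreal (moore_re J (gram_trunc n x)))"
  proof
    fix n
    let ?K = "I \<inter> {..<n}"
    let ?p = "\<lambda>U. (\<Prod>s\<in>U. lam s) * (\<Prod>s\<in>?K - U. 1 - lam s)"
    have p: "0 \<le> ?p U" if "U \<in> Pow ?K" for U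
      using that lam by (intro mult_nonneg_nonneg prod_nonneg) auto
    have d: "0 \<le> dens U J x" if "U \<in> Pow ?K" for U
      using that assms by (intro dens_nonneg) (auto intro: finite_subset)
    have "(\<integral>\<^sup>+\<omega>. ennreal (dens (sel \<omega> \<inter> ?K) J x) \<partial>\<Omega>) = (\<Sum>U\<in>Pow ?K. ennreal (dens U J x) * ennreal (?p U))"
      by (rule nn_integral_sel_Int[where f = "\<lambda>U. ennreal (dens U J x)"]) auto
    also have "\<dots> = (\<Sum>U\<in>Pow ?K. ennreal (?p U * dens U J x))"
      using p d by (intro sum.cong refl) (simp add: ennreal_mult mult.commute)
    also have "\<dots> = ennreal (\<Sum>U\<in>Pow ?K. ?p U * dens U J x)"
      by (intro sum_ennreal mult_nonneg_nonneg[OF p d])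
    also have "(\<Sum>U\<in>Pow ?K. ?p U * dens U J x) = moore_re J (gram_trunc n x)"
      unfolding gram_trunc_def dens_def kern_def using assms real
      by (intro moore_re_gram_expand[symmetric]) auto
    finally show "(\<integral>\<^sup>+\<omega>. ennreal (dens (sel \<omega> \<inter> ?K) J x) \<partial>\<Omega>) = ennreal (moore_re J (gram_trunc n x))" .
  qed
  finally show ?thesis .
qed

text \<open>The left side is \<open>fact k\<close> times a binomial coefficient. This lets one
  exponential moment of the number of points control all factorial moments.\<close>

lemma prod_diff_le: "(\<Prod>t<k. n - t) \<le> fact k * (2 ^ n :: nat)"
proof (cases "k \<le> n")
  case True
  have "(\<Prod>t<k. n - t) * fact (n - k) = fact k * (n choose k) * fact (n - k)"
    using prod_diff_mult_fact[OF True] binomial_fact_lemma[OF True] by (simp add: mult_ac)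
  then have "(\<Prod>t<k. n - t) = fact k * (n choose k)" by simp
  then show ?thesis using binomial_le_pow2[of n k] by simp
next
  case False
  then have "(\<Prod>t<k. n - t) = 0" by (intro prod_zero) (auto intro!: bexI[of _ n])
  then show ?thesis by (simp only: le0)
qed

text \<open>The generating function at 2 of independent Bernoulli variables is the product of
  \<open>1 + lam k\<close>, bounded by \<open>exp\<close> of the sum.\<close>

lemma nn_integral_pow_card_fsel: "(\<integral>\<^sup>+\<omega>. ennreal (2 ^ card (fsel \<omega>)) \<partial>\<Omega>) < \<infinity>"
proof -
  have "(\<integral>\<^sup>+\<omega>. ennreal (2 ^ card (fsel \<omega>)) \<partial>\<Omega>) = (SUP n. \<integral>\<^sup>+\<omega>. ennreal (2 ^ card (sel \<omega> \<inter> (I \<inter> {..<n}))) \<partial>\<Omega>)"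
    by (rule nn_integral_fsel_SUP[where f = "\<lambda>U. ennreal (2 ^ card U)"])
      (auto intro!: ennreal_leI power_increasing card_mono)
  also have "\<dots> \<le> ennreal (exp (infsum lam I))"
  proof (rule SUP_least)
    fix n
    let ?K = "I \<inter> {..<n}"
    let ?p = "\<lambda>U. (\<Prod>s\<in>U. lam s) * (\<Prod>s\<in>?K - U. 1 - lam s)"
    have p: "0 \<le> ?p U" if "U \<in> Pow ?K" for U
      using that lam by (intro mult_nonneg_nonneg prod_nonneg) auto
    have "(\<integral>\<^sup>+\<omega>. ennreal (2 ^ card (sel \<omega> \<inter> ?K)) \<partial>\<Omega>) = (\<Sum>U\<in>Pow ?K. ennreal (2 ^ card U) * ennreal (?p U))"
      by (rule nn_integral_sel_Int[where f = "\<lambda>U. ennreal (2 ^ card U)"]) auto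
    also have "\<dots> = (\<Sum>U\<in>Pow ?K. ennreal (2 ^ card U * ?p U))"
      using p by (intro sum.cong refl) (simp add: ennreal_mult)
    also have "\<dots> = ennreal (\<Sum>U\<in>Pow ?K. 2 ^ card U * ?p U)"
      by (intro sum_ennreal mult_nonneg_nonneg[OF _ p]) auto
    also have "(\<Sum>U\<in>Pow ?K. 2 ^ card U * ?p U) = (\<Sum>U\<in>Pow ?K. (\<Prod>s\<in>U. 2 * lam s) * (\<Prod>s\<in>?K - U. 1 - lam s))"
      by (simp add: prod.distrib mult.assoc)
    also have "\<dots> = (\<Prod>s\<in>?K. 2 * lam s + (1 - lam s))" by (rule prod_add[symmetric]) simp
    also have "\<dots> \<le> (\<Prod>s\<in>?K. exp (lam s))"
    proof (intro prod_mono conjI)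
      fix s assume s: "s \<in> ?K"
      then show "0 \<le> 2 * lam s + (1 - lam s)" using lam[of s] by auto
      show "2 * lam s + (1 - lam s) \<le> exp (lam s)" using exp_ge_add_one_self[of "lam s"] by (simp add: add.commute)
    qed
    also have "\<dots> = exp (sum lam ?K)" by (simp add: exp_sum)
    also have "\<dots> \<le> exp (infsum lam I)"
      using lam lam_summable by (auto intro!: finite_sum_le_infsum)
    finally show "(\<integral>\<^sup>+\<omega>. ennreal (2 ^ card (sel \<omega> \<inter> ?K)) \<partial>\<Omega>) \<le> ennreal (exp (infsum lam I))"
      by (simp add: ennreal_leI)
  qed
  also have "\<dots> < \<infinity>" by simp
  finally show ?thesis .
qed

lemma nn_integral_falling_card_fsel: "(\<integral>\<^sup>+\<omega>. of_nat (\<Prod>t<k. card (fsel \<omega>) - t) \<partial>\<Omega>) < \<infinity>"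
proof -
  have m: "(\<lambda>\<omega>. ennreal (2 ^ card (fsel \<omega>))) \<in> borel_measurable \<Omega>"
    by (rule measurable_compose[OF measurable_fsel]) auto
  have "(\<integral>\<^sup>+\<omega>. of_nat (\<Prod>t<k. card (fsel \<omega>) - t) \<partial>\<Omega>) \<le> (\<integral>\<^sup>+\<omega>. ennreal (fact k) * ennreal (2 ^ card (fsel \<omega>)) \<partial>\<Omega>)"
  proof (rule nn_integral_mono)
    fix \<omega>
    have "real (\<Prod>t<k. card (fsel \<omega>) - t) \<le> real (fact k * 2 ^ card (fsel \<omega>))"
      using prod_diff_le[of "card (fsel \<omega>)" k] by (simp only: of_nat_le_iff)
    then show "of_nat (\<Prod>t<k. card (fsel \<omega>) - t) \<le> ennreal (fact k) * ennreal (2 ^ card (fsel \<omega>))"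
      unfolding ennreal_of_nat_eq_real_of_nat by (subst ennreal_mult[symmetric]) (auto intro!: ennreal_leI)
  qed
  also have "\<dots> = ennreal (fact k) * (\<integral>\<^sup>+\<omega>. ennreal (2 ^ card (fsel \<omega>)) \<partial>\<Omega>)"
    by (rule nn_integral_cmult[OF m])
  also have "\<dots> < \<infinity>" using nn_integral_pow_card_fsel by (simp add: ennreal_mult_less_top)
  finally show ?thesis .
qed

section \<open>The point field\<close>

definition field :: "'a set measure" where "field = \<Omega> \<bind> (\<lambda>\<omega>. point_law (fsel \<omega>))"

lemma measurable_point_law_fsel:
  "(\<lambda>\<omega>. point_law (fsel \<omega>)) \<in> measurable \<Omega> (prob_algebra configuration_space)"
proof (rule measurable_compose_countable'[OF _ measurable_fsel countable_fsets])
  fix T assume "T \<in> fsets"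
  then show "(\<lambda>\<omega>. point_law T) \<in> measurable \<Omega> (prob_algebra configuration_space)"
    using prob_space_point_law[of T] by (intro measurable_const) (auto simp: fsets_def space_prob_algebra)
qed

lemma random_point_field_field: "random_point_field field"
proof -
  have O: "\<Omega> \<in> space (prob_algebra \<Omega>)" by (simp add: space_prob_algebra prob_space_Om)
  show ?thesis
    unfolding random_point_field_def field_def
    using prob_space_bind'[OF O measurable_point_law_fsel] sets_bind'[OF O measurable_point_law_fsel] by simp
qed

lemma nn_integral_field:
  assumes "f \<in> borel_measurable configuration_space"
  shows "(\<integral>\<^sup>+X. f X \<partial>field) = (\<integral>\<^sup>+\<omega>. \<integral>\<^sup>+X. f X \<partial>point_law (fsel \<omega>) \<partial>\<Omega>)"
  unfolding field_def
  by (rule nn_integral_bind[OF assms measurable_prob_algebraD[OF measurable_point_law_fsel]])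

text \<open>Kept in \<open>ennreal\<close>, since finiteness is obtained only almost everywhere,
  from integrability.\<close>

definition corr :: "nat \<Rightarrow> (nat \<Rightarrow> 'a) \<Rightarrow> ennreal" where
  "corr k x = (\<integral>\<^sup>+\<omega>. ennreal (dens (fsel \<omega>) {..<k} x) \<partial>\<Omega>)"

abbreviation MM :: "nat \<Rightarrow> (nat \<Rightarrow> 'a) measure" where "MM k \<equiv> Pi\<^sub>M {..<k} (\<lambda>_. M)"

text \<open>The random set has countably many values, and for each fixed value the density is
  measurable in the points.\<close>

lemma measurable_dens_joint:
  "(\<lambda>p. ennreal (dens (fsel (snd p)) {..<k} (fst p))) \<in> borel_measurable (MM k \<Otimes>\<^sub>M \<Omega>)"
proof (rule measurable_compose_countable'[OF _ measurable_compose[OF measurable_snd measurable_fsel] countable_fsets])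
  fix T assume "T \<in> fsets"
  then show "(\<lambda>p. ennreal (dens T {..<k} (fst p))) \<in> borel_measurable (MM k \<Otimes>\<^sub>M \<Omega>)"
    by (intro measurable_compose[OF measurable_fst] measurable_compose[OF borel_measurable_dens measurable_ennreal])
      (auto simp: fsets_def)
qed

lemma sigma_finite_Om: "sigma_finite_measure \<Omega>"
  using prob_space_Om by (simp add: prob_space_imp_sigma_finite)

lemma measurable_corr [measurable]: "corr k \<in> borel_measurable (MM k)"
  unfolding corr_def
  by (rule sigma_finite_measure.borel_measurable_nn_integral[OF sigma_finite_Om])
    (use measurable_dens_joint in \<open>simp add: split_def\<close>)

lemma nn_integral_corr:
  assumes h: "h \<in> borel_measurable (MM k)"
  shows "(\<integral>\<^sup>+\<omega>. \<integral>\<^sup>+x. ennreal (dens (fsel \<omega>) {..<k} x) * h x \<partial>MM k \<partial>\<Omega>) = (\<integral>\<^sup>+x. corr k x * h x \<partial>MM k)"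
proof -
  interpret O: sigma_finite_measure \<Omega> by (rule sigma_finite_Om)
  interpret N: sigma_finite_measure "MM k" by (rule P.sigma_finite) simp
  interpret NO: pair_sigma_finite "MM k" \<Omega> ..
  have "(\<integral>\<^sup>+\<omega>. \<integral>\<^sup>+x. ennreal (dens (fsel \<omega>) {..<k} x) * h x \<partial>MM k \<partial>\<Omega>) =
    (\<integral>\<^sup>+x. \<integral>\<^sup>+\<omega>. ennreal (dens (fsel \<omega>) {..<k} x) * h x \<partial>\<Omega> \<partial>MM k)"
    using borel_measurable_times_ennreal[OF measurable_dens_joint measurable_compose[OF measurable_fst h]]
    by (intro NO.Fubini') (simp add: split_def)
  also have "\<dots> = (\<integral>\<^sup>+x. corr k x * h x \<partial>MM k)"
  proof (rule nn_integral_cong)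
    fix x
    have "(\<lambda>\<omega>. ennreal (dens (fsel \<omega>) {..<k} x)) \<in> borel_measurable \<Omega>"
      by (rule measurable_compose[OF measurable_fsel]) auto
    then show "(\<integral>\<^sup>+\<omega>. ennreal (dens (fsel \<omega>) {..<k} x) * h x \<partial>\<Omega>) = corr k x * h x"
      unfolding corr_def by (rule nn_integral_multc)
  qed
  finally show ?thesis .
qed

text \<open>Tonelli turns the total mass into the factorial moment of the size of the random
  set.\<close>

lemma nn_integral_corr_finite: "(\<integral>\<^sup>+x. corr k x \<partial>MM k) < \<infinity>"
proof -
  have "(\<integral>\<^sup>+x. corr k x \<partial>MM k) = (\<integral>\<^sup>+\<omega>. \<integral>\<^sup>+x. ennreal (dens (fsel \<omega>) {..<k} x) \<partial>MM k \<partial>\<Omega>)"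
    using nn_integral_corr[of "\<lambda>_. 1" k] by simp
  also have "\<dots> = (\<integral>\<^sup>+\<omega>. of_nat (\<Prod>t<k. card (fsel \<omega>) - t) \<partial>\<Omega>)"
    using nn_integral_dens_total[OF fselD] by simp
  finally show ?thesis using nn_integral_falling_card_fsel by simp
qed

lemma nn_integral_field_falling:
  assumes A: "disjoint_family_on A {..<m}" "\<And>i. i < m \<Longrightarrow> A i \<in> sets borel" and k: "(\<Sum>i<m. ks i) = k"
  shows "(\<integral>\<^sup>+X. (\<Prod>i<m. falling_count (A i) (ks i) X) \<partial>field) =
    (\<integral>\<^sup>+x. corr k x * (\<Prod>t<k. indicator (A (block ks t)) (x t)) \<partial>MM k)"
proof -
  have "(\<lambda>x. indicator (A (block ks t)) (x t) :: ennreal) \<in> borel_measurable (MM k)" if "t < k" for t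
  proof -
    have "A (block ks t) \<in> sets M"
      using that unfolding k[symmetric] sets_M by (rule block_cases) (simp add: block_eq A)
    then show ?thesis
      using that by (intro measurable_compose[OF measurable_component_singleton borel_measurable_indicator]) auto
  qed
  then have h: "(\<lambda>x. \<Prod>t<k. indicator (A (block ks t)) (x t) :: ennreal) \<in> borel_measurable (MM k)"
    by (intro borel_measurable_prod_ennreal) auto
  have f: "(\<lambda>X. \<Prod>i<m. falling_count (A i) (ks i) X) \<in> borel_measurable configuration_space"
    using A by (intro borel_measurable_prod_ennreal measurable_falling_count) auto
  have "(\<integral>\<^sup>+X. (\<Prod>i<m. falling_count (A i) (ks i) X) \<partial>field) =
    (\<integral>\<^sup>+\<omega>. \<integral>\<^sup>+x. ennreal (dens (fsel \<omega>) {..<k} x) * (\<Prod>t<k. indicator (A (block ks t)) (x t)) \<partial>MM k \<partial>\<Omega>)"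
    unfolding nn_integral_field[OF f] using nn_integral_point_law_falling[OF fselD A k] by simp
  then show ?thesis using nn_integral_corr[OF h] by simp
qed

lemma expected_number_finite: "(\<integral>\<^sup>+X. num_points UNIV X \<partial>field) < \<infinity>"
proof -
  \<comment> \<open>The number of points is the factorial moment for a single block of length 1 with
    the set \<open>UNIV\<close>.\<close>
  have "num_points UNIV X = (\<Prod>i<1::nat. falling_count UNIV 1 X)" for X :: "'a set"
    by (simp add: falling_count_def)
  then have "(\<integral>\<^sup>+X. num_points UNIV X \<partial>field) = (\<integral>\<^sup>+x. corr 1 x \<partial>MM 1)"
    using nn_integral_field_falling[of "\<lambda>_. UNIV" 1 "\<lambda>_. 1" 1] by (simp add: disjoint_family_on_def)
  then show ?thesis using nn_integral_corr_finite[of 1] by simp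
qed

lemma AE_corr_finite: "AE x in MM k. ennreal (enn2real (corr k x)) = corr k x"
proof -
  have "AE x in MM k. corr k x \<noteq> \<infinity>"
    using nn_integral_corr_finite by (intro nn_integral_PInf_AE measurable_corr) (auto simp: less_top)
  then show ?thesis by eventually_elim (simp add: less_top)
qed

lemma correlation_function_field: "correlation_function M field k (\<lambda>x. enn2real (corr k x))"
  unfolding correlation_function_def
proof (intro conjI allI impI ballI)
  show m: "(\<lambda>x. enn2real (corr k x)) \<in> borel_measurable (MM k)" by measurable
  show "0 \<le> enn2real (corr k x)" for x by simp
  fix C :: "'a set" assume "compact C"
  then have "C \<in> sets M" unfolding sets_M by (intro borel_closed compact_imp_closed)
  then have "Pi\<^sub>E {..<k} (\<lambda>_. C) \<in> sets (MM k)" by (intro sets_PiM_I_finite) auto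
  moreover have "integrable (MM k) (\<lambda>x. enn2real (corr k x))"
  proof (rule integrableI_nonneg[OF m])
    have "(\<integral>\<^sup>+x. ennreal (enn2real (corr k x)) \<partial>MM k) = (\<integral>\<^sup>+x. corr k x \<partial>MM k)"
      by (intro nn_integral_cong_AE AE_corr_finite)
    then show "(\<integral>\<^sup>+x. ennreal (enn2real (corr k x)) \<partial>MM k) < \<infinity>" using nn_integral_corr_finite by simp
  qed simp
  ultimately show "set_integrable (MM k) (Pi\<^sub>E {..<k} (\<lambda>_. C)) (\<lambda>x. enn2real (corr k x))"
    unfolding set_integrable_def by (rule integrable_mult_indicator)
next
  fix m ks and A :: "nat \<Rightarrow> 'a set"
  assume A: "disjoint_family_on A {..<m} \<and> (\<forall>i<m. A i \<in> sets M) \<and> (\<Sum>i<m. ks i) = k"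
  have "(\<integral>\<^sup>+X. (\<Prod>i<m. falling_count (A i) (ks i) X) \<partial>field) =
    (\<integral>\<^sup>+x. corr k x * (\<Prod>t<k. indicator (A (block ks t)) (x t)) \<partial>MM k)"
    using A sets_M by (intro nn_integral_field_falling) auto
  also have "\<dots> = (\<integral>\<^sup>+x. ennreal (enn2real (corr k x)) * indicator (block_box m ks A) x \<partial>MM k)"
  \<comment> \<open>Where \<open>corr\<close> is infinite, \<open>enn2real\<close> would return 0;
    this happens only on a null set.\<close>
  proof (rule nn_integral_cong_AE, rule AE_mp[OF AE_corr_finite], intro AE_I2 impI)
    fix x assume x: "x \<in> space (MM k)" and c: "ennreal (enn2real (corr k x)) = corr k x"
    have "x \<in> block_box m ks A \<longleftrightarrow> (\<forall>t<k. x t \<in> A (block ks t))"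
      using x A unfolding block_box_iff by (auto simp: space_PiM PiE_def)
    then have "(\<Prod>t<k. indicator (A (block ks t)) (x t)) = (indicator (block_box m ks A) x :: ennreal)"
      by (auto simp: indicator_def intro!: prod_zero)
    then show "corr k x * (\<Prod>t<k. indicator (A (block ks t)) (x t)) = ennreal (enn2real (corr k x)) * indicator (block_box m ks A) x"
      unfolding c by simp
  qed
  finally show "(\<integral>\<^sup>+X. (\<Prod>i<m. falling_count (A i) (ks i) X) \<partial>field) =
    (\<integral>\<^sup>+x\<in>block_box m ks A. ennreal (enn2real (corr k x)) \<partial>MM k)" .
qed

end

section \<open>Identification of the correlation functions\<close>

lemma tendsto_cquat_mult:
  fixes f g :: "_ \<Rightarrow> cquat"
  assumes "(f \<longlongrightarrow> a) F" "(g \<longlongrightarrow> b) F" shows "((\<lambda>n. f n * g n) \<longlongrightarrow> a * b) F"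
  by (rule bounded_bilinear.tendsto[OF bounded_bilinear_cquat_mult assms])

lemma tendsto_row_path:
  fixes X :: "_ \<Rightarrow> nat \<Rightarrow> nat \<Rightarrow> cquat"
  assumes "\<And>a b. a \<in> insert e (set l) \<Longrightarrow> b \<in> insert b0 (set l) \<Longrightarrow> ((\<lambda>n. X n a b) \<longlongrightarrow> Y a b) F"
  shows "((\<lambda>n. row_path (X n) (X n e) l b0) \<longlongrightarrow> row_path Y (Y e) l b0) F"
  using assms
proof (induction l arbitrary: e)
  case (Cons c l)
  have "((\<lambda>n. row_path (X n) (X n c) l b0) \<longlongrightarrow> row_path Y (Y c) l b0) F"
    by (rule Cons.IH) (auto intro: Cons.prems)
  moreover have "((\<lambda>n. X n e c) \<longlongrightarrow> Y e c) F" by (rule Cons.prems) auto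
  ultimately show ?case by (simp add: tendsto_cquat_mult)
qed simp

text \<open>The recursion at the maximum is used because it holds for arbitrary matrices: the limit
  matrix is not known to be self-dual with real entries at all indices.\<close>

lemma tendsto_moore:
  assumes "finite J" "\<And>a b. a \<in> J \<Longrightarrow> b \<in> J \<Longrightarrow> ((\<lambda>n. X n a b) \<longlongrightarrow> Y a b) F"
  shows "((\<lambda>n. moore J (X n)) \<longlongrightarrow> moore J Y) F"
  using assms
proof (induction "card J" arbitrary: J rule: less_induct)
  case less
  show ?case
  proof (cases "J = {}")
    case False
    define a where "a = Max J"
    have a: "a \<in> J" using False less.prems by (simp add: a_def)
    show ?thesis
      unfolding moore_rec[OF less.prems(1) False a_def]
    proof (intro tendsto_sum tendsto_cquat_mult tendsto_const)
      fix l assume l: "l \<in> dlists (J - {a})"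
      show "((\<lambda>n. row_path (X n) (X n a) l a) \<longlongrightarrow> row_path Y (Y a) l a) F"
        using l a by (intro tendsto_row_path less.prems) (auto simp: dlists_def)
      show "((\<lambda>n. moore (J - {a} - set l) (X n)) \<longlongrightarrow> moore (J - {a} - set l) Y) F"
        using less.prems a by (intro less.hyps psubset_card_mono) auto
    qed
  qed simp
qed

section \<open>Almost everywhere statements on finite powers\<close>

context quat_system begin

text \<open>The measure may be infinite, so it need not be a marginal of its power. Integrating over
  coordinate \<open>j\<close> first already gives 0.\<close>

lemma AE_PiM_coord:
  fixes j :: nat
  assumes J: "finite J" "j \<in> J" and Q: "AE x in M. Q x"
  shows "AE x in Pi\<^sub>M J (\<lambda>_. M). Q (x j)"
proof -
  obtain N where N: "{x \<in> space M. \<not> Q x} \<subseteq> N" "emeasure M N = 0" "N \<in> sets M"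
    using Q by (rule AE_E)
  let ?E = "(\<lambda>x. x j) -` N \<inter> space (Pi\<^sub>M J (\<lambda>_. M))"
  have E: "?E \<in> sets (Pi\<^sub>M J (\<lambda>_. M))"
    using J N by (intro measurable_sets[OF measurable_component_singleton]) auto
  have J': "insert j (J - {j}) = J" using J by auto
  have "emeasure (Pi\<^sub>M J (\<lambda>_. M)) ?E = (\<integral>\<^sup>+x. indicator N (x j) \<partial>Pi\<^sub>M J (\<lambda>_. M))"
    unfolding nn_integral_indicator[OF E, symmetric] by (intro nn_integral_cong) (auto simp: indicator_def)
  also have "\<dots> = (\<integral>\<^sup>+x. \<integral>\<^sup>+y. indicator N ((x(j := y)) j) \<partial>M \<partial>Pi\<^sub>M (J - {j}) (\<lambda>_. M))"
  proof -
    have "(\<lambda>x. indicator N (x j) :: ennreal) \<in> borel_measurable (Pi\<^sub>M J (\<lambda>_. M))"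
      using J N by (intro measurable_compose[OF measurable_component_singleton borel_measurable_indicator]) auto
    then show ?thesis
      using P.product_nn_integral_insert[of "J - {j}" j "\<lambda>x. indicator N (x j)"] J(1)
      unfolding J' by simp
  qed
  also have "\<dots> = 0" using N by simp
  finally have "emeasure (Pi\<^sub>M J (\<lambda>_. M)) ?E = 0" .
  moreover have "{x \<in> space (Pi\<^sub>M J (\<lambda>_. M)). \<not> Q (x j)} \<subseteq> ?E"
    using N J by (auto simp: space_PiM)
  ultimately show ?thesis using E by (intro AE_I)
qed

text \<open>Almost every section of a null set of the product is null; the one-coordinate statement
  transfers this to the coordinate \<open>i\<close>, and \<open>j\<close> is integrated
  first.\<close>

lemma AE_PiM_pair:
  fixes i j :: nat
  assumes J: "finite J" "i \<in> J" "j \<in> J" "i \<noteq> j" and Q: "AE p in M \<Otimes>\<^sub>M M. Q (fst p) (snd p)"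
  shows "AE x in Pi\<^sub>M J (\<lambda>_. M). Q (x i) (x j)"
proof -
  obtain N where N: "{p \<in> space (M \<Otimes>\<^sub>M M). \<not> Q (fst p) (snd p)} \<subseteq> N" "emeasure (M \<Otimes>\<^sub>M M) N = 0" "N \<in> sets (M \<Otimes>\<^sub>M M)"
    using Q by (rule AE_E)
  let ?E = "(\<lambda>x. (x i, x j)) -` N \<inter> space (Pi\<^sub>M J (\<lambda>_. M))"
  have c: "(\<lambda>x. (x i, x j)) \<in> measurable (Pi\<^sub>M J (\<lambda>_. M)) (M \<Otimes>\<^sub>M M)"
    using J by (intro measurable_Pair measurable_component_singleton)
  have E: "?E \<in> sets (Pi\<^sub>M J (\<lambda>_. M))" using N by (intro measurable_sets[OF c])
  have J': "insert j (J - {j}) = J" using J by auto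
  interpret MM: pair_sigma_finite M M ..
  have "AE p in M \<Otimes>\<^sub>M M. p \<notin> N" using N by (intro AE_not_in) (auto simp: null_sets_def)
  then have "AE a in M. AE y in M. (a, y) \<notin> N" by (rule MM.AE_pair)
  then have "AE x in Pi\<^sub>M (J - {j}) (\<lambda>_. M). AE y in M. (x i, y) \<notin> N"
    using J by (intro AE_PiM_coord[where Q = "\<lambda>a. AE y in M. (a, y) \<notin> N"]) auto
  then have AE0: "AE x in Pi\<^sub>M (J - {j}) (\<lambda>_. M). (\<integral>\<^sup>+y. indicator N ((x(j := y)) i, (x(j := y)) j) \<partial>M) = (0 :: ennreal)"
  proof eventually_elim
    case (elim x)
    then have "AE y in M. indicator N ((x(j := y)) i, (x(j := y)) j) = (0 :: ennreal)"
      by eventually_elim (use J in auto)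
    from nn_integral_cong_AE[OF this] show ?case by simp
  qed
  have "emeasure (Pi\<^sub>M J (\<lambda>_. M)) ?E = (\<integral>\<^sup>+x. indicator N (x i, x j) \<partial>Pi\<^sub>M J (\<lambda>_. M))"
    unfolding nn_integral_indicator[OF E, symmetric] by (intro nn_integral_cong) (auto simp: indicator_def)
  also have "\<dots> = (\<integral>\<^sup>+x. \<integral>\<^sup>+y. indicator N ((x(j := y)) i, (x(j := y)) j) \<partial>M \<partial>Pi\<^sub>M (J - {j}) (\<lambda>_. M))"
  proof -
    have "(\<lambda>x. indicator N (x i, x j) :: ennreal) \<in> borel_measurable (Pi\<^sub>M J (\<lambda>_. M))"
      using N by (intro measurable_compose[OF c borel_measurable_indicator])
    then show ?thesis
      using P.product_nn_integral_insert[of "J - {j}" j "\<lambda>x. indicator N (x i, x j)"] J(1)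
      unfolding J' by simp
  qed
  also have "\<dots> = (\<integral>\<^sup>+x. 0 \<partial>Pi\<^sub>M (J - {j}) (\<lambda>_. M))" by (rule nn_integral_cong_AE[OF AE0])
  finally have "emeasure (Pi\<^sub>M J (\<lambda>_. M)) ?E = 0" by simp
  moreover have "{x \<in> space (Pi\<^sub>M J (\<lambda>_. M)). \<not> Q (x i) (x j)} \<subseteq> ?E"
  proof (rule subsetI)
    fix x assume "x \<in> {x \<in> space (Pi\<^sub>M J (\<lambda>_. M)). \<not> Q (x i) (x j)}"
    then have x: "x \<in> space (Pi\<^sub>M J (\<lambda>_. M))" "\<not> Q (x i) (x j)" by auto
    then have "(x i, x j) \<in> space (M \<Otimes>\<^sub>M M)" using J by (auto simp: space_PiM space_pair_measure PiE_iff)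
    then have "(x i, x j) \<in> N" using N(1) x(2) by force
    then show "x \<in> ?E" using x(1) by simp
  qed
  ultimately show ?thesis using E by (intro AE_I)
qed

text \<open>Equal indices use the diagonal clause of \<open>kernel_AE\<close>, distinct ones the
  clause on the product.\<close>

lemma kernel_AE_PiM:
  fixes J :: "nat set"
  assumes "kernel_AE M Q" "finite J"
  shows "AE x in Pi\<^sub>M J (\<lambda>_. M). \<forall>i\<in>J. \<forall>j\<in>J. Q (x i) (x j)"
proof (intro eventually_ball_finite assms ballI)
  fix i j assume ij: "i \<in> J" "j \<in> J"
  show "AE x in Pi\<^sub>M J (\<lambda>_. M). Q (x i) (x j)"
  proof (cases "i = j")
    case True
    then show ?thesis using AE_PiM_coord[of J i "\<lambda>a. Q a a"] assms ij by (simp add: kernel_AE_def)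
  next
    case False
    then show ?thesis using AE_PiM_pair assms ij by (simp add: kernel_AE_def)
  qed
qed

lemma kernel_AE_swap:
  assumes "kernel_AE M Q" shows "kernel_AE M (\<lambda>x y. Q y x)"
proof -
  interpret MM: pair_sigma_finite M M ..
  have "AE p in distr (M \<Otimes>\<^sub>M M) (M \<Otimes>\<^sub>M M) (\<lambda>(x, y). (y, x)). Q (fst p) (snd p)"
    unfolding MM.distr_pair_swap[symmetric] using assms by (simp add: kernel_AE_def)
  then have "AE p in M \<Otimes>\<^sub>M M. Q (fst (case p of (x, y) \<Rightarrow> (y, x))) (snd (case p of (x, y) \<Rightarrow> (y, x)))"
    by (rule AE_distrD[rotated]) (rule measurable_pair_swap')
  then show ?thesis using assms by (simp add: kernel_AE_def split_def)
qed

end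

section \<open>The limit of the truncated determinants\<close>

context pfaffian_data begin

definition expansion :: "('a \<Rightarrow> 'a \<Rightarrow> cquat) \<Rightarrow> 'a \<Rightarrow> 'a \<Rightarrow> bool" where
  "expansion K x y \<longleftrightarrow> (\<lambda>k. norm (lam k *\<^sub>R (u k x * qconj (u k y)))) summable_on I \<and>
       K x y = (\<Sum>\<^sub>\<infinity>k\<in>I. lam k *\<^sub>R (u k x * qconj (u k y)))"

lemma expansion_has_sum:
  "expansion K x y \<Longrightarrow> ((\<lambda>k. lam k *\<^sub>R (u k x * qconj (u k y))) has_sum K x y) I"
  unfolding expansion_def using abs_summable_summable[of "\<lambda>k. lam k *\<^sub>R (u k x * qconj (u k y))" I]
  by (metis has_sum_infsum)

lemma expansion_dual:
  assumes "expansion K x y" "expansion K y x" shows "K y x = qconj (K x y)"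
proof -
  have "((\<lambda>k. qconj (lam k *\<^sub>R (u k x * qconj (u k y)))) has_sum qconj (K x y)) I"
    using has_sum_bounded_linear[OF bounded_linear_qconj expansion_has_sum[OF assms(1)]] by (simp add: comp_def)
  then have "((\<lambda>k. lam k *\<^sub>R (u k y * qconj (u k x))) has_sum qconj (K x y)) I" by simp
  then show ?thesis using expansion_has_sum[OF assms(2)] by (metis infsumI)
qed

lemma self_dual_kernel_expansion:
  assumes "kernel_AE M (expansion K)" shows "self_dual_kernel M K"
proof -
  have "AE p in M \<Otimes>\<^sub>M M. expansion K (fst p) (snd p)" "AE p in M \<Otimes>\<^sub>M M. expansion K (snd p) (fst p)"
    "AE x in M. expansion K x x"
    using assms kernel_AE_swap[OF assms] by (simp_all add: kernel_AE_def)
  then show ?thesis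
    unfolding self_dual_kernel_def kernel_AE_def
    by (auto elim: eventually_mono eventually_elim2 intro: expansion_dual)
qed

text \<open>The initial segments of \<open>I\<close> are cofinal among its finite subsets, so an
  unordered sum is also their limit.\<close>

lemma gram_trunc_tendsto:
  assumes "expansion K (x a) (x b)"
  shows "(\<lambda>n. gram_trunc n x a b) \<longlonglongrightarrow> K (x a) (x b)"
proof -
  have "filterlim (\<lambda>n. I \<inter> {..<n}) (finite_subsets_at_top I) sequentially"
    unfolding filterlim_finite_subsets_at_top
  proof (intro allI impI)
    fix A assume A: "finite A \<and> A \<subseteq> I"
    then obtain N where "A \<subseteq> {..<N}" unfolding finite_nat_iff_bounded by blast
    then have "finite (I \<inter> {..<n}) \<and> A \<subseteq> I \<inter> {..<n} \<and> I \<inter> {..<n} \<subseteq> I" if "n \<ge> N" for n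
      using that A by auto
    then show "\<forall>\<^sub>F n in sequentially. finite (I \<inter> {..<n}) \<and> A \<subseteq> I \<inter> {..<n} \<and> I \<inter> {..<n} \<subseteq> I"
      by (auto simp: eventually_sequentially)
  qed
  from filterlim_compose[OF expansion_has_sum[OF assms, unfolded has_sum_def] this]
  show ?thesis unfolding gram_trunc_def gram_def .
qed

text \<open>The truncated minors have two limits: by continuity the determinant of \<open>K\<close>,
  by monotone convergence the expected density.\<close>

lemma moore_dyson_det_eq_corr:
  assumes "\<forall>i\<in>{..<m}. \<forall>j\<in>{..<m}. expansion K (x i) (x j)"
  shows "moore_dyson_det m (\<lambda>i j. K (x i) (x j)) = of_real (enn2real (corr m x))"
proof -
  define Z where "Z = moore {..<m} (\<lambda>i j. K (x i) (x j))"
  define D where "D n = moore_re {..<m} (gram_trunc n x)" for n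
  have sd: "self_dual_real (gram_trunc n x)" for n
    unfolding gram_trunc_def using real by (intro self_dual_real_gram) auto
  have "(\<lambda>n. moore {..<m} (gram_trunc n x)) \<longlonglongrightarrow> Z"
    unfolding Z_def using assms by (intro tendsto_moore gram_trunc_tendsto) auto
  then have lim: "(\<lambda>n. of_real (D n)) \<longlonglongrightarrow> Z" by (simp add: D_def moore_conv_moore_re sd)
  then have limD: "D \<longlonglongrightarrow> qre Z"
    using bounded_linear.tendsto[OF bounded_linear_qre lim] by simp
  \<comment> \<open>The truncations are real scalars; uniqueness of limits shows that
    \<open>Z\<close> is one too.\<close>
  then have "(\<lambda>n. of_real (D n)) \<longlonglongrightarrow> (of_real (qre Z) :: cquat)"
    unfolding of_real_def by (intro tendsto_scaleR tendsto_const)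
  then have Z: "Z = of_real (qre Z)" using lim by (rule LIMSEQ_unique[rotated])
  have "0 \<le> D n" for n
    unfolding D_def gram_trunc_def using real lam by (intro moore_re_gram_nonneg) auto
  then have nonneg: "0 \<le> qre Z" using limD by (intro LIMSEQ_le_const) auto
  have "incseq (\<lambda>n. ennreal (D n))"
    unfolding D_def gram_trunc_def using real lam
    by (intro incseq_SucI ennreal_leI moore_re_gram_mono) auto
  then have "(\<lambda>n. ennreal (D n)) \<longlonglongrightarrow> (SUP n. ennreal (D n))" by (rule LIMSEQ_SUP)
  moreover have "(\<lambda>n. ennreal (D n)) \<longlonglongrightarrow> ennreal (qre Z)" using limD by (rule tendsto_ennrealI)
  ultimately have "(SUP n. ennreal (D n)) = ennreal (qre Z)" by (rule LIMSEQ_unique)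
  then have "corr m x = ennreal (qre Z)" unfolding corr_def D_def by (simp add: nn_integral_fsel_dens)
  then have "enn2real (corr m x) = qre Z" using nonneg by simp
  then show ?thesis using Z unfolding moore_dyson_det_conv_moore Z_def[symmetric] by simp
qed

lemma pfaffian_point_field_field:
  assumes "kernel_AE M (expansion K)" shows "pfaffian_point_field M K field"
  unfolding pfaffian_point_field_def
proof (intro conjI allI impI exI)
  show "AE x in MM m. moore_dyson_det m (\<lambda>i j. K (x i) (x j)) = of_real (enn2real (corr m x))" for m
    using kernel_AE_PiM[OF assms, of "{..<m}"] by (auto elim!: eventually_mono intro: moore_dyson_det_eq_corr)
qed (use random_point_field_field self_dual_kernel_expansion[OF assms] correlation_function_field in auto)

end

theorem theorem1p3:
  fixes M :: "'a::t2_space measure"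
    and K :: "'a \<Rightarrow> 'a \<Rightarrow> cquat"
    and I :: "nat set"
    and lam :: "nat \<Rightarrow> real"
    and u :: "nat \<Rightarrow> 'a \<Rightarrow> cquat"
  assumes "sigma_finite_measure M"
    and "sets M = sets borel"
    and "real_diagonal_form M K I lam u"
    and "\<forall>k\<in>I. 0 \<le> lam k \<and> lam k \<le> 1"
    and "lam summable_on I"
  shows "\<exists>P. pfaffian_point_field M K P \<and> (\<integral>\<^sup>+X. num_points UNIV X \<partial>P) < \<infinity>"
proof -
  \<comment> \<open>The locale asks for real values of \<open>u k\<close> at every point of the
    type, while the diagonal form gives them on \<open>space M\<close>.\<close>
  have "space M = UNIV" using sets_eq_imp_space_eq[OF assms(2)] by simp
  then interpret pfaffian_data M I u lam
    using assms by (intro pfaffian_data.intro point_system.intro quat_system.intro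
        quat_system_axioms.intro point_system_axioms.intro pfaffian_data_axioms.intro)
      (auto simp: real_diagonal_form_def)
  have "kernel_AE M (expansion K)"
    using assms(3) by (simp add: real_diagonal_form_def expansion_def[abs_def])
  then show ?thesis using pfaffian_point_field_field expected_number_finite by blast
qed

end
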